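(* Let $K$ be a compact subset of $\mathcal{V}$ and let $\mathcal{U}$ be the interior of $K$. Then there are constants $C>0$ and $\mu_0>0$ such that for every $\mu\in(0,\mu_0)$ any point of $\mathcal{U}$ is $C\mu^{1/20}$-non-wandering under the flow $\phi_{H_\mu}$ of the Hamiltonian $H_\mu$. More concretely, for every $\mu\in(0,\mu_0)$ and every $z\in\mathcal{U}$ there are a neighborhood $\mathcal{V}_\mu$ of $z$ of size $O(\mu^{1/20})$ (contained in the ball of radius $C\mu^{1/20}$ around $z$) and times $0<T'_\mu<T_\mu$ such that $\phi_{H_\mu}(T'_\mu,\mathcal{V}_\mu)$ is $O(\mu^{1/20})$-close to a collision, i.e. its distance to the set $\{x=(1-\mu,0)\}$ is at most $C\mu^{1/20}$, and $$\phi_{H_\mu}(T_\mu,\mathcal{V}_\mu)\cap\mathcal{V}_\mu\neq\emptyset.$$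
   Context: For $\mu\in[0,1)$ the restricted circular planar 3 body problem in rotating coordinates is the Hamiltonian system (canonical symplectic form) with $$H_\mu(x,y)=\frac{|y|^2}{2}-x^tJy-\frac{\mu}{|x-(1-\mu,0)|}-\frac{1-\mu}{|x-(-\mu,0)|},\qquad J=\begin{pmatrix}0&1\\-1&0\end{pmatrix},\quad x,y\in\mathbb{R}^2 .$$ The flow $\phi_{H_\mu}(t,\cdot)$ may be incomplete because of collisions; $\phi_{H_\mu}(t,A)$ denotes the image of those points of $A$ whose orbit is defined up to time $t$. For $(x,y)$ with $\frac{|y|^2}{2}-\frac1{|x|}<0$, let $L>0$ be defined by $-\frac{1}{2L^2}=\frac{|y|^2}{2}-\frac{1}{|x|}$, let $G=x_1y_2-x_2y_1$ and $e=\sqrt{1-G^2/L^2}$ (so $L^2$ is the semimajor axis, $G$ the angular momentum, $e$ the eccentricity, and $H_0=-\frac1{2L^2}-G$). The set $\mathcal{V}\subset\mathbb{R}^4$ is $$\mathcal{V}=\Big\{(x,y):\ 0<|G|<L,\ \ \frac{G^2}{1+e}<1<\frac{G^2}{1-e},\ \ -2H_0\in(-2\sqrt2,3)\Big\}.$$ (Equivalently, the middle condition reads $L^2(1-e)<1<L^2(1+e)$.) Given a dynamical system $\{\phi_t\}$ and $\delta>0$, a point $x$ is called $\delta$-non-wandering if for any neighborhood $\mathcal{W}$ of $x$ containing the ball $B_\delta(x)$ of radius $\delta$ there exists $T>1$ such that $\phi_T(\mathcal{W})\cap\mathcal{W}\neq\emptyset$. *)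

theory Defs
  imports "HOL-Analysis.Analysis"
begin

type_synonym phase = "(real^2) \<times> (real^2)"

text \<open>Points of phase space are pairs \<open>(x, y)\<close> of position and momentum; the norm of the
  product type is the Euclidean norm of \<open>\<real>\<^sup>4\<close>.\<close>

text \<open>\<open>g = (H\<^sub>x, H\<^sub>y)\<close> is the gradient of \<open>H\<close>, so the equations are
  \<open>x' = H\<^sub>y\<close>, \<open>y' = - H\<^sub>x\<close>. The set \<open>D\<close> is the domain of
  \<open>H\<close>; it has to be recorded because \<open>H\<close> is a total function in HOL. The segment between
  \<open>0\<close> and \<open>t\<close> covers both signs of \<open>t\<close>.\<close>

definition hamiltonian_orbit ::
  "('a::real_inner \<times> 'a \<Rightarrow> real) \<Rightarrow> ('a \<times> 'a) set \<Rightarrow> real \<Rightarrow> (real \<Rightarrow> 'a \<times> 'a) \<Rightarrow> bool" where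
  "hamiltonian_orbit H D t \<gamma> \<longleftrightarrow>
     (\<forall>s\<in>closed_segment 0 t. \<gamma> s \<in> D \<and>
        (\<exists>g. (GDERIV H (\<gamma> s) :> g) \<and>
             (\<gamma> has_vector_derivative (snd g, - fst g)) (at s within closed_segment 0 t)))"

text \<open>The image of \<open>A\<close> under the possibly incomplete time-\<open>t\<close> flow: points of \<open>A\<close> whose orbit
  does not exist up to time \<open>t\<close> contribute nothing. When the vector field is locally Lipschitz on
  an open \<open>D\<close>, each point of \<open>A\<close> contributes at most one point.\<close>

definition hamiltonian_flow ::
  "('a::real_inner \<times> 'a \<Rightarrow> real) \<Rightarrow> ('a \<times> 'a) set \<Rightarrow> real \<Rightarrow> ('a \<times> 'a) set \<Rightarrow> ('a \<times> 'a) set" where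
  "hamiltonian_flow H D t A = {\<gamma> t | \<gamma>. hamiltonian_orbit H D t \<gamma> \<and> \<gamma> 0 \<in> A}"

text \<open>A dynamical system is given by its action \<open>\<Phi> t A\<close> on sets, so that incomplete flows
  are included.\<close>

definition non_wandering ::
  "(real \<Rightarrow> 'a::metric_space set \<Rightarrow> 'a set) \<Rightarrow> real \<Rightarrow> 'a \<Rightarrow> bool" where
  "non_wandering \<Phi> \<delta> x \<longleftrightarrow>
     (\<forall>W. x \<in> interior W \<and> ball x \<delta> \<subseteq> W \<longrightarrow> (\<exists>T>1. \<Phi> T W \<inter> W \<noteq> {}))"

definition J :: "real^2^2" where
  "J = vector [vector [0, 1], vector [-1, 0]]"

definition rc3bp_H :: "real \<Rightarrow> phase \<Rightarrow> real" where
  "rc3bp_H \<mu> = (\<lambda>(x, y).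
     (norm y)\<^sup>2 / 2 - x \<bullet> (J *v y)
       - \<mu> / norm (x - vector [1 - \<mu>, 0])
       - (1 - \<mu>) / norm (x - vector [- \<mu>, 0]))"

definition rc3bp_domain :: "real \<Rightarrow> phase set" where
  "rc3bp_domain \<mu> = {(x, y). x \<noteq> vector [1 - \<mu>, 0] \<and> x \<noteq> vector [- \<mu>, 0]}"

definition rc3bp_flow :: "real \<Rightarrow> real \<Rightarrow> phase set \<Rightarrow> phase set" where
  "rc3bp_flow \<mu> = hamiltonian_flow (rc3bp_H \<mu>) (rc3bp_domain \<mu>)"

definition collision_set :: "real \<Rightarrow> phase set" where
  "collision_set \<mu> = {(x, y). x = vector [1 - \<mu>, 0]}"

definition kepler_energy :: "phase \<Rightarrow> real" where
  "kepler_energy = (\<lambda>(x, y). (norm y)\<^sup>2 / 2 - 1 / norm x)"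

text \<open>Meaningful only where the Kepler energy is negative.\<close>

definition orb_L :: "phase \<Rightarrow> real" where
  "orb_L z = (THE L. L > 0 \<and> - 1 / (2 * L\<^sup>2) = kepler_energy z)"

definition orb_G :: "phase \<Rightarrow> real" where
  "orb_G = (\<lambda>(x, y). x $ 1 * y $ 2 - x $ 2 * y $ 1)"

definition orb_e :: "phase \<Rightarrow> real" where
  "orb_e z = sqrt (1 - (orb_G z)\<^sup>2 / (orb_L z)\<^sup>2)"

text \<open>With \<open>1 / 0 = 0\<close>, points with \<open>x = 0\<close> have nonnegative Kepler energy and are
  therefore excluded.\<close>

definition V_set :: "phase set" where
  "V_set = {z. kepler_energy z < 0 \<and>
     0 < \<bar>orb_G z\<bar> \<and> \<bar>orb_G z\<bar> < orb_L z \<and>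
     (orb_G z)\<^sup>2 / (1 + orb_e z) < 1 \<and> 1 < (orb_G z)\<^sup>2 / (1 - orb_e z) \<and>
     - 2 * rc3bp_H 0 z \<in> {- 2 * sqrt 2 <..< 3}}"

end

theory Submission
  imports Defs
begin

text \<open>For \<open>\<mu> = 0\<close> the system is the Kepler problem in rotating coordinates, and the orbits in \<open>V_set\<close>
  lie on ellipses that cross the unit circle transversally. Put \<open>\<delta> = \<mu>\<^sup>1\<^sup>/\<^sup>2\<^sup>0\<close> and \<open>N \<approx> 1 / \<delta>\<close>. A
  scaling and a rotation of size \<open>O(\<delta>)\<close> move a given point to one whose semimajor axis \<open>a\<close> satisfies
  \<open>a\<^sup>3\<^sup>/\<^sup>2 = j / N + 1 / N\<^sup>2\<close>; its Kepler orbit closes up after \<open>N\<^sup>2\<close> revolutions. The form of the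
  resonance makes the crossings with the unit circle \<open>O(\<delta>)\<close>-dense, so one of them is \<open>O(\<delta>)\<close>-close to the
  second primary, and the rotation can be chosen so that the whole orbit keeps a distance of order
  \<open>1 / N\<^sup>2 \<approx> \<delta>\<^sup>2\<close> from it. Along the orbit the perturbation is therefore \<open>O(\<mu> / \<delta>\<^sup>4)\<close>. In
  Levi-Civita coordinates the Kepler flow is linear and bounded, and over a time of order \<open>\<delta>\<^sup>-\<^sup>2\<close> the
  perturbed orbit deviates by at most \<open>O(\<mu> \<delta>\<^sup>-\<^sup>4 \<delta>\<^sup>-\<^sup>6) = O(\<delta>\<^sup>1\<^sup>0)\<close>, much less than \<open>\<delta>\<^sup>2\<close>. A single
  orbit thus provides both the near collision and the return.\<close>

section \<open>Existence of solutions\<close>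

text \<open>Two demands on the same orbit compete: it must come close to the second primary, and the
  force must nevertheless stay small until the return. The resonance
  \<open>j / N + 1 / N\<^sup>2\<close> is chosen because its N-fold multiple is 1 / N modulo 1,
  whatever divisors j and N have in common. So j may come from plain rounding, and no arithmetic of
  j enters. The denominator N^2 also limits the number of crossing points, hence how closely they
  can crowd around the second primary. Levi-Civita coordinates are used for the linearity of the
  flow and not for passing through a collision: on a compact set the condition G \<noteq> 0 keeps
  the Kepler orbits at a uniform distance from the origin.\<close>

lemma norm_diff_le_of_vector_derivative:
  fixes f :: "real \<Rightarrow> 'a::real_normed_vector"
  assumes "\<And>s. s \<in> {a..b} \<Longrightarrow> (f has_vector_derivative f' s) (at s within {a..b})"
    and "\<And>s. s \<in> {a..b} \<Longrightarrow> norm (f' s) \<le> B"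
    and "x \<in> {a..b}" "y \<in> {a..b}"
  shows "norm (f x - f y) \<le> B * \<bar>x - y\<bar>"
proof -
  have B0: "0 \<le> B" using assms(2)[OF assms(3)] norm_ge_zero order_trans by blast
  have "norm (f x - f y) \<le> B * norm (x - y)"
  proof (rule differentiable_bound[of "{a..b}" f "\<lambda>s h. h *\<^sub>R f' s"])
    fix s assume "s \<in> {a..b}"
    then show "(f has_derivative (\<lambda>h. h *\<^sub>R f' s)) (at s within {a..b})"
      using assms(1) by (simp add: has_vector_derivative_def)
    show "onorm (\<lambda>h. h *\<^sub>R f' s) \<le> B"
      by (rule onorm_bound[OF B0])
        (use assms(2)[OF \<open>s \<in> {a..b}\<close>] in \<open>simp add: mult.commute[of B] mult_left_mono\<close>)
  qed (use assms in auto)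
  then show ?thesis by simp
qed

text \<open>The weight \<open>exp (-2 K s)\<close> makes the
  integral operator a contraction on the whole interval at once.\<close>

lemma picard_global:
  fixes f :: "real \<Rightarrow> 'a::banach \<Rightarrow> 'a"
  assumes S: "0 \<le> S" and K: "0 < K"
    and cont: "continuous_on ({0..S} \<times> UNIV) (\<lambda>(s, u). f s u)"
    and lip: "\<And>s u v. s \<in> {0..S} \<Longrightarrow> norm (f s u - f s v) \<le> K * norm (u - v)"
  obtains u where "u 0 = u0"
    and "\<And>s. s \<in> {0..S} \<Longrightarrow> (u has_vector_derivative f s (u s)) (at s within {0..S})"
proof -
  \<comment> \<open>Times are clamped to the interval, because the fixed point is sought among
    bounded continuous functions on the whole line.\<close>
  define c where "c s = max 0 (min s S)" for s :: real
  have c_in: "c s \<in> {0..S}" for s using S by (auto simp: c_def)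
  have c_id: "c s = s" if "s \<in> {0..S}" for s using that by (auto simp: c_def)
  have c_cont: "continuous_on UNIV c" unfolding c_def by (intro continuous_intros)
  have fcomp: "continuous_on {0..S} (\<lambda>s. f s (g s))" if "continuous_on {0..S} g" for g
  proof -
    have "continuous_on {0..S} ((\<lambda>(s, u). f s u) \<circ> (\<lambda>s. (s, g s)))"
      by (rule continuous_on_compose)
        (auto intro!: continuous_intros that continuous_on_subset[OF cont])
    then show ?thesis by (simp add: o_def)
  qed
  \<comment> \<open>\<open>\<phi>\<close> is the weighted unknown; the solution itself is
    \<open>exp (2 * K * s) *\<^sub>R \<phi> s\<close>.\<close>
  define g where "g \<phi> s = f s (exp (2 * K * s) *\<^sub>R \<phi> s)" for \<phi> :: "real \<Rightarrow> 'a" and s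
  have g_cont: "continuous_on {0..S} (g \<phi>)" if "continuous_on {0..S} \<phi>" for \<phi>
    unfolding g_def by (intro fcomp continuous_intros that)
  define F where "F \<phi> s = exp (- 2 * K * c s) *\<^sub>R (u0 + integral {0..c s} (g \<phi>))" for \<phi> s
  have F_bcont: "F \<phi> \<in> bcontfun" if "continuous_on {0..S} \<phi>" for \<phi>
  proof -
    have i: "continuous_on {0..S} (\<lambda>s. integral {0..s} (g \<phi>))"
      by (intro indefinite_integral_continuous_1 integrable_continuous_real g_cont that)
    have ii: "continuous_on {0..S} (\<lambda>s. exp (- 2 * K * s) *\<^sub>R (u0 + integral {0..s} (g \<phi>)))"
      by (intro continuous_intros i)
    have "continuous_on UNIV ((\<lambda>s. exp (- 2 * K * s) *\<^sub>R (u0 + integral {0..s} (g \<phi>))) \<circ> c)"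
      by (rule continuous_on_compose[OF c_cont continuous_on_subset[OF ii]]) (use c_in in auto)
    moreover have "F \<phi> = (\<lambda>s. exp (- 2 * K * s) *\<^sub>R (u0 + integral {0..s} (g \<phi>))) \<circ> c"
      by (simp add: F_def fun_eq_iff)
    moreover have "bounded ((\<lambda>s. exp (- 2 * K * s) *\<^sub>R (u0 + integral {0..s} (g \<phi>))) ` {0..S})"
      by (intro compact_imp_bounded compact_continuous_image ii compact_Icc)
    ultimately show ?thesis using c_in
      by (auto simp: bcontfun_def intro: bounded_subset)
  qed
  define T where "T \<phi> = Bcontfun (F (apply_bcontfun \<phi>))" for \<phi> :: "real \<Rightarrow>\<^sub>C 'a"
  have T_apply: "apply_bcontfun (T \<phi>) = F (apply_bcontfun \<phi>)" for \<phi>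
    unfolding T_def by (rule Bcontfun_inverse) (rule F_bcont, simp)
  have contr: "dist (T \<phi>) (T \<psi>) \<le> 1/2 * dist \<phi> \<psi>" for \<phi> \<psi>
  proof (rule dist_bound)
    fix s
    define D where "D = dist \<phi> \<psi>"
    let ?s = "c s"
    have s0: "0 \<le> ?s" "{0..?s} \<subseteq> {0..S}" using c_in[of s] by auto
    have int: "g (apply_bcontfun \<phi>) integrable_on {0..?s}" for \<phi>
      by (intro integrable_continuous_real continuous_on_subset[OF g_cont] s0) simp
    have b: "norm (g (apply_bcontfun \<phi>) \<sigma> - g (apply_bcontfun \<psi>) \<sigma>) \<le> K * exp (2 * K * \<sigma>) * D"
      if "\<sigma> \<in> {0..?s}" for \<sigma>
    proof -
      have "norm (g (apply_bcontfun \<phi>) \<sigma> - g (apply_bcontfun \<psi>) \<sigma>)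
          \<le> K * norm (exp (2 * K * \<sigma>) *\<^sub>R apply_bcontfun \<phi> \<sigma> - exp (2 * K * \<sigma>) *\<^sub>R apply_bcontfun \<psi> \<sigma>)"
        unfolding g_def using that s0 by (intro lip) auto
      also have "\<dots> = K * (exp (2 * K * \<sigma>) * dist (apply_bcontfun \<phi> \<sigma>) (apply_bcontfun \<psi> \<sigma>))"
        by (simp add: dist_norm flip: scaleR_diff_right)
      also have "\<dots> \<le> K * (exp (2 * K * \<sigma>) * D)"
        unfolding D_def using K by (intro mult_left_mono dist_bounded) auto
      finally show ?thesis by simp
    qed
    \<comment> \<open>The exponent 2 K against the Lipschitz constant K makes the integral half of
      the weight, whence the contraction factor 1/2.\<close>
    have hi: "((\<lambda>\<sigma>. K * exp (2 * K * \<sigma>) * D) has_integral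
        (exp (2 * K * ?s) * D / 2 - exp (2 * K * 0) * D / 2)) {0..?s}"
      by (rule fundamental_theorem_of_calculus[OF s0(1)])
        (use K in \<open>auto intro!: derivative_eq_intros simp flip: has_real_derivative_iff_has_vector_derivative\<close>)
    have "dist (apply_bcontfun (T \<phi>) s) (apply_bcontfun (T \<psi>) s)
        = exp (- 2 * K * ?s) * norm (integral {0..?s} (g (apply_bcontfun \<phi>)) - integral {0..?s} (g (apply_bcontfun \<psi>)))"
      by (simp add: T_apply F_def dist_norm flip: scaleR_diff_right)
    also have "integral {0..?s} (g (apply_bcontfun \<phi>)) - integral {0..?s} (g (apply_bcontfun \<psi>))
        = integral {0..?s} (\<lambda>\<sigma>. g (apply_bcontfun \<phi>) \<sigma> - g (apply_bcontfun \<psi>) \<sigma>)"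
      by (simp add: integral_diff int)
    also have "exp (- 2 * K * ?s) * norm \<dots> \<le> exp (- 2 * K * ?s) * (exp (2 * K * ?s) * D / 2 - exp (2 * K * 0) * D / 2)"
    proof (rule mult_left_mono)
      show "norm (integral {0..?s} (\<lambda>\<sigma>. g (apply_bcontfun \<phi>) \<sigma> - g (apply_bcontfun \<psi>) \<sigma>))
          \<le> exp (2 * K * ?s) * D / 2 - exp (2 * K * 0) * D / 2"
        unfolding integral_unique[OF hi, symmetric]
        using hi by (intro integral_norm_bound_integral integrable_diff int b) auto
    qed simp
    also have "\<dots> = D / 2 - exp (- 2 * K * ?s) * D / 2"
      by (simp add: algebra_simps flip: exp_add)
    also have "\<dots> \<le> D / 2" by (simp add: D_def)
    finally show "dist (apply_bcontfun (T \<phi>) s) (apply_bcontfun (T \<psi>) s) \<le> 1/2 * dist \<phi> \<psi>"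
      by (simp add: D_def)
  qed
  obtain \<phi> where \<phi>: "T \<phi> = \<phi>"
    using banach_fix_type[of "1/2" T] contr by auto
  define u where "u s = exp (2 * K * s) *\<^sub>R apply_bcontfun \<phi> s" for s
  have u_eq: "u s = u0 + integral {0..s} (\<lambda>s. f s (u s))" if "s \<in> {0..S}" for s
  proof -
    have "apply_bcontfun \<phi> s = F (apply_bcontfun \<phi>) s" using \<phi> T_apply by metis
    then show ?thesis
      by (simp add: u_def F_def c_id[OF that] g_def[abs_def] flip: exp_add)
  qed
  show ?thesis
  proof (rule that)
    show "u 0 = u0" using u_eq[of 0] S by simp
    fix s assume s: "s \<in> {0..S}"
    have "continuous_on {0..S} (\<lambda>s. f s (u s))"
      unfolding u_def by (intro fcomp continuous_intros) auto
    from integral_has_vector_derivative[OF this s]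
    have "((\<lambda>s. u0 + integral {0..s} (\<lambda>s. f s (u s))) has_vector_derivative f s (u s)) (at s within {0..S})"
      by (auto intro!: derivative_eq_intros)
    then show "(u has_vector_derivative f s (u s)) (at s within {0..S})"
      by (rule has_vector_derivative_transform[OF s, rotated]) (use u_eq in auto)
  qed
qed

text \<open>Retracting the state onto \<open>B\<close> turns a field that is Lipschitz on \<open>B\<close> only into a global one.\<close>

lemma picard_closest_point:
  fixes f :: "real \<Rightarrow> 'a::euclidean_space \<Rightarrow> 'a"
  assumes S: "0 \<le> S" and B: "convex B" "closed B" "B \<noteq> {}"
    and cont: "continuous_on ({0..S} \<times> B) (\<lambda>(s, u). f s u)"
    and lip: "\<And>s u v. s \<in> {0..S} \<Longrightarrow> u \<in> B \<Longrightarrow> v \<in> B \<Longrightarrow> norm (f s u - f s v) \<le> K * norm (u - v)"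
  obtains u where "u 0 = u0"
    and "\<And>s. s \<in> {0..S} \<Longrightarrow>
      (u has_vector_derivative f s (closest_point B (u s))) (at s within {0..S})"
proof -
  let ?P = "closest_point B"
  have P: "?P u \<in> B" for u using B by (simp add: closest_point_in_set)
  have cont': "continuous_on ({0..S} \<times> UNIV) (\<lambda>(s, u). f s (?P u))"
  proof -
    have "continuous_on ({0..S} \<times> UNIV) ((\<lambda>(s, u). f s u) \<circ> (\<lambda>x. (fst x, ?P (snd x))))"
    proof (rule continuous_on_compose)
      show "continuous_on ({0..S} \<times> UNIV) (\<lambda>x. (fst x, ?P (snd x)))"
        by (intro continuous_intros continuous_on_compose2[OF continuous_on_closest_point[OF B]]) auto
      show "continuous_on ((\<lambda>x. (fst x, ?P (snd x))) ` ({0..S} \<times> UNIV)) (\<lambda>(s, u). f s u)"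
        by (rule continuous_on_subset[OF cont]) (use P in auto)
    qed
    then show ?thesis by (simp add: o_def case_prod_beta)
  qed
  \<comment> \<open>The closest-point map does not increase distances. \<open>K\<close> may fail to
    be positive, as the global lemma demands; hence \<open>max K 1\<close>.\<close>
  have "norm (f s (?P u) - f s (?P v)) \<le> max K 1 * norm (u - v)" if "s \<in> {0..S}" for s u v
  proof -
    have "norm (f s (?P u) - f s (?P v)) \<le> K * norm (?P u - ?P v)"
      by (intro lip that P)
    also have "\<dots> \<le> max K 1 * norm (u - v)"
      using closest_point_lipschitz[OF B, of u v] by (intro mult_mono) (auto simp: dist_norm)
    finally show ?thesis .
  qed
  moreover have "0 < max K 1" by simp
  ultimately obtain u where "u 0 = u0"
    "\<And>s. s \<in> {0..S} \<Longrightarrow> (u has_vector_derivative f s (?P (u s))) (at s within {0..S})"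
    using picard_global[OF S _ cont', of "max K 1" u0] by blast
  then show ?thesis by (rule that)
qed

section \<open>The perturbing force\<close>

text \<open>The bound on the values belongs to the notion because products of Lipschitz maps need
  not be Lipschitz without it. The field of the variation of constants is assembled from coordinates
  and functions of time by sums, products, linear maps and compositions, so its Lipschitz bound
  follows from closure rules.\<close>

definition unif_lipschitz ::
  "real set \<Rightarrow> 'a::real_normed_vector set \<Rightarrow> (real \<Rightarrow> 'a \<Rightarrow> 'b::real_normed_vector) \<Rightarrow> bool" where
  "unif_lipschitz I U g \<longleftrightarrow>
     continuous_on (I \<times> U) (\<lambda>(s, u). g s u) \<and>
     (\<exists>B\<ge>0. \<forall>s\<in>I. \<forall>u\<in>U. norm (g s u) \<le> B) \<and>
     (\<exists>L\<ge>0. \<forall>s\<in>I. \<forall>u\<in>U. \<forall>v\<in>U. norm (g s u - g s v) \<le> L * norm (u - v))"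

lemma unif_lipschitzI:
  assumes "continuous_on (I \<times> U) (\<lambda>(s, u). g s u)"
    and "\<And>s u. s \<in> I \<Longrightarrow> u \<in> U \<Longrightarrow> norm (g s u) \<le> B"
    and "\<And>s u v. s \<in> I \<Longrightarrow> u \<in> U \<Longrightarrow> v \<in> U \<Longrightarrow> norm (g s u - g s v) \<le> L * norm (u - v)"
  shows "unif_lipschitz I U g"
proof -
  have "norm (g s u) \<le> max B 0" if "s \<in> I" "u \<in> U" for s u
    using assms(2)[OF that] by simp
  moreover have "norm (g s u - g s v) \<le> max L 0 * norm (u - v)" if "s \<in> I" "u \<in> U" "v \<in> U" for s u v
    using order_trans[OF assms(3)[OF that] mult_right_mono[of L "max L 0"]] by simp
  ultimately show ?thesis unfolding unif_lipschitz_def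
    by (metis assms(1) max.cobounded2)
qed

lemma unif_lipschitz_const:
  assumes "compact I" "continuous_on I c"
  shows "unif_lipschitz I U (\<lambda>s u. c s)"
proof -
  have "bounded (c ` I)" using assms by (intro compact_imp_bounded compact_continuous_image)
  then obtain B where "B > 0" "\<And>s. s \<in> I \<Longrightarrow> norm (c s) \<le> B"
    unfolding bounded_pos by auto
  moreover have "continuous_on (I \<times> U) (\<lambda>(s, u). c s)"
    unfolding case_prod_beta by (intro continuous_on_compose2[OF assms(2)] continuous_intros) auto
  ultimately show ?thesis by (intro unif_lipschitzI[where B = B and L = 0]) auto
qed

lemma unif_lipschitz_id: "bounded U \<Longrightarrow> unif_lipschitz I U (\<lambda>s u. u)"
  unfolding bounded_pos
  by (elim exE, rule unif_lipschitzI[where L = 1]) (auto simp: case_prod_beta intro!: continuous_intros)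

lemma unif_lipschitz_linear:
  assumes "bounded_linear T" "unif_lipschitz I U g"
  shows "unif_lipschitz I U (\<lambda>s u. T (g s u))"
proof -
  interpret bounded_linear T by fact
  obtain K where K: "K \<ge> 0" "\<And>x. norm (T x) \<le> norm x * K" using nonneg_bounded by auto
  obtain B L where B: "B \<ge> 0" "\<And>s u. s \<in> I \<Longrightarrow> u \<in> U \<Longrightarrow> norm (g s u) \<le> B"
    and L: "L \<ge> 0" "\<And>s u v. s \<in> I \<Longrightarrow> u \<in> U \<Longrightarrow> v \<in> U \<Longrightarrow> norm (g s u - g s v) \<le> L * norm (u - v)"
    and c: "continuous_on (I \<times> U) (\<lambda>(s, u). g s u)"
    using assms(2) unfolding unif_lipschitz_def by auto
  have "norm (T (g s u)) \<le> B * K" if "s \<in> I" "u \<in> U" for s u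
    using K(2)[of "g s u"] mult_right_mono[OF B(2)[OF that] K(1)] by linarith
  moreover have "norm (T (g s u) - T (g s v)) \<le> (L * K) * norm (u - v)"
    if "s \<in> I" "u \<in> U" "v \<in> U" for s u v
    using K(2)[of "g s u - g s v"] mult_right_mono[OF L(2)[OF that] K(1)] by (simp add: diff mult_ac)
  moreover have "continuous_on (I \<times> U) (\<lambda>(s, u). T (g s u))"
    using c unfolding case_prod_beta by (rule continuous_on)
  ultimately show ?thesis by (rule unif_lipschitzI[rotated])
qed

lemma unif_lipschitz_add:
  assumes "unif_lipschitz I U f" "unif_lipschitz I U g"
  shows "unif_lipschitz I U (\<lambda>s u. f s u + g s u)"
proof -
  obtain B L where B: "B \<ge> 0" "\<And>s u. s \<in> I \<Longrightarrow> u \<in> U \<Longrightarrow> norm (g s u) \<le> B"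
    and L: "L \<ge> 0" "\<And>s u v. s \<in> I \<Longrightarrow> u \<in> U \<Longrightarrow> v \<in> U \<Longrightarrow> norm (g s u - g s v) \<le> L * norm (u - v)"
    and c: "continuous_on (I \<times> U) (\<lambda>(s, u). g s u)"
    using assms(2) unfolding unif_lipschitz_def by auto
  obtain B' L' where B': "B' \<ge> 0" "\<And>s u. s \<in> I \<Longrightarrow> u \<in> U \<Longrightarrow> norm (f s u) \<le> B'"
    and L': "L' \<ge> 0" "\<And>s u v. s \<in> I \<Longrightarrow> u \<in> U \<Longrightarrow> v \<in> U \<Longrightarrow> norm (f s u - f s v) \<le> L' * norm (u - v)"
    and c': "continuous_on (I \<times> U) (\<lambda>(s, u). f s u)"
    using assms(1) unfolding unif_lipschitz_def by auto
  have "norm (f s u + g s u) \<le> B' + B" if "s \<in> I" "u \<in> U" for s u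
    using norm_triangle_mono[OF B'(2)[OF that] B(2)[OF that]] .
  moreover have "norm (f s u + g s u - (f s v + g s v)) \<le> (L' + L) * norm (u - v)"
    if "s \<in> I" "u \<in> U" "v \<in> U" for s u v
    using norm_triangle_mono[OF L'(2)[OF that] L(2)[OF that]] by (simp add: algebra_simps)
  moreover have "continuous_on (I \<times> U) (\<lambda>(s, u). f s u + g s u)"
    using c c' unfolding case_prod_beta by (rule continuous_on_add[rotated])
  ultimately show ?thesis by (rule unif_lipschitzI[rotated])
qed

lemma unif_lipschitz_Pair:
  assumes "unif_lipschitz I U f" "unif_lipschitz I U g"
  shows "unif_lipschitz I U (\<lambda>s u. (f s u, g s u))"
proof -
  have "unif_lipschitz I U (\<lambda>s u. (f s u, 0))"
    by (rule unif_lipschitz_linear[OF _ assms(1)]) (auto intro!: bounded_linear_Pair bounded_linear_ident bounded_linear_zero)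
  moreover have "unif_lipschitz I U (\<lambda>s u. (0, g s u))"
    by (rule unif_lipschitz_linear[OF _ assms(2)]) (auto intro!: bounded_linear_Pair bounded_linear_ident bounded_linear_zero)
  ultimately have "unif_lipschitz I U (\<lambda>s u. (f s u, 0) + (0, g s u))" by (rule unif_lipschitz_add)
  then show ?thesis by simp
qed

lemma unif_lipschitz_mult:
  fixes f g :: "real \<Rightarrow> 'a::real_normed_vector \<Rightarrow> 'b::real_normed_algebra"
  assumes "unif_lipschitz I U f" "unif_lipschitz I U g"
  shows "unif_lipschitz I U (\<lambda>s u. f s u * g s u)"
proof -
  obtain B L where B: "B \<ge> 0" "\<And>s u. s \<in> I \<Longrightarrow> u \<in> U \<Longrightarrow> norm (g s u) \<le> B"
    and L: "L \<ge> 0" "\<And>s u v. s \<in> I \<Longrightarrow> u \<in> U \<Longrightarrow> v \<in> U \<Longrightarrow> norm (g s u - g s v) \<le> L * norm (u - v)"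
    and c: "continuous_on (I \<times> U) (\<lambda>(s, u). g s u)"
    using assms(2) unfolding unif_lipschitz_def by auto
  obtain B' L' where B': "B' \<ge> 0" "\<And>s u. s \<in> I \<Longrightarrow> u \<in> U \<Longrightarrow> norm (f s u) \<le> B'"
    and L': "L' \<ge> 0" "\<And>s u v. s \<in> I \<Longrightarrow> u \<in> U \<Longrightarrow> v \<in> U \<Longrightarrow> norm (f s u - f s v) \<le> L' * norm (u - v)"
    and c': "continuous_on (I \<times> U) (\<lambda>(s, u). f s u)"
    using assms(1) unfolding unif_lipschitz_def by auto
  have "norm (f s u * g s u) \<le> B' * B" if "s \<in> I" "u \<in> U" for s u
    using norm_mult_ineq[of "f s u" "g s u"] mult_mono[OF B'(2)[OF that] B(2)[OF that]] B'(1) by force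
  moreover have "norm (f s u * g s u - f s v * g s v) \<le> (L' * B + B' * L) * norm (u - v)"
    if "s \<in> I" "u \<in> U" "v \<in> U" for s u v
  proof -
    have "f s u * g s u - f s v * g s v = (f s u - f s v) * g s u + f s v * (g s u - g s v)"
      by (simp add: algebra_simps)
    also have "norm \<dots> \<le> norm (f s u - f s v) * norm (g s u) + norm (f s v) * norm (g s u - g s v)"
      by (intro norm_triangle_mono norm_mult_ineq)
    also have "\<dots> \<le> (L' * norm (u - v)) * B + B' * (L * norm (u - v))"
      using that B B' L L' by (intro add_mono mult_mono) auto
    finally show ?thesis by (simp add: algebra_simps)
  qed
  moreover have "continuous_on (I \<times> U) (\<lambda>(s, u). f s u * g s u)"
    using c c' unfolding case_prod_beta by (rule continuous_on_mult[rotated])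
  ultimately show ?thesis by (rule unif_lipschitzI[rotated])
qed

text \<open>The outer map is Lipschitz on a set containing the values, not on the whole space. This
  admits the Newtonian force, which is Lipschitz only away from the primaries.\<close>

lemma unif_lipschitz_compose:
  fixes k :: "'b::real_normed_vector \<Rightarrow> 'c::real_normed_vector"
  assumes g: "unif_lipschitz I U g"
    and W: "\<And>s u. s \<in> I \<Longrightarrow> u \<in> U \<Longrightarrow> g s u \<in> W"
    and k: "\<And>x y. x \<in> W \<Longrightarrow> y \<in> W \<Longrightarrow> norm (k x - k y) \<le> K * norm (x - y)"
  shows "unif_lipschitz I U (\<lambda>s u. k (g s u))"
proof (cases "I = {} \<or> U = {}")
  case True
  then show ?thesis by (auto simp: unif_lipschitz_def)
next
  case False
  then obtain s0 u0 where su: "s0 \<in> I" "u0 \<in> U" by auto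
  define K' where "K' = max K 0"
  have k': "norm (k x - k y) \<le> K' * norm (x - y)" if "x \<in> W" "y \<in> W" for x y
    using order_trans[OF k[OF that] mult_right_mono[of K K' "norm (x - y)"]] by (simp add: K'_def)
  obtain B L where B: "B \<ge> 0" "\<And>s u. s \<in> I \<Longrightarrow> u \<in> U \<Longrightarrow> norm (g s u) \<le> B"
    and L: "L \<ge> 0" "\<And>s u v. s \<in> I \<Longrightarrow> u \<in> U \<Longrightarrow> v \<in> U \<Longrightarrow> norm (g s u - g s v) \<le> L * norm (u - v)"
    and c: "continuous_on (I \<times> U) (\<lambda>(s, u). g s u)"
    using g unfolding unif_lipschitz_def by auto
  have "norm (k (g s u)) \<le> norm (k (g s0 u0)) + K' * (2 * B)" if "s \<in> I" "u \<in> U" for s u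
  proof -
    have "norm (k (g s u)) \<le> norm (k (g s0 u0)) + norm (k (g s u) - k (g s0 u0))"
      by (rule norm_triangle_sub)
    also have "norm (k (g s u) - k (g s0 u0)) \<le> K' * norm (g s u - g s0 u0)"
      by (intro k' W that su)
    also have "\<dots> \<le> K' * (2 * B)"
      using norm_triangle_ineq4[of "g s u" "g s0 u0"] B(2)[OF that] B(2)[OF su]
      by (intro mult_left_mono) (auto simp: K'_def)
    finally show ?thesis by simp
  qed
  moreover have "norm (k (g s u) - k (g s v)) \<le> (K' * L) * norm (u - v)"
    if "s \<in> I" "u \<in> U" "v \<in> U" for s u v
  proof -
    have "norm (k (g s u) - k (g s v)) \<le> K' * norm (g s u - g s v)" using that by (intro k' W)
    also have "\<dots> \<le> K' * (L * norm (u - v))"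
      using that by (intro mult_left_mono L) (auto simp: K'_def)
    finally show ?thesis by (simp add: mult_ac)
  qed
  moreover have "continuous_on (I \<times> U) (\<lambda>(s, u). k (g s u))"
  proof -
    have "continuous_on W k"
      by (rule continuous_on_subset[OF lipschitz_on_continuous_on[of K'], of W])
        (auto simp: lipschitz_on_def dist_norm K'_def[symmetric] intro!: k', simp add: K'_def)
    then have "continuous_on (I \<times> U) (\<lambda>x. k ((\<lambda>(s, u). g s u) x))"
      by (rule continuous_on_compose2[OF _ c]) (use W in auto)
    then show ?thesis by (simp add: case_prod_beta)
  qed
  ultimately show ?thesis by (rule unif_lipschitzI[rotated])
qed

lemma norm_cis_diff_le: "norm (cis a - cis b) \<le> \<bar>a - b\<bar>"
proof -
  have "norm (cis a - cis b) \<le> 1 * \<bar>a - b\<bar>"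
  proof (rule norm_diff_le_of_vector_derivative)
    fix s assume "s \<in> {min a b..max a b}"
    show "(cis has_vector_derivative \<i> * cis s) (at s within {min a b..max a b})"
      unfolding has_vector_derivative_def by (auto intro!: derivative_eq_intros)
  qed (auto simp: norm_mult)
  then show ?thesis by simp
qed

text \<open>Newton's inverse square law for a unit mass at the origin, up to sign, in complex
  notation.\<close>

definition kernel3 :: "complex \<Rightarrow> complex" where
  "kernel3 X = X / of_real (norm X ^ 3)"

lemma norm_kernel3: "norm (kernel3 X) = 1 / (norm X)\<^sup>2"
proof -
  have "norm (kernel3 X) = norm X / norm X ^ 3" by (simp add: kernel3_def norm_divide norm_power)
  then show ?thesis by (simp add: power3_eq_cube power2_eq_square)
qed

text \<open>In the constant 4, one unit comes from varying the numerator and three from varying the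
  inverse cube, whose difference splits into three terms.\<close>

lemma kernel3_lipschitz:
  assumes m: "0 < m" "m \<le> norm X" "m \<le> norm Y"
  shows "norm (kernel3 X - kernel3 Y) \<le> 4 / m ^ 3 * norm (X - Y)"
proof -
  define x y where "x = norm X" and "y = norm Y"
  have xy: "0 < x" "0 < y" "m \<le> x" "m \<le> y" using m by (auto simp: x_def y_def)
  have "kernel3 X - kernel3 Y = (X - Y) / of_real (x ^ 3) + Y * of_real (1 / x ^ 3 - 1 / y ^ 3)"
    using xy by (simp add: kernel3_def x_def y_def field_simps)
  also have "norm \<dots> \<le> norm (X - Y) / x ^ 3 + y * \<bar>1 / x ^ 3 - 1 / y ^ 3\<bar>"
    using xy norm_triangle_ineq[of "(X - Y) / of_real (x ^ 3)" "Y * of_real (1 / x ^ 3 - 1 / y ^ 3)"]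
    unfolding norm_mult norm_divide norm_of_real y_def[symmetric] by simp
  also have "y * \<bar>1 / x ^ 3 - 1 / y ^ 3\<bar> = \<bar>y - x\<bar> * (1 / x ^ 3 + 1 / (x\<^sup>2 * y) + 1 / (x * y\<^sup>2))"
  proof -
    have "y * (1 / x ^ 3 - 1 / y ^ 3) = (y - x) * (1 / x ^ 3 + 1 / (x\<^sup>2 * y) + 1 / (x * y\<^sup>2))"
      using xy by (simp add: field_simps power3_eq_cube power2_eq_square)
    moreover have "0 < 1 / x ^ 3 + 1 / (x\<^sup>2 * y) + 1 / (x * y\<^sup>2)" using xy by (intro add_pos_pos) auto
    ultimately show ?thesis using xy
      by (metis abs_mult abs_of_pos)
  qed
  also have "\<dots> \<le> norm (X - Y) * (1 / m ^ 3 + 1 / (m\<^sup>2 * m) + 1 / (m * m\<^sup>2))"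
    using xy m norm_triangle_ineq3[of X Y]
    by (intro mult_mono add_mono divide_left_mono power_mono mult_mono)
      (auto simp: x_def y_def abs_minus_commute intro!: add_nonneg_nonneg)
  also have "norm (X - Y) / x ^ 3 \<le> norm (X - Y) / m ^ 3"
    using xy m by (intro divide_left_mono power_mono) auto
  finally show ?thesis using m by (simp add: field_simps power3_eq_cube power2_eq_square)
qed

text \<open>The attraction of the two primaries minus that of a unit mass at the origin:
  in the rotating frame this is the acceleration that perturbs the Kepler problem.\<close>

definition perturb :: "real \<Rightarrow> complex \<Rightarrow> complex" where
  "perturb \<mu> X = kernel3 X - of_real (1 - \<mu>) * kernel3 (X + of_real \<mu>)
     - of_real \<mu> * kernel3 (X - of_real (1 - \<mu>))"

text \<open>The kernels at X and at X + \<mu> nearly cancel, so every remaining term carries a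
  factor \<mu>. The three contributions have coefficients 256, 16 and 1, and only the last one feels
  the distance \<open>d\<close> to the second primary.\<close>

lemma norm_perturb_le:
  assumes \<mu>: "0 < \<mu>" "\<mu> \<le> \<kappa> / 4" and \<kappa>: "\<kappa> \<le> 1" and d: "0 < d" "d \<le> 1"
    and X: "\<kappa> / 2 \<le> norm X" "d \<le> norm (X - of_real (1 - \<mu>))"
  shows "norm (perturb \<mu> X) \<le> 300 * \<mu> / (\<kappa> ^ 3 * d\<^sup>2)"
proof -
  have k0: "0 < \<kappa>" using \<mu> by simp
  have X': "\<kappa> / 4 \<le> norm (X + of_real \<mu>)"
    using norm_diff_ineq[of X "of_real \<mu>"] X(1) \<mu> by simp
  have eq: "perturb \<mu> X = (kernel3 X - kernel3 (X + of_real \<mu>)) + of_real \<mu> * kernel3 (X + of_real \<mu>)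
      + of_real (- \<mu>) * kernel3 (X - of_real (1 - \<mu>))"
    by (simp add: perturb_def algebra_simps)
  have inv: "1 \<le> 1 / (\<kappa> ^ 3)" "1 \<le> 1 / d\<^sup>2" "1 / \<kappa>\<^sup>2 \<le> 1 / \<kappa> ^ 3"
    using k0 \<kappa> d by (auto simp: divide_simps power_le_one power2_eq_square power3_eq_cube mult_le_one)
  have t1: "norm (kernel3 X - kernel3 (X + of_real \<mu>)) \<le> 256 * (\<mu> / \<kappa> ^ 3)"
    using kernel3_lipschitz[of "\<kappa> / 4" X "X + of_real \<mu>"] k0 X X' \<mu> by (simp add: field_simps)
  have "1 / (norm (X + of_real \<mu>))\<^sup>2 \<le> 1 / (\<kappa> / 4)\<^sup>2"
    using X' k0 by (intro divide_left_mono power_mono) (auto intro!: mult_pos_pos)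
  also have "\<dots> = 16 * (1 / \<kappa>\<^sup>2)" using k0 by (simp add: power_divide)
  also have "\<dots> \<le> 16 * (1 / \<kappa> ^ 3)" using inv by simp
  finally have t2: "norm (of_real \<mu> * kernel3 (X + of_real \<mu>)) \<le> 16 * (\<mu> / \<kappa> ^ 3)"
    using \<mu> mult_left_mono[of "1 / (norm (X + of_real \<mu>))\<^sup>2" "16 * (1 / \<kappa> ^ 3)" \<mu>]
    by (simp add: norm_mult norm_kernel3 mult_ac)
  have "1 / (norm (X - of_real (1 - \<mu>)))\<^sup>2 \<le> 1 / d\<^sup>2"
    using X d by (intro divide_left_mono power_mono) (auto intro!: mult_pos_pos)
  then have t3: "norm (of_real (- \<mu>) * kernel3 (X - of_real (1 - \<mu>))) \<le> \<mu> * (1 / d\<^sup>2)"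
    using \<mu> mult_left_mono[of "1 / (norm (X - of_real (1 - \<mu>)))\<^sup>2" "1 / d\<^sup>2" \<mu>] by (simp add: norm_mult norm_kernel3)
  have "norm (perturb \<mu> X) \<le> 256 * (\<mu> / \<kappa> ^ 3) + 16 * (\<mu> / \<kappa> ^ 3) + \<mu> * (1 / d\<^sup>2)"
    unfolding eq by (intro norm_triangle_mono t1 t2 t3)
  also have "\<dots> \<le> 299 * ((\<mu> / \<kappa> ^ 3) * (1 / d\<^sup>2)) + (1 / \<kappa> ^ 3) * (\<mu> * (1 / d\<^sup>2))"
  proof -
    have "(\<mu> / \<kappa> ^ 3) * 1 \<le> (\<mu> / \<kappa> ^ 3) * (1 / d\<^sup>2)"
      using inv \<mu> k0 by (intro mult_left_mono) auto
    moreover have "1 * (\<mu> * (1 / d\<^sup>2)) \<le> (1 / \<kappa> ^ 3) * (\<mu> * (1 / d\<^sup>2))"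
      using inv \<mu> d by (intro mult_right_mono) auto
    moreover have "0 < \<mu> / \<kappa> ^ 3" using \<mu> k0 by simp
    ultimately show ?thesis by linarith
  qed
  also have "\<dots> = 300 * \<mu> / (\<kappa> ^ 3 * d\<^sup>2)" by (simp add: field_simps)
  finally show ?thesis .
qed

lemma perturb_lipschitz:
  assumes m: "0 < m" and \<mu>: "0 \<le> \<mu>" "\<mu> \<le> 1"
    and X: "m \<le> norm X" "m \<le> norm (X + of_real \<mu>)" "m \<le> norm (X - of_real (1 - \<mu>))"
    and Y: "m \<le> norm Y" "m \<le> norm (Y + of_real \<mu>)" "m \<le> norm (Y - of_real (1 - \<mu>))"
  shows "norm (perturb \<mu> X - perturb \<mu> Y) \<le> 8 / m ^ 3 * norm (X - Y)"
proof -
  have "perturb \<mu> X - perturb \<mu> Y = (kernel3 X - kernel3 Y)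
      + of_real (- (1 - \<mu>)) * (kernel3 (X + of_real \<mu>) - kernel3 (Y + of_real \<mu>))
      + of_real (- \<mu>) * (kernel3 (X - of_real (1 - \<mu>)) - kernel3 (Y - of_real (1 - \<mu>)))"
    by (simp add: perturb_def algebra_simps)
  also have "norm \<dots> \<le> 4 / m ^ 3 * norm (X - Y) + (1 - \<mu>) * (4 / m ^ 3 * norm (X - Y))
      + \<mu> * (4 / m ^ 3 * norm (X - Y))"
  proof (intro norm_triangle_mono)
    show "norm (kernel3 X - kernel3 Y) \<le> 4 / m ^ 3 * norm (X - Y)"
      by (intro kernel3_lipschitz m X Y)
    have "norm (kernel3 (X + of_real \<mu>) - kernel3 (Y + of_real \<mu>)) \<le> 4 / m ^ 3 * norm (X - Y)"
      using kernel3_lipschitz[OF m X(2) Y(2)] by simp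
    then show "norm (of_real (- (1 - \<mu>)) * (kernel3 (X + of_real \<mu>) - kernel3 (Y + of_real \<mu>)))
        \<le> (1 - \<mu>) * (4 / m ^ 3 * norm (X - Y))"
      using \<mu> unfolding norm_mult norm_of_real by (intro mult_mono) auto
    have "norm (kernel3 (X - of_real (1 - \<mu>)) - kernel3 (Y - of_real (1 - \<mu>))) \<le> 4 / m ^ 3 * norm (X - Y)"
      using kernel3_lipschitz[OF m X(3) Y(3)] by simp
    then show "norm (of_real (- \<mu>) * (kernel3 (X - of_real (1 - \<mu>)) - kernel3 (Y - of_real (1 - \<mu>))))
        \<le> \<mu> * (4 / m ^ 3 * norm (X - Y))"
      using \<mu> unfolding norm_mult norm_of_real by (intro mult_mono) auto
  qed
  also have "\<dots> = 8 / m ^ 3 * norm (X - Y)" using m by (simp add: field_simps)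
  finally show ?thesis .
qed

section \<open>The perturbed Kepler problem in Levi-Civita coordinates\<close>

lemma has_vector_derivative_cis:
  assumes "(f has_vector_derivative f') (at s within A)"
  shows "((\<lambda>s. cis (f s)) has_vector_derivative of_real f' * (\<i> * cis (f s))) (at s within A)"
  using assms unfolding has_vector_derivative_def
  by (auto intro!: derivative_eq_intros simp: scaleR_conv_of_real)

lemma has_vector_derivative_cnj:
  "(f has_vector_derivative f') F \<Longrightarrow> ((\<lambda>s. cnj (f s)) has_vector_derivative cnj f') F"
  by (rule bounded_linear.has_vector_derivative[OF bounded_linear_cnj])

text \<open>Kepler motion in Levi-Civita coordinates: the position is \<open>z\<^sup>2\<close>, physical time satisfies
  \<open>dt = |z|\<^sup>2 ds\<close>, and \<open>z\<close> is a harmonic oscillator of frequency \<open>\<Omega>\<close>, where the Kepler energy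
  is \<open>- 2 \<Omega>\<^sup>2\<close>.\<close>

definition kep_z :: "real \<Rightarrow> complex \<Rightarrow> complex \<Rightarrow> real \<Rightarrow> complex" where
  "kep_z \<Omega> \<alpha> \<beta> s = \<alpha> * cis (\<Omega> * s) + \<beta> * cis (- (\<Omega> * s))"

definition kep_w :: "real \<Rightarrow> complex \<Rightarrow> complex \<Rightarrow> real \<Rightarrow> complex" where
  "kep_w \<Omega> \<alpha> \<beta> s = \<i> * of_real \<Omega> * (\<alpha> * cis (\<Omega> * s) - \<beta> * cis (- (\<Omega> * s)))"

text \<open>This is Kepler's equation, with 2 \<Omega> s as eccentric anomaly up to an additive
  constant, normalized to vanish at s = 0.\<close>

definition kep_t :: "real \<Rightarrow> complex \<Rightarrow> complex \<Rightarrow> real \<Rightarrow> real" where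
  "kep_t \<Omega> \<alpha> \<beta> s = ((norm \<alpha>)\<^sup>2 + (norm \<beta>)\<^sup>2) * s
     + Im (\<alpha> * cnj \<beta> * (cis (2 * \<Omega> * s) - 1)) / \<Omega>"

lemma norm_kep_z_sq:
  "(norm (kep_z \<Omega> \<alpha> \<beta> s))\<^sup>2 = (norm \<alpha>)\<^sup>2 + (norm \<beta>)\<^sup>2 + 2 * Re (\<alpha> * cnj \<beta> * cis (2 * \<Omega> * s))"
proof -
  define e where "e = cis (\<Omega> * s)"
  have e: "e * cnj e = 1" "cis (- (\<Omega> * s)) = cnj e" "cis (2 * \<Omega> * s) = e * e"
    by (auto simp: e_def cis_cnj cis_mult mult.assoc)
  have "of_real ((norm (kep_z \<Omega> \<alpha> \<beta> s))\<^sup>2) = (\<alpha> * e + \<beta> * cnj e) * cnj (\<alpha> * e + \<beta> * cnj e)"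
    unfolding complex_norm_square kep_z_def e(2) e_def[symmetric] ..
  also have "\<dots> = (\<alpha> * cnj \<alpha>) * (e * cnj e) + (\<beta> * cnj \<beta>) * (e * cnj e)
      + (\<alpha> * cnj \<beta> * (e * e) + cnj (\<alpha> * cnj \<beta> * (e * e)))"
    by (simp add: algebra_simps)
  also have "\<dots> = of_real ((norm \<alpha>)\<^sup>2 + (norm \<beta>)\<^sup>2 + 2 * Re (\<alpha> * cnj \<beta> * cis (2 * \<Omega> * s)))"
    unfolding e(1) e(3) complex_add_cnj by (simp add: complex_norm_square[symmetric])
  finally show ?thesis by (simp only: of_real_eq_iff)
qed

lemma norm_kep_z_le: "norm (kep_z \<Omega> \<alpha> \<beta> s) \<le> norm \<alpha> + norm \<beta>"
  unfolding kep_z_def by (rule order_trans[OF norm_triangle_ineq]) (simp add: norm_mult)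

lemma norm_kep_w_le: "norm (kep_w \<Omega> \<alpha> \<beta> s) \<le> \<bar>\<Omega>\<bar> * (norm \<alpha> + norm \<beta>)"
  unfolding kep_w_def norm_mult
  by (rule mult_mono) (auto intro!: order_trans[OF norm_triangle_ineq4] simp: norm_mult)

lemma kep_z_diff: "kep_z \<Omega> \<alpha> \<beta> s - kep_z \<Omega> \<alpha>' \<beta>' s = kep_z \<Omega> (\<alpha> - \<alpha>') (\<beta> - \<beta>') s"
  by (simp add: kep_z_def algebra_simps)

lemma kep_w_diff: "kep_w \<Omega> \<alpha> \<beta> s - kep_w \<Omega> \<alpha>' \<beta>' s = kep_w \<Omega> (\<alpha> - \<alpha>') (\<beta> - \<beta>') s"
  by (simp add: kep_w_def algebra_simps)

lemma kep_t_has_vector_derivative: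
  assumes "\<Omega> \<noteq> 0"
  shows "(kep_t \<Omega> \<alpha> \<beta> has_vector_derivative (norm (kep_z \<Omega> \<alpha> \<beta> s))\<^sup>2) (at s within A)"
proof -
  have "((\<lambda>s. Im (\<alpha> * cnj \<beta> * (cis (2 * \<Omega> * s) - 1))) has_vector_derivative
      Im (\<alpha> * cnj \<beta> * (of_real (2 * \<Omega>) * (\<i> * cis (2 * \<Omega> * s))))) (at s within A)"
    by (intro bounded_linear.has_vector_derivative[OF bounded_linear_Im] has_vector_derivative_mult_right)
      (auto intro!: derivative_eq_intros has_vector_derivative_cis)
  also have "Im (\<alpha> * cnj \<beta> * (of_real (2 * \<Omega>) * (\<i> * cis (2 * \<Omega> * s))))
      = 2 * \<Omega> * Re (\<alpha> * cnj \<beta> * cis (2 * \<Omega> * s))"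
    by (simp add: algebra_simps)
  finally have 1: "((\<lambda>s. Im (\<alpha> * cnj \<beta> * (cis (2 * \<Omega> * s) - 1))) has_vector_derivative
      2 * \<Omega> * Re (\<alpha> * cnj \<beta> * cis (2 * \<Omega> * s))) (at s within A)" .
  have "((\<lambda>s. ((norm \<alpha>)\<^sup>2 + (norm \<beta>)\<^sup>2) * s + Im (\<alpha> * cnj \<beta> * (cis (2 * \<Omega> * s) - 1)) / \<Omega>)
      has_vector_derivative ((norm \<alpha>)\<^sup>2 + (norm \<beta>)\<^sup>2)
         + 2 * \<Omega> * Re (\<alpha> * cnj \<beta> * cis (2 * \<Omega> * s)) / \<Omega>) (at s within A)"
    by (intro has_vector_derivative_add has_vector_derivative_divide 1)
      (auto intro!: derivative_eq_intros)
  then show ?thesis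
    using assms by (simp add: kep_t_def[abs_def] norm_kep_z_sq)
qed

lemma kep_t_0 [simp]: "kep_t \<Omega> \<alpha> \<beta> 0 = 0"
  by (simp add: kep_t_def)

text \<open>The square of z is a position in the inertial frame, while the primaries rest in the
  frame turned by t. The position is therefore turned into that frame and the resulting acceleration
  turned back.\<close>

definition inertial_force :: "real \<Rightarrow> real \<Rightarrow> complex \<Rightarrow> complex" where
  "inertial_force \<mu> t z = cis t * perturb \<mu> (cis (- t) * z\<^sup>2)"

text \<open>Variation of constants about the Kepler motion, in the unknowns \<open>\<alpha>\<close>, \<open>\<beta>\<close>, the deviation \<open>k\<close> of
  the energy and the deviation \<open>\<theta>\<close> of the time. Estimated in the order \<open>k\<close>, \<open>(\<alpha>, \<beta>)\<close>, \<open>\<theta>\<close>, they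
  grow only like \<open>S\<close>, \<open>S\<^sup>2\<close>, \<open>S\<^sup>3\<close>, where a Gronwall argument in \<open>(x, y)\<close> would lose an exponential
  factor; the estimates hold for the field retracted onto the box, so the solution never leaves it.\<close>

lemma perturbed_kepler:
  fixes \<alpha>0 \<beta>0 :: complex and \<Omega> :: real
  defines "X \<equiv> \<lambda>t z. cis (- t) * z\<^sup>2"
  defines "zr \<equiv> kep_z \<Omega> \<alpha>0 \<beta>0" and "wr \<equiv> kep_w \<Omega> \<alpha>0 \<beta>0" and "tr \<equiv> kep_t \<Omega> \<alpha>0 \<beta>0"
  assumes \<Omega>: "0 < \<Omega>" "\<Omega> \<le> 1" "1 \<le> 2 * M * \<Omega>" and M: "norm \<alpha>0 + norm \<beta>0 \<le> M" "1 \<le> M"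
    and S: "1 \<le> S" and \<mu>: "0 < \<mu>" and \<kappa>: "0 < \<kappa>" "\<kappa> \<le> 1" and d: "0 < d" "d \<le> \<kappa> / 4"
    and sun: "\<And>s. s \<in> {0..S} \<Longrightarrow> \<kappa> \<le> (norm (zr s))\<^sup>2"
    and jup: "\<And>s. s \<in> {0..S} \<Longrightarrow> 2 * d \<le> norm (X (tr s) (zr s) - 1)"
    and eps: "\<epsilon> = 4800 * (M + 1) ^ 7 * \<mu> * S ^ 3 / (\<kappa> ^ 3 * d\<^sup>2)" "\<epsilon> \<le> d / 2"
  obtains z w :: "real \<Rightarrow> complex" and h t :: "real \<Rightarrow> real" where
    "z 0 = \<alpha>0 + \<beta>0" "w 0 = \<i> * of_real \<Omega> * (\<alpha>0 - \<beta>0)" "h 0 = - 2 * \<Omega>\<^sup>2" "t 0 = 0"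
    "\<And>s. s \<in> {0..S} \<Longrightarrow> (z has_vector_derivative w s) (at s within {0..S})"
    "\<And>s. s \<in> {0..S} \<Longrightarrow> (w has_vector_derivative of_real (h s / 2) * z s
        + z s * cnj (z s) * cnj (z s) * inertial_force \<mu> (t s) (z s) / 2) (at s within {0..S})"
    "\<And>s. s \<in> {0..S} \<Longrightarrow> (h has_vector_derivative
        2 * Re (cnj (w s * z s) * inertial_force \<mu> (t s) (z s))) (at s within {0..S})"
    "\<And>s. s \<in> {0..S} \<Longrightarrow> (t has_vector_derivative (norm (z s))\<^sup>2) (at s within {0..S})"
    "\<And>s. s \<in> {0..S} \<Longrightarrow> norm (z s - zr s) \<le> \<epsilon>"
    "\<And>s. s \<in> {0..S} \<Longrightarrow> norm (w s - wr s) \<le> \<epsilon>"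
    "\<And>s. s \<in> {0..S} \<Longrightarrow> \<bar>t s - tr s\<bar> \<le> \<epsilon>"
    "\<And>s. s \<in> {0..S} \<Longrightarrow> norm (X (t s) (z s) - X (tr s) (zr s)) \<le> \<epsilon>"
    "\<And>s. s \<in> {0..S} \<Longrightarrow> \<kappa> / 2 \<le> norm (X (t s) (z s)) \<and> d \<le> norm (X (t s) (z s) - of_real (1 - \<mu>))"
proof -

  \<comment> \<open>The radii of the box\<close>
  define N where "N = M + 1"
  define \<eta> where "\<eta> = 300 * \<mu> / (\<kappa> ^ 3 * d\<^sup>2)"
  \<comment> \<open>Each radius is \<open>S\<close> times a bound for the speed of its component:
    the energy moves with the force \<open>\<eta>\<close>, the coefficients with the energy
    deviation and the force, the time with the coefficients.\<close>
  define \<rho>k where "\<rho>k = 2 * N\<^sup>2 * \<eta> * S"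
  define \<rho> where "\<rho> = 2 * N ^ 4 * \<eta> * S\<^sup>2"
  define \<rho>\<theta> where "\<rho>\<theta> = 8 * N ^ 5 * \<eta> * S ^ 3"
  have N: "2 \<le> N" using M by (simp add: N_def)
  have Np: "1 \<le> N ^ n" for n using N by (simp add: one_le_power)
  have Sp: "1 \<le> S ^ n" for n using S by (simp add: one_le_power)
  have \<eta>0: "0 < \<eta>" using \<mu> \<kappa> d by (simp add: \<eta>_def)
  have eps': "\<epsilon> = 16 * N ^ 7 * \<eta> * S ^ 3" by (simp add: eps(1) \<eta>_def N_def)
  have d1: "d \<le> 1" using d \<kappa> by simp
  have kd: "\<kappa> ^ 3 * d\<^sup>2 \<le> 1" using \<kappa> d d1 by (intro mult_le_one power_le_one) auto
  have "\<mu> * 1 \<le> \<mu> * (1 / (\<kappa> ^ 3 * d\<^sup>2))"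
    using kd \<mu> \<kappa> d by (intro mult_left_mono) (auto simp: divide_simps)
  then have "\<mu> \<le> \<eta>" using \<mu> \<eta>0 by (simp add: \<eta>_def)
  moreover have "\<eta> * 1 \<le> \<eta> * (16 * N ^ 7 * S ^ 3)"
    using \<eta>0 N mult_mono[OF Np[of 7] Sp[of 3]] by (intro mult_left_mono) auto
  \<comment> \<open>The second primary sits at 1 - \<mu>, whereas \<open>jup\<close> measures the
    distance to 1; this bounds the cost of the shift.\<close>
  ultimately have \<mu>_le: "\<mu> \<le> d / 2" using eps(2) eps' by (simp add: mult_ac)
  \<comment> \<open>The first inequality is for positions in the rotating frame:
    \<open>4 * N * \<rho>\<close> accounts for the error of the square of z,
    \<open>N\<^sup>2 * \<rho>\<theta>\<close> for the error of the rotation angle.\<close>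
  have r: "4 * N * \<rho> + N\<^sup>2 * \<rho>\<theta> \<le> \<epsilon>" "\<rho>\<theta> \<le> \<epsilon>" "2 * \<rho> \<le> \<epsilon>"
  proof -
    have "4 * N * \<rho> = 8 * \<eta> * (N ^ 5 * S\<^sup>2)" by (simp add: \<rho>_def eval_nat_numeral)
    also have "\<dots> \<le> 8 * \<eta> * (N ^ 7 * S ^ 3)"
      using \<eta>0 N S by (intro mult_left_mono mult_mono power_increasing) auto
    finally have a: "4 * N * \<rho> \<le> 8 * \<eta> * (N ^ 7 * S ^ 3)" .
    have b: "N\<^sup>2 * \<rho>\<theta> = 8 * \<eta> * (N ^ 7 * S ^ 3)" by (simp add: \<rho>\<theta>_def eval_nat_numeral)
    show "4 * N * \<rho> + N\<^sup>2 * \<rho>\<theta> \<le> \<epsilon>" using a b eps' by (simp add: mult_ac)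
    have pos: "0 \<le> \<rho>" "0 \<le> \<rho>\<theta>" using \<eta>0 N S by (auto simp: \<rho>_def \<rho>\<theta>_def)
    have "1 * \<rho>\<theta> \<le> N\<^sup>2 * \<rho>\<theta>" using pos Np by (intro mult_right_mono) auto
    then show "\<rho>\<theta> \<le> \<epsilon>" using b pos eps' Np[of 7] Sp[of 3] \<eta>0 by (simp add: mult_ac)
    have "2 * \<rho> \<le> 4 * N * \<rho>" using N pos by (intro mult_right_mono) auto
    moreover have "0 \<le> 8 * \<eta> * (N ^ 7 * S ^ 3)" using \<eta>0 N S by auto
    ultimately show "2 * \<rho> \<le> \<epsilon>" using a eps' by (simp add: mult_ac)
  qed
  have pos: "0 < \<rho>k" "0 < \<rho>" "0 < \<rho>\<theta>" using \<eta>0 N S by (auto simp: \<rho>_def \<rho>\<theta>_def \<rho>k_def)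
  have \<rho>1: "2 * \<rho> \<le> 1" using r(3) eps(2) d1 by simp
  define B where "B = cball \<alpha>0 \<rho> \<times> cball \<beta>0 \<rho> \<times> cball (0::real) \<rho>k \<times> cball (0::real) \<rho>\<theta>"
  have B: "convex B" "closed B" "B \<noteq> {}" "bounded B"
    unfolding B_def using pos
    by (auto intro!: convex_Times closed_Times bounded_Times)
  define zf where "zf s u = kep_z \<Omega> (fst u) (fst (snd u)) s" for s and u :: "complex \<times> complex \<times> real \<times> real"
  define wf where "wf s u = kep_w \<Omega> (fst u) (fst (snd u)) s" for s and u :: "complex \<times> complex \<times> real \<times> real"
  define tf where "tf s u = tr s + snd (snd (snd u))" for s and u :: "complex \<times> complex \<times> real \<times> real"
  define pf where "pf s u = inertial_force \<mu> (tf s u) (zf s u)" for s u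
  \<comment> \<open>\<open>qf\<close> is the value of z'' + \<Omega>^2 z: an energy - 2 \<Omega>^2 +
    k leaves k z / 2, and the force adds the other term.\<close>
  define qf where "qf s u = of_real (fst (snd (snd u)) / 2) * zf s u + zf s u * cnj (zf s u) * cnj (zf s u) * pf s u / 2"
    for s u
  \<comment> \<open>With e = \<open>cis (\<Omega> * s)\<close>, the first two components solve
    \<alpha>' e + \<beta>' / e = 0 and \<i> \<Omega> (\<alpha>' e - \<beta>' / e) =
    \<open>qf\<close>. The last one is the derivative of the deviation from
    \<open>tr\<close>.\<close>
  define F where "F s u = (cis (- (\<Omega> * s)) * qf s u / (2 * \<i> * of_real \<Omega>),
     - cis (\<Omega> * s) * qf s u / (2 * \<i> * of_real \<Omega>),
     2 * Re (cnj (wf s u * zf s u) * pf s u), (norm (zf s u))\<^sup>2 - (norm (zr s))\<^sup>2)" for s u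

  \<comment> \<open>Bounds valid on the whole box\<close>
  have box: "norm (fst u - \<alpha>0) \<le> \<rho>" "norm (fst (snd u) - \<beta>0) \<le> \<rho>"
      "\<bar>fst (snd (snd u))\<bar> \<le> \<rho>k" "\<bar>snd (snd (snd u))\<bar> \<le> \<rho>\<theta>" if "u \<in> B" for u
    using that by (auto simp: B_def dist_norm norm_minus_commute)
  have zr_le: "norm (zr s) \<le> M" for s
    using norm_kep_z_le[of \<Omega> \<alpha>0 \<beta>0 s] M by (simp add: zr_def)
  have z_dev: "norm (zf s u - zr s) \<le> 2 * \<rho>" if "u \<in> B" for s u
    unfolding zf_def zr_def kep_z_diff
    using norm_kep_z_le[of \<Omega> "fst u - \<alpha>0" "fst (snd u) - \<beta>0" s] box[OF that] by linarith
  have w_dev: "norm (wf s u - wr s) \<le> 2 * \<rho>" if "u \<in> B" for s u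
  proof -
    have "norm (wf s u - wr s) \<le> \<bar>\<Omega>\<bar> * (norm (fst u - \<alpha>0) + norm (fst (snd u) - \<beta>0))"
      unfolding wf_def wr_def kep_w_diff by (rule norm_kep_w_le)
    also have "\<dots> \<le> 1 * (\<rho> + \<rho>)" using \<Omega> box[OF that] by (intro mult_mono) auto
    finally show ?thesis by simp
  qed
  have z_le: "norm (zf s u) \<le> N" if "u \<in> B" for s u
    using norm_triangle_sub[of "zf s u" "zr s"] z_dev[OF that, of s] zr_le[of s] \<rho>1 by (simp add: N_def)
  have wr_le: "norm (wr s) \<le> M" for s
  proof -
    have "norm (wr s) \<le> \<bar>\<Omega>\<bar> * (norm \<alpha>0 + norm \<beta>0)" unfolding wr_def by (rule norm_kep_w_le)
    also have "\<dots> \<le> 1 * M" using \<Omega> M by (intro mult_mono) auto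
    finally show ?thesis by simp
  qed
  have w_le: "norm (wf s u) \<le> N" if "u \<in> B" for s u
    using norm_triangle_sub[of "wf s u" "wr s"] w_dev[OF that, of s] wr_le[of s] \<rho>1 by (simp add: N_def)
  have z_prod: "norm (zf s u - zr s) * (norm (zf s u) + norm (zr s)) \<le> 4 * N * \<rho>" if "u \<in> B" for s u
  proof -
    have "norm (zf s u - zr s) * (norm (zf s u) + norm (zr s)) \<le> (2 * \<rho>) * (N + N)"
      using z_dev[OF that, of s] z_le[OF that, of s] zr_le[of s] pos
      by (intro mult_mono add_mono) (auto simp: N_def)
    then show ?thesis by (simp add: algebra_simps)
  qed
  have X_dev: "norm (X (tf s u) (zf s u) - X (tr s) (zr s)) \<le> \<epsilon>" if "u \<in> B" for s u
  proof -
    have "X (tf s u) (zf s u) - X (tr s) (zr s)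
        = cis (- tf s u) * ((zf s u - zr s) * (zf s u + zr s)) + (cis (- tf s u) - cis (- tr s)) * (zr s)\<^sup>2"
      by (simp add: X_def algebra_simps power2_eq_square)
    also have "norm \<dots> \<le> norm (zf s u - zr s) * norm (zf s u + zr s)
        + norm (cis (- tf s u) - cis (- tr s)) * (norm (zr s))\<^sup>2"
      by (rule order_trans[OF norm_triangle_ineq]) (simp add: norm_mult norm_power)
    also have "norm (zf s u - zr s) * norm (zf s u + zr s) \<le> norm (zf s u - zr s) * (norm (zf s u) + norm (zr s))"
      by (intro mult_left_mono norm_triangle_ineq) auto
    also have "\<dots> \<le> 4 * N * \<rho>" by (rule z_prod[OF that])
    also have "norm (cis (- tf s u) - cis (- tr s)) * (norm (zr s))\<^sup>2 \<le> \<rho>\<theta> * N\<^sup>2"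
      using norm_cis_diff_le[of "- tf s u" "- tr s"] box(4)[OF that] zr_le[of s] pos
      by (intro mult_mono power_mono) (auto simp: tf_def N_def)
    finally show ?thesis using r(1) by (simp add: mult_ac)
  qed
  have nX: "norm (X t z) = (norm z)\<^sup>2" for t z by (simp add: X_def norm_mult norm_power)
  \<comment> \<open>Half of the margin \<open>2 * d\<close> is spent: at most d / 2 on the deviation
    \<open>\<epsilon>\<close> and at most d / 2 on the displacement \<open>\<mu>\<close> of the
    primary.\<close>
  have far: "\<kappa> / 2 \<le> norm (X (tf s u) (zf s u)) \<and> d \<le> norm (X (tf s u) (zf s u) - of_real (1 - \<mu>))"
    if "u \<in> B" "s \<in> {0..S}" for s u
  proof -
    have "norm (X (tr s) (zr s)) \<le> norm (X (tf s u) (zf s u)) + norm (X (tf s u) (zf s u) - X (tr s) (zr s))"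
      using norm_triangle_sub[of "X (tr s) (zr s)" "X (tf s u) (zf s u)"] by (simp add: norm_minus_commute)
    then have 1: "\<kappa> / 2 \<le> norm (X (tf s u) (zf s u))"
      using X_dev[OF that(1), of s] sun[OF that(2)] eps(2) d by (simp add: nX)
    have "norm ((X (tf s u) (zf s u) - of_real (1 - \<mu>))
        - (X (tf s u) (zf s u) - X (tr s) (zr s)) - of_real \<mu>) \<le> norm (X (tf s u) (zf s u) - of_real (1 - \<mu>))
        + norm (X (tf s u) (zf s u) - X (tr s) (zr s)) + norm (of_real \<mu> :: complex)"
      by (rule order_trans[OF norm_triangle_ineq4 add_right_mono[OF norm_triangle_ineq4]])
    moreover have "(X (tf s u) (zf s u) - of_real (1 - \<mu>))
        - (X (tf s u) (zf s u) - X (tr s) (zr s)) - of_real \<mu> = X (tr s) (zr s) - 1"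
      by simp
    ultimately have "norm (X (tr s) (zr s) - 1) \<le> norm (X (tf s u) (zf s u) - of_real (1 - \<mu>))
        + norm (X (tf s u) (zf s u) - X (tr s) (zr s)) + norm (of_real \<mu> :: complex)"
      by metis
    then show ?thesis
      using 1 X_dev[OF that(1), of s] jup[OF that(2)] eps(2) \<mu>_le \<mu> by simp
  qed
  have p_le: "norm (pf s u) \<le> \<eta>" if "u \<in> B" "s \<in> {0..S}" for s u
  proof -
    have "norm (pf s u) = norm (perturb \<mu> (X (tf s u) (zf s u)))"
      by (simp add: pf_def inertial_force_def X_def norm_mult)
    also have "\<dots> \<le> \<eta>" unfolding \<eta>_def
      using far[OF that] \<mu> \<mu>_le d \<kappa> by (intro norm_perturb_le) auto
    finally show ?thesis .
  qed
  have q_le: "norm (qf s u) \<le> 2 * N ^ 3 * \<eta> * S" if "u \<in> B" "s \<in> {0..S}" for s u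
  proof -
    have "norm (qf s u) \<le> \<bar>fst (snd (snd u)) / 2\<bar> * norm (zf s u)
        + norm (zf s u) * norm (zf s u) * norm (zf s u) * norm (pf s u) / 2"
      unfolding qf_def by (rule order_trans[OF norm_triangle_ineq]) (simp add: norm_mult norm_divide)
    also have "\<dots> \<le> \<rho>k / 2 * N + N * N * N * \<eta> / 2"
      using z_le[OF that(1), of s] p_le[OF that] box(3)[OF that(1)] N \<eta>0 pos
      by (intro add_mono mult_mono divide_right_mono) auto
    also have "\<dots> = N ^ 3 * \<eta> * S + N ^ 3 * \<eta> / 2 * 1"
      by (simp add: \<rho>k_def power2_eq_square power3_eq_cube)
    also have "\<dots> \<le> N ^ 3 * \<eta> * S + N ^ 3 * \<eta> / 2 * S"
      using N \<eta>0 S by (intro add_mono mult_left_mono) auto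
    also have "\<dots> \<le> 2 * N ^ 3 * \<eta> * S" using N \<eta>0 S by simp
    finally show ?thesis .
  qed
  have ab_le: "norm (c * qf s u / (2 * \<i> * of_real \<Omega>)) \<le> \<rho> / S"
    if "u \<in> B" "s \<in> {0..S}" "norm c = 1" for s u and c :: complex
  proof -
    have "norm (c * qf s u / (2 * \<i> * of_real \<Omega>)) = norm (qf s u) * (1 / (2 * \<Omega>))"
      using \<Omega> that(3) by (simp add: norm_mult norm_divide)
    also have "\<dots> \<le> (2 * N ^ 3 * \<eta> * S) * N"
      using q_le[OF that(1,2)] \<Omega> N \<eta>0 S by (intro mult_mono) (auto simp: N_def field_simps)
    also have "\<dots> = \<rho> / S" using S by (simp add: \<rho>_def eval_nat_numeral)
    finally show ?thesis .
  qed
  have k_le: "norm (2 * Re (cnj (wf s u * zf s u) * pf s u)) \<le> \<rho>k / S" if "u \<in> B" "s \<in> {0..S}" for s u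
  proof -
    have "\<bar>Re (cnj (wf s u * zf s u) * pf s u)\<bar> \<le> norm (wf s u) * norm (zf s u) * norm (pf s u)"
      using abs_Re_le_cmod[of "cnj (wf s u * zf s u) * pf s u"] by (simp add: norm_mult)
    also have "\<dots> \<le> N * N * \<eta>"
      using w_le[OF that(1), of s] z_le[OF that(1), of s] p_le[OF that] N by (intro mult_mono) auto
    finally show ?thesis using S by (simp add: \<rho>k_def power2_eq_square)
  qed
  have \<theta>_le: "norm ((norm (zf s u))\<^sup>2 - (norm (zr s))\<^sup>2) \<le> \<rho>\<theta> / S" if "u \<in> B" for s u
  proof -
    have "norm ((norm (zf s u))\<^sup>2 - (norm (zr s))\<^sup>2) = \<bar>norm (zf s u) - norm (zr s)\<bar> * (norm (zf s u) + norm (zr s))"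
      by (simp add: power2_eq_square square_diff_square_factored abs_mult mult.commute)
    also have "\<dots> \<le> norm (zf s u - zr s) * (norm (zf s u) + norm (zr s))"
      by (intro mult_right_mono norm_triangle_ineq3) auto
    also have "\<dots> \<le> 4 * N * \<rho>" by (rule z_prod[OF that])
    also have "\<dots> = \<rho>\<theta> / S" using S by (simp add: \<rho>_def \<rho>\<theta>_def eval_nat_numeral)
    finally show ?thesis .
  qed
  have tr_der: "(tr has_vector_derivative (norm (zr s))\<^sup>2) (at s within A)" for s A
    unfolding tr_def zr_def using \<Omega> by (intro kep_t_has_vector_derivative) auto
  have tr_cont: "continuous_on A tr" for A
    unfolding continuous_on_eq_continuous_within
    using tr_der has_vector_derivative_continuous by blast
  have zr_cont: "continuous_on A zr" for A
    unfolding zr_def kep_z_def[abs_def] by (intro continuous_intros)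

  \<comment> \<open>Lipschitz property of the field\<close>
  let ?I = "{0..S}"
  note ul = unif_lipschitz_mult unif_lipschitz_add unif_lipschitz_linear[OF bounded_linear_cnj]
    unif_lipschitz_linear[OF bounded_linear_Re] unif_lipschitz_linear[OF bounded_linear_of_real]
    unif_lipschitz_linear[OF bounded_linear_fst] unif_lipschitz_linear[OF bounded_linear_snd]
    unif_lipschitz_id[OF B(4)] unif_lipschitz_const[OF compact_Icc] unif_lipschitz_Pair
  have ul_z: "unif_lipschitz ?I B zf"
    unfolding zf_def[abs_def] kep_z_def by (intro ul continuous_intros)
  have ul_w: "unif_lipschitz ?I B wf"
    unfolding wf_def[abs_def] kep_w_def diff_conv_add_uminus mult_minus_right[symmetric]
    by (intro ul continuous_intros)
  have ul_t: "unif_lipschitz ?I B tf"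
    unfolding tf_def[abs_def] by (intro ul tr_cont)
  have ul_cis: "unif_lipschitz ?I B (\<lambda>s u. cis (tf s u))"
    by (rule unif_lipschitz_compose[OF ul_t, of UNIV cis 1]) (use norm_cis_diff_le in auto)
  have ul_cis': "unif_lipschitz ?I B (\<lambda>s u. cnj (cis (tf s u)))" by (intro ul ul_cis)
  have ul_p: "unif_lipschitz ?I B pf"
  proof -
    have "unif_lipschitz ?I B (\<lambda>s u. cnj (cis (tf s u)) * (zf s u * zf s u))"
      by (intro ul ul_z ul_cis')
    then have "unif_lipschitz ?I B (\<lambda>s u. X (tf s u) (zf s u))"
      by (simp add: X_def cis_cnj power2_eq_square)
    then have "unif_lipschitz ?I B (\<lambda>s u. perturb \<mu> (X (tf s u) (zf s u)))"
    proof (rule unif_lipschitz_compose)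
      fix s u assume "s \<in> ?I" "u \<in> B"
      from far[OF this(2,1)]
      show "X (tf s u) (zf s u) \<in> {x. \<kappa> / 2 \<le> norm x \<and> d \<le> norm (x - of_real (1 - \<mu>))}" by simp
    next
      fix x y :: complex
      have *: "d \<le> norm (x + of_real \<mu>)" if "\<kappa> / 2 \<le> norm x" for x :: complex
        using norm_diff_ineq[of x "of_real \<mu>"] that \<mu> \<mu>_le d by simp
      assume "x \<in> {x. \<kappa> / 2 \<le> norm x \<and> d \<le> norm (x - of_real (1 - \<mu>))}"
        "y \<in> {x. \<kappa> / 2 \<le> norm x \<and> d \<le> norm (x - of_real (1 - \<mu>))}"
      then show "norm (perturb \<mu> x - perturb \<mu> y) \<le> 8 / d ^ 3 * norm (x - y)"
        using \<mu> \<mu>_le d d1 * by (intro perturb_lipschitz) auto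
    qed
    then have "unif_lipschitz ?I B (\<lambda>s u. cis (tf s u) * perturb \<mu> (X (tf s u) (zf s u)))"
      by (intro ul ul_cis)
    then show ?thesis by (simp add: pf_def[abs_def] inertial_force_def X_def)
  qed
  have ul_q: "unif_lipschitz ?I B qf"
    unfolding qf_def[abs_def] divide_inverse by (intro ul ul_z ul_p continuous_intros)
  have ul_F: "unif_lipschitz ?I B F"
  proof -
    \<comment> \<open>The squared norm is written as the real part of a product, a form covered by
      the closure rules.\<close>
    have "unif_lipschitz ?I B (\<lambda>s u. (cis (- (\<Omega> * s)) * qf s u * inverse (2 * \<i> * of_real \<Omega>),
     - cis (\<Omega> * s) * qf s u * inverse (2 * \<i> * of_real \<Omega>),
     2 * Re (cnj (wf s u * zf s u) * pf s u), Re (zf s u * cnj (zf s u)) + - (norm (zr s))\<^sup>2))"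
      by (intro ul ul_z ul_p ul_q ul_w continuous_intros zr_cont)
    moreover have "Re (zf s u * cnj (zf s u)) = (norm (zf s u))\<^sup>2" for s u
      by (metis Re_complex_of_real complex_norm_square)
    ultimately show ?thesis by (simp only: F_def[abs_def] divide_inverse diff_conv_add_uminus)
  qed
  obtain L where cont: "continuous_on (?I \<times> B) (\<lambda>(s, u). F s u)"
    and lip: "\<And>s u v. s \<in> ?I \<Longrightarrow> u \<in> B \<Longrightarrow> v \<in> B \<Longrightarrow> norm (F s u - F s v) \<le> L * norm (u - v)"
    using ul_F unfolding unif_lipschitz_def by blast

  \<comment> \<open>The solution stays in the box\<close>
  have S0: "0 \<le> S" using S by simp
  obtain u where u0: "u 0 = (\<alpha>0, \<beta>0, 0, 0)" and
    uP: "\<And>s. s \<in> ?I \<Longrightarrow> (u has_vector_derivative F s (closest_point B (u s))) (at s within ?I)"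
    using picard_closest_point[OF S0 B(1-3) cont lip] by blast
  have PB: "closest_point B v \<in> B" for v using B by (simp add: closest_point_in_set)
  note comp = bounded_linear.has_vector_derivative[OF bounded_linear_fst]
    bounded_linear.has_vector_derivative[OF bounded_linear_snd]
  have stay: "norm (f s - f 0) \<le> R" if f: "\<And>s. s \<in> ?I \<Longrightarrow> (f has_vector_derivative f' s) (at s within ?I)"
    and b: "\<And>s. s \<in> ?I \<Longrightarrow> norm (f' s) \<le> R / S" and s: "s \<in> ?I" and R: "0 < R"
    for f :: "real \<Rightarrow> 'x::real_normed_vector" and f' R s
  proof -
    have "norm (f s - f 0) \<le> R / S * \<bar>s - 0\<bar>"
      by (rule norm_diff_le_of_vector_derivative[OF f b s]) (use S in auto)
    also have "\<dots> \<le> R / S * S" using s R S by (intro mult_left_mono) auto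
    finally show ?thesis using S by simp
  qed
  have uB: "u s \<in> B" if s: "s \<in> ?I" for s
  proof -
    have 1: "norm (fst (u s) - fst (u 0)) \<le> \<rho>"
    proof (rule stay[OF comp(1)[OF uP] _ s pos(2)])
      fix s assume "s \<in> ?I"
      show "norm (fst (F s (closest_point B (u s)))) \<le> \<rho> / S"
        unfolding F_def fst_conv by (rule ab_le[OF PB \<open>s \<in> ?I\<close>]) simp
    qed
    have 2: "norm (fst (snd (u s)) - fst (snd (u 0))) \<le> \<rho>"
    proof (rule stay[OF comp(1)[OF comp(2)[OF uP]] _ s pos(2)])
      fix s assume "s \<in> ?I"
      show "norm (fst (snd (F s (closest_point B (u s))))) \<le> \<rho> / S"
        unfolding F_def fst_conv snd_conv by (rule ab_le[OF PB \<open>s \<in> ?I\<close>]) simp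
    qed
    have 3: "norm (fst (snd (snd (u s))) - fst (snd (snd (u 0)))) \<le> \<rho>k"
    proof (rule stay[OF comp(1)[OF comp(2)[OF comp(2)[OF uP]]] _ s pos(1)])
      fix s assume "s \<in> ?I"
      show "norm (fst (snd (snd (F s (closest_point B (u s)))))) \<le> \<rho>k / S"
        unfolding F_def fst_conv snd_conv by (rule k_le[OF PB \<open>s \<in> ?I\<close>])
    qed
    have 4: "norm (snd (snd (snd (u s))) - snd (snd (snd (u 0)))) \<le> \<rho>\<theta>"
    proof (rule stay[OF comp(2)[OF comp(2)[OF comp(2)[OF uP]]] _ s pos(3)])
      fix s assume "s \<in> ?I"
      show "norm (snd (snd (snd (F s (closest_point B (u s)))))) \<le> \<rho>\<theta> / S"
        unfolding F_def fst_conv snd_conv by (rule \<theta>_le[OF PB])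
    qed
    show ?thesis using 1 2 3 4 u0
      by (cases "u s") (auto simp: B_def dist_norm norm_minus_commute)
  qed
  have uD: "(u has_vector_derivative F s (u s)) (at s within ?I)" if "s \<in> ?I" for s
    using uP[OF that] by (simp add: closest_point_self[OF uB[OF that]])

  \<comment> \<open>The equations for position, velocity, energy and time\<close>
  define \<alpha> \<beta> k \<theta> where "\<alpha> s = fst (u s)" and "\<beta> s = fst (snd (u s))" and "k s = fst (snd (snd (u s)))"
    and "\<theta> s = snd (snd (snd (u s)))" for s
  note abk_defs = \<alpha>_def \<beta>_def k_def \<theta>_def
  define z w h t where "z s = zf s (u s)" and "w s = wf s (u s)" and "h s = - 2 * \<Omega>\<^sup>2 + k s"
    and "t s = tf s (u s)" for s
  define q where "q s = qf s (u s)" for s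
  have \<alpha>D: "(\<alpha> has_vector_derivative cis (- (\<Omega> * s)) * q s / (2 * \<i> * of_real \<Omega>)) (at s within ?I)"
    and \<beta>D: "(\<beta> has_vector_derivative - cis (\<Omega> * s) * q s / (2 * \<i> * of_real \<Omega>)) (at s within ?I)"
    and kD: "(k has_vector_derivative 2 * Re (cnj (w s * z s) * inertial_force \<mu> (t s) (z s))) (at s within ?I)"
    and \<theta>D: "(\<theta> has_vector_derivative (norm (z s))\<^sup>2 - (norm (zr s))\<^sup>2) (at s within ?I)"
    if "s \<in> ?I" for s
    using comp(1)[OF uD[OF that]] comp(1)[OF comp(2)[OF uD[OF that]]]
      comp(1)[OF comp(2)[OF comp(2)[OF uD[OF that]]]] comp(2)[OF comp(2)[OF comp(2)[OF uD[OF that]]]]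
    unfolding abk_defs[abs_def] z_def w_def t_def q_def F_def fst_conv snd_conv pf_def by simp_all
  have eD: "((\<lambda>s. cis (\<Omega> * s)) has_vector_derivative of_real \<Omega> * (\<i> * cis (\<Omega> * s))) (at s within A)"
    "((\<lambda>s. cis (- (\<Omega> * s))) has_vector_derivative of_real (- \<Omega>) * (\<i> * cis (- (\<Omega> * s)))) (at s within A)"
    for s A
    by (rule has_vector_derivative_cis; auto intro!: derivative_eq_intros)+
  have ee: "cis (\<Omega> * s) * cis (- (\<Omega> * s)) = 1" for s by (simp add: cis_mult)
  have z_eq: "z = (\<lambda>s. \<alpha> s * cis (\<Omega> * s) + \<beta> s * cis (- (\<Omega> * s)))"
    by (simp add: fun_eq_iff z_def zf_def kep_z_def abk_defs)
  have w_eq: "w = (\<lambda>s. \<i> * of_real \<Omega> * (\<alpha> s * cis (\<Omega> * s) - \<beta> s * cis (- (\<Omega> * s))))"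
    by (simp add: fun_eq_iff w_def wf_def kep_w_def abk_defs)
  have q_eq: "q s = of_real (k s / 2) * z s + z s * cnj (z s) * cnj (z s) * inertial_force \<mu> (t s) (z s) / 2" for s
    by (simp add: q_def qf_def pf_def z_def t_def abk_defs)
  \<comment> \<open>The two terms with \<open>q\<close> cancel, by the first equation of the
    variation of constants.\<close>
  have zD: "(z has_vector_derivative w s) (at s within ?I)" if "s \<in> ?I" for s
  proof -
    let ?e = "cis (\<Omega> * s)" and ?f = "cis (- (\<Omega> * s))" and ?c = "2 * \<i> * complex_of_real \<Omega>"
    have "(z has_vector_derivative
        (\<alpha> s * (of_real \<Omega> * (\<i> * ?e)) + ?f * q s / ?c * ?e)
        + (\<beta> s * (of_real (- \<Omega>) * (\<i> * ?f)) + - ?e * q s / ?c * ?f)) (at s within ?I)"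
      unfolding z_eq by (intro has_vector_derivative_add has_vector_derivative_mult \<alpha>D \<beta>D eD that)
    also have "(\<alpha> s * (of_real \<Omega> * (\<i> * ?e)) + ?f * q s / ?c * ?e)
        + (\<beta> s * (of_real (- \<Omega>) * (\<i> * ?f)) + - ?e * q s / ?c * ?f) = w s"
      by (simp add: w_eq algebra_simps)
    finally show ?thesis .
  qed
  have wD: "(w has_vector_derivative of_real (h s / 2) * z s
        + z s * cnj (z s) * cnj (z s) * inertial_force \<mu> (t s) (z s) / 2) (at s within ?I)" if "s \<in> ?I" for s
  proof -
    let ?e = "cis (\<Omega> * s)" and ?f = "cis (- (\<Omega> * s))" and ?c = "2 * \<i> * complex_of_real \<Omega>"
    have "(w has_vector_derivative \<i> * of_real \<Omega> *
        ((\<alpha> s * (of_real \<Omega> * (\<i> * ?e)) + ?f * q s / ?c * ?e)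
        - (\<beta> s * (of_real (- \<Omega>) * (\<i> * ?f)) + - ?e * q s / ?c * ?f))) (at s within ?I)"
      unfolding w_eq
      by (intro has_vector_derivative_mult_right has_vector_derivative_diff has_vector_derivative_mult \<alpha>D \<beta>D eD that)
    also have "\<i> * of_real \<Omega> * ((\<alpha> s * (of_real \<Omega> * (\<i> * ?e)) + ?f * q s / ?c * ?e)
        - (\<beta> s * (of_real (- \<Omega>) * (\<i> * ?f)) + - ?e * q s / ?c * ?f))
        = - (of_real \<Omega>)\<^sup>2 * (\<alpha> s * ?e + \<beta> s * ?f) + (\<i> * of_real \<Omega> / ?c * 2) * (?e * ?f) * q s"
      by (simp add: algebra_simps power2_eq_square)
    also have "\<dots> = - (of_real \<Omega>)\<^sup>2 * z s + q s"
      using \<Omega> by (simp add: ee z_eq)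
    also have "\<dots> = of_real (h s / 2) * z s
        + z s * cnj (z s) * cnj (z s) * inertial_force \<mu> (t s) (z s) / 2"
      by (simp add: q_eq h_def field_simps)
    finally show ?thesis .
  qed
  have hD: "(h has_vector_derivative 2 * Re (cnj (w s * z s) * inertial_force \<mu> (t s) (z s))) (at s within ?I)"
    if "s \<in> ?I" for s
    using has_vector_derivative_add[OF has_vector_derivative_const kD[OF that], of "- 2 * \<Omega>\<^sup>2"]
    by (simp only: h_def[abs_def] add_0_left)
  have tD: "(t has_vector_derivative (norm (z s))\<^sup>2) (at s within ?I)" if "s \<in> ?I" for s
    using has_vector_derivative_add[OF tr_der \<theta>D[OF that]]
    by (simp add: t_def[abs_def] tf_def \<theta>_def)
  show ?thesis
  proof (rule that[of z w h t])
    show "z 0 = \<alpha>0 + \<beta>0" "w 0 = \<i> * of_real \<Omega> * (\<alpha>0 - \<beta>0)" "h 0 = - 2 * \<Omega>\<^sup>2" "t 0 = 0"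
      using u0 by (simp_all add: z_eq w_eq h_def t_def tf_def tr_def abk_defs)
    fix s assume s: "s \<in> ?I"
    note b = uB[OF s]
    show "(z has_vector_derivative w s) (at s within ?I)" by (rule zD[OF s])
    show "(w has_vector_derivative of_real (h s / 2) * z s
        + z s * cnj (z s) * cnj (z s) * inertial_force \<mu> (t s) (z s) / 2) (at s within ?I)"
      by (rule wD[OF s])
    show "(h has_vector_derivative 2 * Re (cnj (w s * z s) * inertial_force \<mu> (t s) (z s))) (at s within ?I)"
      by (rule hD[OF s])
    show "(t has_vector_derivative (norm (z s))\<^sup>2) (at s within ?I)" by (rule tD[OF s])
    show "norm (z s - zr s) \<le> \<epsilon>" using z_dev[OF b, of s] r(3) by (simp add: z_def)
    show "norm (w s - wr s) \<le> \<epsilon>" using w_dev[OF b, of s] r(3) by (simp add: w_def)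
    show "\<bar>t s - tr s\<bar> \<le> \<epsilon>" using box(4)[OF b] r(2) by (simp add: t_def tf_def)
    show "norm (X (t s) (z s) - X (tr s) (zr s)) \<le> \<epsilon>" using X_dev[OF b] by (simp add: z_def t_def)
    show "\<kappa> / 2 \<le> norm (X (t s) (z s)) \<and> d \<le> norm (X (t s) (z s) - of_real (1 - \<mu>))"
      using far[OF b s] by (simp add: z_def t_def)
  qed
qed

section \<open>From regularized solutions to orbits of the Hamiltonian flow\<close>

text \<open>Complex notation makes rotations and the squaring map of Levi-Civita algebraic;
  \<open>vec2\<close> carries the result to the real plane of the statement.\<close>

definition vec2 :: "complex \<Rightarrow> real^2" where
  "vec2 c = vector [Re c, Im c]"

lemma vec2_nth [simp]: "vec2 c $ 1 = Re c" "vec2 c $ 2 = Im c"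
  by (simp_all add: vec2_def)

lemma bounded_linear_vec2: "bounded_linear vec2"
  unfolding linear_conv_bounded_linear[symmetric]
  by (rule linearI) (simp_all add: vec_eq_iff forall_2)

lemma vec2_add: "vec2 (a + b) = vec2 a + vec2 b"
  and vec2_diff: "vec2 (a - b) = vec2 a - vec2 b"
  and vec2_minus: "vec2 (- a) = - vec2 a"
  by (simp_all add: vec_eq_iff forall_2)

lemma norm_vec2 [simp]: "norm (vec2 c) = norm c"
  by (simp add: norm_vec_def L2_set_def UNIV_2 cmod_def)

lemma vec2_eq_iff [simp]: "vec2 a = vec2 b \<longleftrightarrow> a = b"
  by (auto simp: vec_eq_iff forall_2 complex_eq_iff)

lemma vector_eq_vec2: "vector [a, b] = vec2 (Complex a b)"
  by (simp add: vec2_def)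

lemma vec2_surj: "\<exists>c. v = vec2 c"
  by (rule exI[of _ "Complex (v $ 1) (v $ 2)"]) (simp add: vec_eq_iff forall_2)

lemma J_mult: "(J *v v) $ 1 = v $ 2" "(J *v v) $ 2 = - v $ 1"
  by (simp_all add: J_def matrix_vector_mult_def UNIV_2)

lemma J_vec2: "J *v vec2 c = vec2 (- \<i> * c)"
  by (simp add: vec_eq_iff forall_2 J_mult)

lemma inner_J: "x \<bullet> (J *v y) = - ((J *v x) \<bullet> y)"
  by (simp add: inner_vec_def UNIV_2 J_mult)

lemma has_derivative_inverse_norm_diff:
  fixes a :: "'a::real_inner"
  assumes "fst p \<noteq> a"
  shows "((\<lambda>p. 1 / norm (fst p - a)) has_derivative
    (\<lambda>h. - ((fst p - a) \<bullet> fst h) / norm (fst p - a) ^ 3)) (at p)"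
proof -
  have "((\<lambda>p. norm (fst p - a)) has_derivative (\<lambda>h. fst h \<bullet> sgn (fst p - a))) (at p)"
  proof -
    have "((\<lambda>p. fst p - a) has_derivative fst) (at p)" by (auto intro!: derivative_eq_intros)
    from has_derivative_compose[OF this GDERIV_norm[unfolded gderiv_def]] assms
    show ?thesis by simp
  qed
  from Deriv.has_derivative_inverse[OF _ this] assms
  have "((\<lambda>p. inverse (norm (fst p - a))) has_derivative
      (\<lambda>h. - (inverse (norm (fst p - a)) * (fst h \<bullet> sgn (fst p - a)) * inverse (norm (fst p - a))))) (at p)"
    by simp
  then show ?thesis
    unfolding inverse_eq_divide by (rule has_derivative_eq_rhs)
      (simp add: fun_eq_iff sgn_div_norm inner_commute[of "fst p - a"] divide_simps power3_eq_cube)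
qed

lemma GDERIV_rc3bp_H:
  fixes x y :: "real^2" and \<mu> :: real
  defines "a \<equiv> vector [1 - \<mu>, 0]" and "b \<equiv> vector [- \<mu>, 0]"
  assumes "x \<noteq> a" "x \<noteq> b"
  shows "GDERIV (rc3bp_H \<mu>) (x, y) :>
    (- (J *v y) + (\<mu> / norm (x - a) ^ 3) *\<^sub>R (x - a) + ((1 - \<mu>) / norm (x - b) ^ 3) *\<^sub>R (x - b),
     y + J *v x)"
proof -
  have H: "rc3bp_H \<mu> = (\<lambda>p. (snd p \<bullet> snd p) / 2 - fst p \<bullet> (J *v snd p)
      - \<mu> * (1 / norm (fst p - a)) - (1 - \<mu>) * (1 / norm (fst p - b)))"
    by (simp add: rc3bp_H_def fun_eq_iff a_def b_def power2_norm_eq_inner split_beta)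
  have 1: "((\<lambda>p. J *v snd p) has_derivative (\<lambda>h. J *v snd h)) (at (x, y))"
    by (intro bounded_linear.has_derivative[OF matrix_vector_mul_bounded_linear] derivative_intros)
  have 2: "((\<lambda>p. 1 / norm (fst p - a)) has_derivative
      (\<lambda>h. - ((x - a) \<bullet> fst h) / norm (x - a) ^ 3)) (at (x, y))"
    using has_derivative_inverse_norm_diff[of "(x, y)" a] assms by simp
  have 3: "((\<lambda>p. 1 / norm (fst p - b)) has_derivative
      (\<lambda>h. - ((x - b) \<bullet> fst h) / norm (x - b) ^ 3)) (at (x, y))"
    using has_derivative_inverse_norm_diff[of "(x, y)" b] assms by simp
  have 4: "((\<lambda>p. (snd p \<bullet> snd p) / 2) has_derivative (\<lambda>h. y \<bullet> snd h)) (at (x, y))"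
    by (auto intro!: derivative_eq_intros simp: inner_commute)
  have 5: "((\<lambda>p. fst p \<bullet> (J *v snd p)) has_derivative (\<lambda>h. x \<bullet> (J *v snd h) + fst h \<bullet> (J *v y))) (at (x, y))"
    using has_derivative_inner[OF has_derivative_fst[OF has_derivative_ident] 1] by simp
  have "(rc3bp_H \<mu> has_derivative (\<lambda>h. y \<bullet> snd h - (x \<bullet> (J *v snd h) + fst h \<bullet> (J *v y))
      - \<mu> * (- ((x - a) \<bullet> fst h) / norm (x - a) ^ 3)
      - (1 - \<mu>) * (- ((x - b) \<bullet> fst h) / norm (x - b) ^ 3))) (at (x, y))"
    unfolding H
    by (intro has_derivative_diff bounded_linear.has_derivative[OF bounded_linear_mult_right] 2 3 4 5)
  then show ?thesis
    unfolding gderiv_def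
    by (rule has_derivative_eq_rhs)
      (simp add: fun_eq_iff inner_prod_def inner_J[of x] inner_add_right inner_commute[of y]
        inner_commute[of "x - a"] inner_commute[of "x - b"] inner_commute[of "J *v x"]
        inner_diff_right[of _ "_ *\<^sub>R _"])
qed

text \<open>\<open>J\<close> acts as multiplication by -\<i>, so Hamilton's equations take this
  complex form. The momentum Y is the inertial velocity written in the rotating axes, which explains
  the term -\<i> X in X'.\<close>

lemma rc3bp_orbit_complexI:
  assumes "0 \<le> T"
    and "\<And>s. s \<in> {0..T} \<Longrightarrow> X s \<noteq> of_real (1 - \<mu>) \<and> X s \<noteq> of_real (- \<mu>)"
    and "\<And>s. s \<in> {0..T} \<Longrightarrow> (X has_vector_derivative Y s - \<i> * X s) (at s within {0..T})"
    and "\<And>s. s \<in> {0..T} \<Longrightarrow> (Y has_vector_derivative - \<i> * Y s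
       - of_real (1 - \<mu>) * kernel3 (X s + of_real \<mu>) - of_real \<mu> * kernel3 (X s - of_real (1 - \<mu>)))
       (at s within {0..T})"
  shows "hamiltonian_orbit (rc3bp_H \<mu>) (rc3bp_domain \<mu>) T (\<lambda>s. (vec2 (X s), vec2 (Y s)))"
  unfolding hamiltonian_orbit_def
proof
  fix s assume "s \<in> closed_segment 0 T"
  then have s: "s \<in> {0..T}" and seg: "closed_segment 0 T = {0..T}"
    using assms(1) by (auto simp: closed_segment_eq_real_ivl)
  have v: "vector [1 - \<mu>, 0] = vec2 (of_real (1 - \<mu>))" "vector [- \<mu>, 0] = vec2 (of_real (- \<mu>))"
    by (simp_all add: vector_eq_vec2 complex_of_real_def)
  have k: "(m / norm (vec2 c) ^ 3) *\<^sub>R vec2 c = vec2 (of_real m * kernel3 c)" for m c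
    by (simp add: vec_eq_iff forall_2 kernel3_def flip: of_real_power)
  let ?a = "vector [1 - \<mu>, 0] :: real^2" and ?b = "vector [- \<mu>, 0] :: real^2"
  let ?g = "(- (J *v vec2 (Y s)) + (\<mu> / norm (vec2 (X s) - ?a) ^ 3) *\<^sub>R (vec2 (X s) - ?a)
      + ((1 - \<mu>) / norm (vec2 (X s) - ?b) ^ 3) *\<^sub>R (vec2 (X s) - ?b), vec2 (Y s) + J *v vec2 (X s))"
  have n: "vec2 (X s) \<noteq> ?a" "vec2 (X s) \<noteq> ?b"
    using assms(2)[OF s] unfolding v vec2_eq_iff by auto
  have "snd ?g = vec2 (Y s - \<i> * X s)" by (simp add: J_vec2 vec2_diff vec2_minus)
  moreover have "- fst ?g = vec2 (- \<i> * Y s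
       - of_real (1 - \<mu>) * kernel3 (X s + of_real \<mu>) - of_real \<mu> * kernel3 (X s - of_real (1 - \<mu>)))"
  proof -
    have "fst ?g = vec2 (- (- \<i> * Y s) + of_real \<mu> * kernel3 (X s - of_real (1 - \<mu>))
        + of_real (1 - \<mu>) * kernel3 (X s - of_real (- \<mu>)))"
      unfolding v fst_conv J_vec2 vec2_diff[symmetric] k vec2_minus[symmetric] vec2_add[symmetric] ..
    then show ?thesis by (simp only: vec2_minus[symmetric]) (simp add: algebra_simps)
  qed
  ultimately have "((\<lambda>s. (vec2 (X s), vec2 (Y s))) has_vector_derivative (snd ?g, - fst ?g)) (at s within {0..T})"
    by (simp only:)
      (intro has_vector_derivative_Pair bounded_linear.has_vector_derivative[OF bounded_linear_vec2] assms(3,4) s)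
  then show "(vec2 (X s), vec2 (Y s)) \<in> rc3bp_domain \<mu> \<and>
      (\<exists>g. (GDERIV (rc3bp_H \<mu>) (vec2 (X s), vec2 (Y s)) :> g) \<and>
        ((\<lambda>s. (vec2 (X s), vec2 (Y s))) has_vector_derivative (snd g, - fst g)) (at s within closed_segment 0 T))"
    unfolding seg using GDERIV_rc3bp_H[OF n, of "vec2 (Y s)"] n
    by (intro conjI exI[of _ ?g]) (simp_all only: rc3bp_domain_def mem_Collect_eq prod.case simp_thms)
qed

text \<open>Orbits are to be parametrized by physical time again. At the ends of the interval the
  derivatives are one-sided, which is the form in which \<open>hamiltonian_orbit\<close> asks for
  them.\<close>

lemma time_change_inverse:
  fixes t :: "real \<Rightarrow> real"
  assumes S: "0 \<le> S" and t: "\<And>s. s \<in> {0..S} \<Longrightarrow> (t has_vector_derivative r s) (at s within {0..S})"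
    and r: "\<And>s. s \<in> {0..S} \<Longrightarrow> 0 < r s"
  obtains \<sigma> where "\<And>s. s \<in> {0..S} \<Longrightarrow> \<sigma> (t s) = s" "t ` {0..S} = {t 0..t S}"
    "\<And>x. x \<in> {t 0..t S} \<Longrightarrow> \<sigma> x \<in> {0..S} \<and> t (\<sigma> x) = x"
    "\<And>x. x \<in> {t 0..t S} \<Longrightarrow> (\<sigma> has_vector_derivative (1 / r (\<sigma> x))) (at x within {t 0..t S})"
    "\<And>s s'. s \<in> {0..S} \<Longrightarrow> s' \<in> {0..S} \<Longrightarrow> s < s' \<Longrightarrow> t s < t s'"
proof -
  have cont: "continuous_on {0..S} t"
    unfolding continuous_on_eq_continuous_within using t has_vector_derivative_continuous by blast
  have mono: "t s < t s'" if "s \<in> {0..S}" "s' \<in> {0..S}" "s < s'" for s s'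
  proof (rule DERIV_pos_imp_increasing_open[OF that(3)])
    show "continuous_on {s..s'} t" by (rule continuous_on_subset[OF cont]) (use that in auto)
    fix x assume x: "s < x" "x < s'"
    then have "at x within {0..S} = at x"
      using that by (intro at_within_interior) auto
    moreover have "(t has_vector_derivative r x) (at x within {0..S})" by (rule t) (use x that in auto)
    ultimately have "(t has_real_derivative r x) (at x)"
      unfolding has_real_derivative_iff_has_vector_derivative by simp
    then show "\<exists>y. (t has_real_derivative y) (at x) \<and> 0 < y" using r[of x] x that by auto
  qed
  have inj: "inj_on t {0..S}" by (rule linorder_inj_onI') (use mono in force)
  have img: "t ` {0..S} = {t 0..t S}"
  proof
    show "t ` {0..S} \<subseteq> {t 0..t S}"
    proof clarify
      fix s assume "s \<in> {0..S}"
      then show "t s \<in> {t 0..t S}"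
        using mono[of 0 s] mono[of s S] S by (cases "s = 0"; cases "s = S") auto
    qed
    show "{t 0..t S} \<subseteq> t ` {0..S}"
      using IVT'[of t 0 _ S] cont S by fastforce
  qed
  define \<sigma> where "\<sigma> = inv_into {0..S} t"
  have \<sigma>1: "\<sigma> (t s) = s" if "s \<in> {0..S}" for s unfolding \<sigma>_def by (rule inv_into_f_f[OF inj that])
  have \<sigma>2: "\<sigma> x \<in> {0..S} \<and> t (\<sigma> x) = x" if "x \<in> {t 0..t S}" for x
    using that \<sigma>1 unfolding img[symmetric] by auto
  have c\<sigma>: "continuous_on {t 0..t S} \<sigma>"
    unfolding img[symmetric] by (rule continuous_on_inv[OF cont]) (use \<sigma>1 in auto)
  have "(\<sigma> has_vector_derivative (1 / r (\<sigma> x))) (at x within {t 0..t S})" if x: "x \<in> {t 0..t S}" for x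
  proof -
    have s: "\<sigma> x \<in> {0..S}" "t (\<sigma> x) = x" using \<sigma>2[OF x] by auto
    have "(\<sigma> has_derivative (\<lambda>h. h * (1 / r (\<sigma> x)))) (at (t (\<sigma> x)) within t ` {0..S})"
    proof (rule has_derivative_inverse_within)
      show "(t has_derivative (\<lambda>h. h * r (\<sigma> x))) (at (\<sigma> x) within {0..S})"
        using t[OF s(1)] by (simp add: has_vector_derivative_def)
      show "continuous (at (t (\<sigma> x)) within t ` {0..S}) \<sigma>"
        unfolding img s(2) using c\<sigma> x by (simp add: continuous_on_eq_continuous_within)
      show "(\<lambda>h. h * (1 / r (\<sigma> x))) \<circ> (\<lambda>h. h * r (\<sigma> x)) = id"
        using r[OF s(1)] by (simp add: fun_eq_iff)
      show "linear (\<lambda>h. h * (1 / r (\<sigma> x)))" by (intro bounded_linear.linear bounded_linear_mult_left)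
    qed (use s \<sigma>1 in auto)
    then show ?thesis unfolding img s(2) has_vector_derivative_def by simp
  qed
  then show ?thesis by (intro that[of \<sigma>] \<sigma>1 img \<sigma>2 mono)
qed

text \<open>The regularized system treats the Kepler energy h as an unknown of its own. Its
  solutions describe the three body problem on the level h |z|^2 = 2 |w|^2 - 1, which is the
  definition of the energy for position z^2 and momentum 2 w / \<open>cnj z\<close>. The force terms
  of h' and w' cancel in this relation, so it persists once it holds at s = 0.\<close>

lemma regularized_orbit:
  fixes z w :: "real \<Rightarrow> complex" and h t :: "real \<Rightarrow> real"
  defines "X \<equiv> \<lambda>s. cis (- t s) * (z s)\<^sup>2" and "Y \<equiv> \<lambda>s. cis (- t s) * (2 * w s / cnj (z s))"
  assumes S: "0 < S" and t0: "t 0 = 0" and h0: "h 0 * (norm (z 0))\<^sup>2 = 2 * (norm (w 0))\<^sup>2 - 1"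
    and z0: "\<And>s. s \<in> {0..S} \<Longrightarrow> z s \<noteq> 0"
    and zD: "\<And>s. s \<in> {0..S} \<Longrightarrow> (z has_vector_derivative w s) (at s within {0..S})"
    and wD: "\<And>s. s \<in> {0..S} \<Longrightarrow> (w has_vector_derivative of_real (h s / 2) * z s
        + z s * cnj (z s) * cnj (z s) * inertial_force \<mu> (t s) (z s) / 2) (at s within {0..S})"
    and hD: "\<And>s. s \<in> {0..S} \<Longrightarrow> (h has_vector_derivative
        2 * Re (cnj (w s * z s) * inertial_force \<mu> (t s) (z s))) (at s within {0..S})"
    and tD: "\<And>s. s \<in> {0..S} \<Longrightarrow> (t has_vector_derivative (norm (z s))\<^sup>2) (at s within {0..S})"
    and X0: "\<And>s. s \<in> {0..S} \<Longrightarrow> X s \<noteq> of_real (1 - \<mu>) \<and> X s \<noteq> of_real (- \<mu>)"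
  obtains \<gamma> where "\<And>s. s \<in> {0..S} \<Longrightarrow> \<gamma> (t s) = (vec2 (X s), vec2 (Y s))"
    "\<And>s. s \<in> {0..S} \<Longrightarrow> hamiltonian_orbit (rc3bp_H \<mu>) (rc3bp_domain \<mu>) (t s) \<gamma>"
    "\<And>s s'. s \<in> {0..S} \<Longrightarrow> s' \<in> {0..S} \<Longrightarrow> s < s' \<Longrightarrow> t s < t s'"
proof -
  let ?I = "{0..S}"
  define p where "p s = inertial_force \<mu> (t s) (z s)" for s
  have energy: "of_real (h s) * (z s * cnj (z s)) = 2 * (w s * cnj (w s)) - 1" if s: "s \<in> ?I" for s
  proof -
    define E where "E s = of_real (h s) * (z s * cnj (z s)) - 2 * (w s * cnj (w s)) + 1" for s
    have "(E has_vector_derivative 0) (at s within ?I)" if "s \<in> ?I" for s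
    proof -
      let ?w' = "of_real (h s / 2) * z s + z s * cnj (z s) * cnj (z s) * p s / 2"
      define R where "R = complex_of_real (2 * Re (cnj (w s * z s) * p s))"
      have R: "R = cnj (w s * z s) * p s + w s * z s * cnj (p s)"
        using complex_add_cnj[of "cnj (w s * z s) * p s"] by (simp add: R_def)
      have hD': "((\<lambda>s. of_real (h s)) has_vector_derivative R) (at s within ?I)"
        unfolding p_def R_def
        by (rule bounded_linear.has_vector_derivative[OF bounded_linear_of_real hD[OF that]])
      have "(E has_vector_derivative
          (of_real (h s) * (z s * cnj (w s) + w s * cnj (z s)) + R * (z s * cnj (z s)))
          - 2 * (w s * cnj ?w' + ?w' * cnj (w s)) + 0) (at s within ?I)"
        unfolding E_def
        by (intro has_vector_derivative_add has_vector_derivative_diff has_vector_derivative_mult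
            has_vector_derivative_mult_right has_vector_derivative_cnj zD hD' that
            has_vector_derivative_const wD[OF that, folded p_def])
      moreover have "(of_real (h s) * (z s * cnj (w s) + w s * cnj (z s)) + R * (z s * cnj (z s)))
          - 2 * (w s * cnj ?w' + ?w' * cnj (w s)) + 0 = 0"
        unfolding R by (simp add: field_simps)
      ultimately show ?thesis by (simp only:)
    qed
    then obtain c where "\<forall>s\<in>?I. E s = c"
      using has_derivative_zero_constant[of ?I E] by (auto simp: has_vector_derivative_def)
    moreover have "E 0 = of_real (h 0 * (norm (z 0))\<^sup>2 - 2 * (norm (w 0))\<^sup>2 + 1)"
      by (simp add: E_def complex_norm_square del: of_real_power)
    ultimately have "E s = 0" using h0 s S by simp
    then show ?thesis by (simp add: E_def algebra_simps)
  qed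
  have cisD: "((\<lambda>s. cis (- t s)) has_vector_derivative of_real (- (norm (z s))\<^sup>2) * (\<i> * cis (- t s))) (at s within ?I)"
    if "s \<in> ?I" for s
    by (intro has_vector_derivative_cis has_vector_derivative_minus tD that)
  have XD: "(X has_vector_derivative (norm (z s))\<^sup>2 *\<^sub>R (Y s - \<i> * X s)) (at s within ?I)" if "s \<in> ?I" for s
  proof -
    have "(X has_vector_derivative cis (- t s) * (z s * w s + w s * z s)
        + of_real (- (norm (z s))\<^sup>2) * (\<i> * cis (- t s)) * (z s * z s)) (at s within ?I)"
      unfolding X_def power2_eq_square[of "z _"]
      by (intro has_vector_derivative_mult cisD zD that)
    moreover have "cis (- t s) * (z s * w s + w s * z s)
        + of_real (- (norm (z s))\<^sup>2) * (\<i> * cis (- t s)) * (z s * z s) = (norm (z s))\<^sup>2 *\<^sub>R (Y s - \<i> * X s)"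
      unfolding scaleR_conv_of_real of_real_minus complex_norm_square X_def Y_def
      using z0[OF that] by (simp add: field_simps power2_eq_square)
    ultimately show ?thesis by simp
  qed
  have YD: "(Y has_vector_derivative (norm (z s))\<^sup>2 *\<^sub>R (- \<i> * Y s
       - of_real (1 - \<mu>) * kernel3 (X s + of_real \<mu>) - of_real \<mu> * kernel3 (X s - of_real (1 - \<mu>))))
       (at s within ?I)" if "s \<in> ?I" for s
  proof -
    let ?w' = "of_real (h s / 2) * z s + z s * cnj (z s) * cnj (z s) * p s / 2"
    have z: "z s \<noteq> 0" "cnj (z s) \<noteq> 0" using z0[OF that] by auto
    have inv: "((\<lambda>s. inverse (cnj (z s))) has_vector_derivative - (cnj (w s) / (cnj (z s))\<^sup>2)) (at s within ?I)"
    proof -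
      have "(inverse has_field_derivative - (inverse (cnj (z s)) ^ Suc (Suc 0))) (at (cnj (z s)))"
        by (rule DERIV_inverse) (use z in simp)
      note field_vector_diff_chain_within[OF has_vector_derivative_cnj[OF zD[OF that]]
          has_field_derivative_at_within[OF this]]
      moreover have "cnj (w s) * - (inverse (cnj (z s)) ^ Suc (Suc 0)) = - (cnj (w s) / (cnj (z s))\<^sup>2)"
        by (simp add: divide_inverse power2_eq_square)
      ultimately show ?thesis by (simp only: o_def)
    qed
    have "(Y has_vector_derivative cis (- t s) * (2 * (w s * - (cnj (w s) / (cnj (z s))\<^sup>2) + ?w' * inverse (cnj (z s))))
        + of_real (- (norm (z s))\<^sup>2) * (\<i> * cis (- t s)) * (2 * (w s * inverse (cnj (z s))))) (at s within ?I)"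
      unfolding Y_def divide_inverse mult.assoc[of 2]
      by (intro has_vector_derivative_mult has_vector_derivative_mult_right cisD that inv[unfolded divide_inverse]
          wD[OF that, folded p_def, unfolded divide_inverse])
    also have "cis (- t s) * (2 * (w s * - (cnj (w s) / (cnj (z s))\<^sup>2) + ?w' * inverse (cnj (z s))))
        + of_real (- (norm (z s))\<^sup>2) * (\<i> * cis (- t s)) * (2 * (w s * inverse (cnj (z s))))
        = cis (- t s) * (- (1 / (cnj (z s))\<^sup>2) + z s * cnj (z s) * p s)
          - of_real ((norm (z s))\<^sup>2) * \<i> * Y s"
    proof -
      \<comment> \<open>The energy relation turns the terms with h and w into the attraction of a
        unit mass at the origin.\<close>
      have "2 * (w s * - (cnj (w s) / (cnj (z s))\<^sup>2) + ?w' * inverse (cnj (z s)))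
        = (of_real (h s) * (z s * cnj (z s)) - 2 * (w s * cnj (w s))) / (cnj (z s))\<^sup>2 + z s * cnj (z s) * p s"
        using z by (simp add: field_simps power2_eq_square)
      also have "\<dots> = - (1 / (cnj (z s))\<^sup>2) + z s * cnj (z s) * p s"
        unfolding energy[OF that] by simp
      finally have 1: "2 * (w s * - (cnj (w s) / (cnj (z s))\<^sup>2) + ?w' * inverse (cnj (z s)))
        = - (1 / (cnj (z s))\<^sup>2) + z s * cnj (z s) * p s" .
      show ?thesis unfolding 1 Y_def by (simp add: divide_inverse)
    qed
    also have "cis (- t s) * (- (1 / (cnj (z s))\<^sup>2) + z s * cnj (z s) * p s)
        = of_real ((norm (z s))\<^sup>2) * (- kernel3 (X s) + perturb \<mu> (X s))"
    proof -
      have pX: "cis (- t s) * p s = perturb \<mu> (X s)"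
        by (simp add: p_def inertial_force_def X_def cis_mult flip: mult.assoc)
      have nX: "norm (X s) = (norm (z s))\<^sup>2" by (simp add: X_def norm_mult norm_power)
      have "of_real ((norm (z s))\<^sup>2) * kernel3 (X s) = X s / of_real (((norm (z s))\<^sup>2)\<^sup>2)"
        using z unfolding kernel3_def nX by (simp add: field_simps eval_nat_numeral)
      also have "\<dots> = cis (- t s) * (1 / (cnj (z s))\<^sup>2)"
        using z unfolding of_real_power[of "(norm (z s))\<^sup>2" 2] complex_norm_square
        by (simp add: X_def field_simps power_mult_distrib)
      finally show ?thesis
        unfolding distrib_left mult_minus_right complex_norm_square[symmetric] pX[symmetric]
        by (simp add: mult_ac)
    qed
    also have "\<dots> - of_real ((norm (z s))\<^sup>2) * \<i> * Y s = (norm (z s))\<^sup>2 *\<^sub>R (- \<i> * Y s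
       - of_real (1 - \<mu>) * kernel3 (X s + of_real \<mu>) - of_real \<mu> * kernel3 (X s - of_real (1 - \<mu>)))"
      unfolding perturb_def scaleR_conv_of_real by (simp add: algebra_simps)
    finally show ?thesis .
  qed
  obtain \<sigma> where \<sigma>: "\<And>s. s \<in> ?I \<Longrightarrow> \<sigma> (t s) = s" "t ` ?I = {t 0..t S}"
    "\<And>x. x \<in> {t 0..t S} \<Longrightarrow> \<sigma> x \<in> ?I \<and> t (\<sigma> x) = x"
    "\<And>x. x \<in> {t 0..t S} \<Longrightarrow> (\<sigma> has_vector_derivative (1 / (norm (z (\<sigma> x)))\<^sup>2)) (at x within {t 0..t S})"
    "\<And>s s'. s \<in> ?I \<Longrightarrow> s' \<in> ?I \<Longrightarrow> s < s' \<Longrightarrow> t s < t s'"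
    using time_change_inverse[of S t "\<lambda>s. (norm (z s))\<^sup>2"] S tD z0 by auto
  have t_in: "t s \<in> {t 0..t S}" if "s \<in> ?I" for s
    unfolding \<sigma>(2)[symmetric] using that by (rule imageI)
  \<comment> \<open>The factor |z|^2 of the regularized derivatives cancels against the derivative
    of the inverse time change.\<close>
  have chain: "((\<lambda>x. f (\<sigma> x)) has_vector_derivative f' (\<sigma> x)) (at x within {0..t s})"
    if f: "\<And>s. s \<in> ?I \<Longrightarrow> (f has_vector_derivative (norm (z s))\<^sup>2 *\<^sub>R f' s) (at s within ?I)"
      and x: "x \<in> {0..t s}" and s: "s \<in> ?I" for f f' :: "real \<Rightarrow> complex" and x s
  proof -
    have sub: "{0..t s} \<subseteq> {t 0..t S}" using t_in[OF s] t0 by auto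
    then have x': "x \<in> {t 0..t S}" using x by auto
    then have s: "\<sigma> x \<in> ?I" using \<sigma>(3) by auto
    have "\<sigma> ` {t 0..t S} \<subseteq> ?I" using \<sigma>(3) by auto
    then have "(f has_vector_derivative (norm (z (\<sigma> x)))\<^sup>2 *\<^sub>R f' (\<sigma> x)) (at (\<sigma> x) within \<sigma> ` {t 0..t S})"
      by (rule has_vector_derivative_within_subset[OF f[OF s]])
    from vector_diff_chain_within[OF \<sigma>(4)[OF x'] this]
    have "((\<lambda>x. f (\<sigma> x)) has_vector_derivative f' (\<sigma> x)) (at x within {t 0..t S})"
      using z0[OF s] by (simp add: o_def)
    then show ?thesis by (rule has_vector_derivative_within_subset[OF _ sub])
  qed
  show ?thesis
  proof (rule that[of "\<lambda>x. (vec2 (X (\<sigma> x)), vec2 (Y (\<sigma> x)))"])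
    fix s assume s: "s \<in> ?I"
    show "(vec2 (X (\<sigma> (t s))), vec2 (Y (\<sigma> (t s)))) = (vec2 (X s), vec2 (Y s))" by (simp add: \<sigma>(1)[OF s])
    have sub: "{0..t s} \<subseteq> {t 0..t S}" using t_in[OF s] t0 by auto
    have "0 \<le> t s" using t_in[OF s] t0 by auto
    then show "hamiltonian_orbit (rc3bp_H \<mu>) (rc3bp_domain \<mu>) (t s) (\<lambda>x. (vec2 (X (\<sigma> x)), vec2 (Y (\<sigma> x))))"
    proof (rule rc3bp_orbit_complexI)
      fix x assume x: "x \<in> {0..t s}"
      show "X (\<sigma> x) \<noteq> of_real (1 - \<mu>) \<and> X (\<sigma> x) \<noteq> of_real (- \<mu>)"
        using x sub \<sigma>(3) by (intro X0) auto
      show "((\<lambda>x. X (\<sigma> x)) has_vector_derivative Y (\<sigma> x) - \<i> * X (\<sigma> x)) (at x within {0..t s})"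
        by (rule chain[OF XD x s])
      show "((\<lambda>x. Y (\<sigma> x)) has_vector_derivative - \<i> * Y (\<sigma> x)
       - of_real (1 - \<mu>) * kernel3 (X (\<sigma> x) + of_real \<mu>) - of_real \<mu> * kernel3 (X (\<sigma> x) - of_real (1 - \<mu>)))
       (at x within {0..t s})"
        by (rule chain[OF YD x s])
    qed
  qed (rule \<sigma>(5))
qed

section \<open>Resonant Kepler orbits passing close to the second primary\<close>

text \<open>A weak form of Jordan's inequality: the cosine is at least 1/2 up to pi / 3, and beyond
  that angle the sine is at least sqrt 3 / 2, which exceeds pi / 4.\<close>

lemma half_le_sin:
  fixes u :: real
  assumes "0 \<le> u" "u \<le> pi / 2"
  shows "u / 2 \<le> sin u"
proof (cases "u \<le> pi / 3")
  case True
  have "sin 0 - 0 / 2 \<le> sin u - u / 2"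
  proof (rule DERIV_nonneg_imp_nondecreasing[OF assms(1)])
    fix x assume x: "0 \<le> x" "x \<le> u"
    have "cos (pi / 3) \<le> cos x" using x True by (intro cos_monotone_0_pi_le) auto
    then have "0 \<le> cos x - 1 / 2" by (simp add: cos_60)
    moreover have "((\<lambda>u. sin u - u / 2) has_real_derivative cos x - 1 / 2) (at x)"
      by (auto intro!: derivative_eq_intros)
    ultimately show "\<exists>y. ((\<lambda>u. sin u - u / 2) has_real_derivative y) (at x) \<and> 0 \<le> y" by blast
  qed
  then show ?thesis by simp
next
  case False
  have "sin (pi / 3) \<le> sin u"
    using False assms pi_gt_zero by (intro sin_monotone_2pi_le) linarith+
  moreover have "(1.6::real) \<le> sqrt 3" by (rule real_le_rsqrt) (simp add: power2_eq_square)
  moreover have "pi < 3.2" using pi_less_4 pi_approx by simp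
  ultimately show ?thesis using assms by (simp add: sin_60)
qed

lemma half_abs_le_abs_sin:
  fixes u :: real
  assumes "\<bar>u\<bar> \<le> pi / 2"
  shows "\<bar>u\<bar> / 2 \<le> \<bar>sin u\<bar>"
  using half_le_sin[of u] half_le_sin[of "- u"] assms by (cases "0 \<le> u") auto

text \<open>The difference is twice the product of sin ((F + F0) / 2) and |sin ((F0 - F) / 2)|. In
  half angles the first factor is p c + q d, at least p q (c + d), and c + d is at least 1, so it is
  bounded below by sin F0 / 2 independently of F. This quantifies the transversality of the
  crossings.\<close>

lemma abs_cos_diff_ge:
  fixes F F0 :: real
  assumes "0 \<le> F0" "F0 \<le> pi" "0 \<le> F" "F \<le> pi"
  shows "sin F0 / 4 * \<bar>F - F0\<bar> \<le> \<bar>cos F - cos F0\<bar>"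
proof -
  define p q c d where "p = sin (F0 / 2)" and "q = cos (F0 / 2)" and "c = cos (F / 2)" and "d = sin (F / 2)"
  have b: "0 \<le> p" "p \<le> 1" "0 \<le> q" "q \<le> 1" "0 \<le> c" "c \<le> 1" "0 \<le> d" "d \<le> 1"
    using assms unfolding p_def q_def c_def d_def
    by (auto intro!: sin_ge_zero cos_ge_zero)
  have cd: "c\<^sup>2 + d\<^sup>2 = 1" by (simp add: c_def d_def)
  have "1 \<le> c + d" using cd b mult_left_le[of c c] mult_left_le[of d d] by (simp add: power2_eq_square)
  then have "p * q * 1 \<le> p * q * (c + d)" using b by (intro mult_left_mono) auto
  also have "\<dots> = p * q * c + q * p * d" by (simp add: algebra_simps)
  also have "\<dots> \<le> p * 1 * c + q * 1 * d" using b by (intro add_mono mult_right_mono mult_left_mono) auto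
  also have "\<dots> = sin ((F + F0) / 2)"
    by (simp add: p_def q_def c_def d_def add_divide_distrib sin_add mult_ac)
  finally have 1: "sin F0 / 2 \<le> sin ((F + F0) / 2)"
    using sin_double[of "F0 / 2"] by (simp add: p_def q_def)
  have 2: "\<bar>F0 - F\<bar> / 4 \<le> \<bar>sin ((F0 - F) / 2)\<bar>"
  proof -
    have "\<bar>F0 - F\<bar> \<le> pi" using assms by linarith
    then show ?thesis using half_abs_le_abs_sin[of "(F0 - F) / 2"] by (simp add: abs_divide)
  qed
  have s0: "0 \<le> sin F0" using assms by (intro sin_ge_zero) auto
  have "sin F0 / 4 * \<bar>F - F0\<bar> = 2 * (sin F0 / 2 * (\<bar>F0 - F\<bar> / 4))" by (simp add: abs_minus_commute)
  also have "\<dots> \<le> 2 * (sin ((F + F0) / 2) * \<bar>sin ((F0 - F) / 2)\<bar>)"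
    using 1 2 s0 by (intro mult_left_mono mult_mono) auto
  also have "\<dots> = \<bar>cos F - cos F0\<bar>"
    using 1 s0 unfolding cos_diff_cos abs_mult by simp
  finally show ?thesis .
qed

text \<open>F is reduced modulo 2 pi to an angle between -pi and pi; the sign of that angle selects
  the branch \<sigma>.\<close>

lemma ex_near_cos_eq:
  fixes F F0 :: real
  assumes F0: "0 \<le> F0" "F0 \<le> pi"
  obtains n :: int and \<sigma> :: real
  where "\<sigma> = 1 \<or> \<sigma> = - 1" "sin F0 / 4 * \<bar>F - (\<sigma> * F0 + 2 * pi * of_int n)\<bar> \<le> \<bar>cos F - cos F0\<bar>"
proof -
  define n where "n = round (F / (2 * pi))"
  define G where "G = F - 2 * pi * of_int n"
  have "\<bar>of_int n - F / (2 * pi)\<bar> \<le> 1 / 2" unfolding n_def by (rule of_int_round_abs_le)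
  then have "\<bar>of_int n - F / (2 * pi)\<bar> * (2 * pi) \<le> 1 / 2 * (2 * pi)"
    by (intro mult_right_mono) auto
  moreover have "\<bar>of_int n - F / (2 * pi)\<bar> * (2 * pi) = \<bar>G\<bar>"
    unfolding G_def using pi_gt_zero by (simp add: abs_if field_simps)
  ultimately have G: "\<bar>G\<bar> \<le> pi" by simp
  have cG: "cos F = cos \<bar>G\<bar>"
  proof -
    have "cos G = Re (cis F * cis (- (2 * pi * of_int n)))" by (simp add: cis_mult G_def)
    also have "cis (- (2 * pi * of_int n)) = 1" using cis_multiple_2pi[of "of_int (- n)"] by simp
    finally show ?thesis by simp
  qed
  have *: "sin F0 / 4 * \<bar>\<bar>G\<bar> - F0\<bar> \<le> \<bar>cos F - cos F0\<bar>"
    unfolding cG using G F0 by (intro abs_cos_diff_ge) auto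
  show ?thesis
  proof (cases "0 \<le> G")
    case True
    then show ?thesis using * by (intro that[of 1 n]) (auto simp: G_def algebra_simps)
  next
    case False
    then have "\<bar>\<bar>G\<bar> - F0\<bar> = \<bar>F - (- 1 * F0 + 2 * pi * of_int n)\<bar>" by (simp add: G_def)
    then show ?thesis using * by (intro that[of "- 1" n]) auto
  qed
qed

text \<open>Telescoping. Read backwards, a lower bound on the distance of the n-th power from 1
  gives one for u itself, at the cost of a factor n.\<close>

lemma norm_power_minus_one_le:
  fixes u :: complex
  assumes "norm u = 1"
  shows "norm (u ^ n - 1) \<le> real n * norm (u - 1)"
proof (induction n)
  case (Suc n)
  have "u ^ Suc n - 1 = u * (u ^ n - 1) + (u - 1)" by (simp add: algebra_simps)
  also have "norm \<dots> \<le> norm (u ^ n - 1) + norm (u - 1)"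
    by (rule order_trans[OF norm_triangle_ineq]) (simp add: norm_mult assms)
  also have "\<dots> \<le> real (Suc n) * norm (u - 1)" using Suc by (simp add: algebra_simps)
  finally show ?case .
qed simp

lemma norm_cis_minus_one_le: "norm (cis a - 1) \<le> \<bar>a\<bar>"
  using norm_cis_diff_le[of a 0] by simp

text \<open>The cube roots of unity are at mutual distance at least 1, so each of the two points is
  brought within 1/2 of 1 by at most one of them. Three candidates against two points leave one
  over.\<close>

lemma ex_cube_root_avoiding:
  fixes x y :: complex
  assumes "norm x = 1" "norm y = 1"
  obtains l :: nat where "l < 3"
    "1 / 2 \<le> norm (cis (2 * pi / 3) ^ l * x - 1)" "1 / 2 \<le> norm (cis (2 * pi / 3) ^ l * y - 1)"
proof -
  define \<omega> where "\<omega> = cis (2 * pi / 3)"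
  have \<omega>: "\<omega> = Complex (- 1 / 2) (sqrt 3 / 2)"
    using cos_120 sin_120 by (simp add: \<omega>_def cis.ctr mult.commute)
  have \<omega>2: "\<omega> ^ 2 = Complex (- 1 / 2) (- sqrt 3 / 2)"
    by (simp add: \<omega> power2_eq_square complex_eq_iff)
  have n\<omega>: "norm \<omega> = 1" by (simp add: \<omega>_def)
  have d1: "1 \<le> norm (1 - \<omega>)" using abs_Re_le_cmod[of "1 - \<omega>"] by (simp add: \<omega>)
  have d2: "1 \<le> norm (1 - \<omega> ^ 2)" using abs_Re_le_cmod[of "1 - \<omega> ^ 2"] by (simp add: \<omega>2)
  have "\<omega> - \<omega> ^ 2 = \<omega> * (1 - \<omega>)" by (simp add: power2_eq_square algebra_simps)
  then have d3: "1 \<le> norm (\<omega> - \<omega> ^ 2)" using d1 by (simp add: norm_mult n\<omega>)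
  have far: "1 / 2 \<le> norm (a * x - 1) \<or> 1 / 2 \<le> norm (b * x - 1)"
    if "norm x = 1" "1 \<le> norm (a - b)" for a b x :: complex
  proof (rule ccontr)
    assume "\<not> ?thesis"
    then have "norm (a * x - 1) + norm (b * x - 1) < 1" by simp
    moreover have "norm ((a * x - 1) - (b * x - 1)) \<le> norm (a * x - 1) + norm (b * x - 1)"
      by (rule norm_triangle_ineq4)
    moreover have "(a * x - 1) - (b * x - 1) = (a - b) * x" by (simp add: algebra_simps)
    ultimately show False using that by (simp add: norm_mult)
  qed
  let ?P = "\<lambda>l x. 1 / 2 \<le> norm (\<omega> ^ l * x - 1)"
  have "?P 0 z \<or> ?P 1 z" "?P 0 z \<or> ?P 2 z" "?P 1 z \<or> ?P 2 z" if "norm z = 1" for z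
    using far[OF that, of 1 \<omega>] far[OF that, of 1 "\<omega> ^ 2"] far[OF that, of \<omega> "\<omega> ^ 2"] d1 d2 d3 by auto
  from this[OF assms(1)] this[OF assms(2)]
  have "(?P 0 x \<and> ?P 0 y) \<or> (?P 1 x \<and> ?P 1 y) \<or> (?P 2 x \<and> ?P 2 y)" by blast
  then show ?thesis using that[of 0] that[of 1] that[of 2] unfolding \<omega>_def by auto
qed

text \<open>The argument of v is rounded down to a multiple of 2 pi / N.\<close>

lemma ex_rotation_near_one:
  fixes v :: complex
  assumes "norm v = 1" "0 < N"
  obtains k :: nat where "k < N" "norm (v * cis (- (2 * pi * real k / real N)) - 1) \<le> 2 * pi / real N"
proof -
  define \<tau> where "\<tau> = Arg2pi v"
  have \<tau>: "0 \<le> \<tau>" "\<tau> < 2 * pi" "v = cis \<tau>"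
    using Arg2pi[of v] assms by (auto simp: \<tau>_def cis_conv_exp is_Arg_def)
  define k where "k = nat \<lfloor>real N * \<tau> / (2 * pi)\<rfloor>"
  have k: "real k \<le> real N * \<tau> / (2 * pi)" "real N * \<tau> / (2 * pi) < real k + 1"
    using \<tau> by (auto simp: k_def)
  have "real N * \<tau> / (2 * pi) < real N" using \<tau> assms by (simp add: field_simps)
  then have "k < N" using k by linarith
  moreover have "norm (v * cis (- (2 * pi * real k / real N)) - 1) \<le> 2 * pi / real N"
  proof -
    have "norm (v * cis (- (2 * pi * real k / real N)) - 1) \<le> \<bar>\<tau> + - (2 * pi * real k / real N)\<bar>"
      unfolding \<tau>(3) cis_mult by (rule norm_cis_minus_one_le)
    also have "\<dots> \<le> 2 * pi / real N"
    proof -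
      have "2 * pi * real k / real N \<le> \<tau>" using k(1) assms by (simp add: field_simps)
      moreover have "\<tau> \<le> 2 * pi * real k / real N + 2 * pi / real N"
        using k(2) assms by (simp add: field_simps)
      ultimately show ?thesis by linarith
    qed
    finally show ?thesis .
  qed
  ultimately show ?thesis by (rule that)
qed

definition kep_X :: "real \<Rightarrow> complex \<Rightarrow> complex \<Rightarrow> real \<Rightarrow> complex" where
  "kep_X \<Omega> \<alpha> \<beta> s = cis (- kep_t \<Omega> \<alpha> \<beta> s) * (kep_z \<Omega> \<alpha> \<beta> s)\<^sup>2"

lemma norm_kep_X: "norm (kep_X \<Omega> \<alpha> \<beta> s) = (norm (kep_z \<Omega> \<alpha> \<beta> s))\<^sup>2"
  by (simp add: kep_X_def norm_mult norm_power)

text \<open>Positions are squares, so they turn by the square of c. Time depends only on the moduli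
  of \<alpha> and \<beta> and on \<alpha> times the conjugate of \<beta>, none of which
  changes.\<close>

lemma kep_X_rotate:
  assumes "norm c = 1"
  shows "kep_X \<Omega> (c * \<alpha>) (c * \<beta>) s = c\<^sup>2 * kep_X \<Omega> \<alpha> \<beta> s"
proof -
  have z: "kep_z \<Omega> (c * \<alpha>) (c * \<beta>) s = c * kep_z \<Omega> \<alpha> \<beta> s"
    by (simp add: kep_z_def algebra_simps)
  have "c * \<alpha> * cnj (c * \<beta>) = (c * cnj c) * (\<alpha> * cnj \<beta>)" by simp
  also have "c * cnj c = 1" using assms complex_norm_square[of c] by simp
  finally have "c * \<alpha> * cnj (c * \<beta>) = \<alpha> * cnj \<beta>" by simp
  then have t: "kep_t \<Omega> (c * \<alpha>) (c * \<beta>) s = kep_t \<Omega> \<alpha> \<beta> s"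
    unfolding kep_t_def by (simp only: norm_mult assms mult_1)
  show ?thesis unfolding kep_X_def z t by (simp add: power_mult_distrib mult_ac)
qed

lemma cis_int_pi: "cis (real_of_int n * pi) ^ 2 = 1"
proof -
  have "cis (real_of_int n * pi) ^ 2 = cis (real_of_int n * pi + real_of_int n * pi)"
    by (simp only: power2_eq_square cis_mult)
  also have "real_of_int n * pi + real_of_int n * pi = 2 * pi * of_int n" by simp
  also have "cis \<dots> = 1" by (rule cis_multiple_2pi) simp
  finally show ?thesis .
qed

text \<open>A shift of s by pi / \<Omega> is one revolution: z and w at most change their sign,
  which disappears in position and momentum. The quotient in the last formula is the period divided
  by 2 pi.\<close>

lemma kep_period:
  fixes n :: int
  assumes "\<Omega> \<noteq> 0"
  shows "kep_z \<Omega> \<alpha> \<beta> (s + of_int n * pi / \<Omega>) = cis (of_int n * pi) * kep_z \<Omega> \<alpha> \<beta> s"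
    and "kep_w \<Omega> \<alpha> \<beta> (s + of_int n * pi / \<Omega>) = cis (of_int n * pi) * kep_w \<Omega> \<alpha> \<beta> s"
    and "kep_t \<Omega> \<alpha> \<beta> (s + of_int n * pi / \<Omega>)
      = kep_t \<Omega> \<alpha> \<beta> s + 2 * pi * (((norm \<alpha>)\<^sup>2 + (norm \<beta>)\<^sup>2) / (2 * \<Omega>) * of_int n)"
proof -
  have a: "\<Omega> * (s + of_int n * pi / \<Omega>) = \<Omega> * s + of_int n * pi"
    using assms by (simp add: distrib_left)
  have "cis (- (of_int n * pi)) = cis (of_int n * pi) * cis (2 * pi * of_int (- n))"
    by (simp add: cis_mult algebra_simps)
  also have "cis (2 * pi * of_int (- n)) = 1" by (rule cis_multiple_2pi) simp
  finally have b: "cis (- (of_int n * pi)) = cis (of_int n * pi)" by simp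
  have c: "cis (\<Omega> * (s + of_int n * pi / \<Omega>)) = cis (of_int n * pi) * cis (\<Omega> * s)"
    "cis (- (\<Omega> * (s + of_int n * pi / \<Omega>))) = cis (of_int n * pi) * cis (- (\<Omega> * s))"
  proof -
    show "cis (\<Omega> * (s + of_int n * pi / \<Omega>)) = cis (of_int n * pi) * cis (\<Omega> * s)"
      unfolding a by (simp add: cis_mult add.commute)
    have "cis (- (\<Omega> * s + of_int n * pi)) = cis (- (of_int n * pi)) * cis (- (\<Omega> * s))"
      unfolding cis_mult by (rule arg_cong[of _ _ cis]) simp
    then show "cis (- (\<Omega> * (s + of_int n * pi / \<Omega>))) = cis (of_int n * pi) * cis (- (\<Omega> * s))"
      unfolding a b .
  qed
  show "kep_z \<Omega> \<alpha> \<beta> (s + of_int n * pi / \<Omega>) = cis (of_int n * pi) * kep_z \<Omega> \<alpha> \<beta> s"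
    unfolding kep_z_def c by (simp add: algebra_simps)
  show "kep_w \<Omega> \<alpha> \<beta> (s + of_int n * pi / \<Omega>) = cis (of_int n * pi) * kep_w \<Omega> \<alpha> \<beta> s"
    unfolding kep_w_def c by (simp add: algebra_simps)
  have "cis (2 * \<Omega> * (s + of_int n * pi / \<Omega>)) = cis (2 * \<Omega> * s) * cis (2 * pi * of_int n)"
    unfolding cis_mult by (rule arg_cong[of _ _ cis]) (use assms in \<open>simp add: field_simps\<close>)
  also have "cis (2 * pi * of_int n) = 1" by (rule cis_multiple_2pi) simp
  finally have e: "cis (2 * \<Omega> * (s + of_int n * pi / \<Omega>)) = cis (2 * \<Omega> * s)" by simp
  have "((norm \<alpha>)\<^sup>2 + (norm \<beta>)\<^sup>2) * (s + of_int n * pi / \<Omega>) = ((norm \<alpha>)\<^sup>2 + (norm \<beta>)\<^sup>2) * s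
      + 2 * pi * (((norm \<alpha>)\<^sup>2 + (norm \<beta>)\<^sup>2) / (2 * \<Omega>) * of_int n)"
    using assms by (simp add: field_simps)
  then show "kep_t \<Omega> \<alpha> \<beta> (s + of_int n * pi / \<Omega>)
      = kep_t \<Omega> \<alpha> \<beta> s + 2 * pi * (((norm \<alpha>)\<^sup>2 + (norm \<beta>)\<^sup>2) / (2 * \<Omega>) * of_int n)"
    unfolding kep_t_def e by simp
qed

lemma kep_X_period:
  fixes n :: int
  assumes "\<Omega> \<noteq> 0"
  shows "kep_X \<Omega> \<alpha> \<beta> (s + of_int n * pi / \<Omega>)
    = kep_X \<Omega> \<alpha> \<beta> s * cis (- (2 * pi * (((norm \<alpha>)\<^sup>2 + (norm \<beta>)\<^sup>2) / (2 * \<Omega>) * of_int n)))"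
proof -
  have "cis (- (x + y)) = cis (- x) * cis (- y)" for x y by (simp add: cis_mult)
  then show ?thesis
    unfolding kep_X_def kep_period[OF assms] power_mult_distrib cis_int_pi by (simp only: mult_ac mult_1)
qed

lemma kep_z_has_vector_derivative:
  "(kep_z \<Omega> \<alpha> \<beta> has_vector_derivative kep_w \<Omega> \<alpha> \<beta> s) (at s within A)"
proof -
  have "((\<lambda>s. \<alpha> * cis (\<Omega> * s) + \<beta> * cis (- (\<Omega> * s))) has_vector_derivative
      \<alpha> * (of_real \<Omega> * (\<i> * cis (\<Omega> * s))) + \<beta> * (of_real (- \<Omega>) * (\<i> * cis (- (\<Omega> * s))))) (at s within A)"
    by (intro has_vector_derivative_add has_vector_derivative_mult_right has_vector_derivative_cis)
      (auto intro!: derivative_eq_intros)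
  then show ?thesis by (simp add: kep_z_def[abs_def] kep_w_def algebra_simps)
qed

text \<open>The motion along the ellipse contributes 2 M^2 and the rotation of the frame
  M^4.\<close>

lemma kep_X_lipschitz:
  assumes \<Omega>: "0 < \<Omega>" "\<Omega> \<le> 1" and M: "norm \<alpha> + norm \<beta> \<le> M" "1 \<le> M"
  shows "norm (kep_X \<Omega> \<alpha> \<beta> x - kep_X \<Omega> \<alpha> \<beta> y) \<le> 3 * M ^ 4 * \<bar>x - y\<bar>"
proof (rule norm_diff_le_of_vector_derivative)
  let ?z = "kep_z \<Omega> \<alpha> \<beta>" and ?w = "kep_w \<Omega> \<alpha> \<beta>" and ?t = "kep_t \<Omega> \<alpha> \<beta>"
  let ?I = "{min x y..max x y}"
  fix s assume "s \<in> ?I"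
  show "(kep_X \<Omega> \<alpha> \<beta> has_vector_derivative cis (- ?t s) * (?z s * ?w s + ?w s * ?z s)
      + of_real (- (norm (?z s))\<^sup>2) * (\<i> * cis (- ?t s)) * (?z s * ?z s)) (at s within ?I)"
    unfolding kep_X_def[abs_def] power2_eq_square[of "?z _"]
    using \<Omega> by (intro has_vector_derivative_mult has_vector_derivative_cis has_vector_derivative_minus
      kep_z_has_vector_derivative kep_t_has_vector_derivative) auto
  have z: "norm (?z s) \<le> M" using norm_kep_z_le M order_trans by blast
  have w: "norm (?w s) \<le> M"
    using norm_kep_w_le[of \<Omega> \<alpha> \<beta> s] mult_mono[of "\<bar>\<Omega>\<bar>" 1 "norm \<alpha> + norm \<beta>" M] \<Omega> M by simp
  have "norm (cis (- ?t s) * (?z s * ?w s + ?w s * ?z s)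
      + of_real (- (norm (?z s))\<^sup>2) * (\<i> * cis (- ?t s)) * (?z s * ?z s))
      \<le> (norm (?z s) * norm (?w s) + norm (?w s) * norm (?z s)) + (norm (?z s))\<^sup>2 * (norm (?z s) * norm (?z s))"
    by (intro norm_triangle_mono) (auto simp: norm_mult norm_power intro!: order_trans[OF norm_triangle_ineq])
  also have "\<dots> \<le> (M * M + M * M) + M\<^sup>2 * (M * M)"
    using z w M by (intro add_mono mult_mono power_mono) auto
  also have "\<dots> = 2 * M ^ 2 + M ^ 4" by (simp add: eval_nat_numeral)
  also have "\<dots> \<le> 3 * M ^ 4" using power_increasing[of 2 4 M] M by simp
  finally show "norm (cis (- ?t s) * (?z s * ?w s + ?w s * ?z s)
      + of_real (- (norm (?z s))\<^sup>2) * (\<i> * cis (- ?t s)) * (?z s * ?z s)) \<le> 3 * M ^ 4" .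
qed auto

text \<open>The orbit crosses the unit circle at two families of points, each an orbit of a rotation by a
  multiple of \<open>2 \<pi> / N\<^sup>2\<close>; taking \<open>N\<^sup>2\<close>-th powers maps each family to a single point. Hence a
  rotation of the orbit by an angle of order \<open>1 / N\<^sup>2\<close> keeps all crossings away from \<open>1\<close>, while
  the crossings with \<open>n \<equiv> 1 (mod N)\<close> are rotations of each other by the multiples of \<open>2 \<pi> / N\<close>, so
  that one of them is \<open>2 \<pi> / N\<close>-close to \<open>1\<close>.\<close>

lemma kepler_near_miss:
  fixes \<alpha> \<beta> :: complex and N :: nat and j :: int
  defines "a \<equiv> (norm \<alpha>)\<^sup>2 + (norm \<beta>)\<^sup>2"
  assumes \<Omega>: "0 < \<Omega>" "\<Omega> \<le> 1" "1 \<le> 2 * M * \<Omega>" and M: "norm \<alpha> + norm \<beta> \<le> M" "1 \<le> M"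
    and \<kappa>: "0 < \<kappa>" "\<kappa> \<le> 1"
    and peri: "(norm \<alpha> - norm \<beta>)\<^sup>2 \<le> 1 - \<kappa>" and apo: "1 + \<kappa> \<le> (norm \<alpha> + norm \<beta>)\<^sup>2"
    and N: "2 \<le> N" and res: "a / (2 * \<Omega>) = of_int j / real N + 1 / (real N)\<^sup>2"
  obtains c s1 where "norm c = 1" "norm (c - 1) \<le> 4 / real N"
    "\<And>s. \<kappa> / (50 * M ^ 5 * (real N)\<^sup>2) \<le> norm (kep_X \<Omega> (c * \<alpha>) (c * \<beta>) s - 1)"
    "0 < s1" "s1 < pi * (real N)\<^sup>2 / \<Omega>" "norm (kep_X \<Omega> (c * \<alpha>) (c * \<beta>) s1 - 1) \<le> 7 / real N"
proof -

  \<comment> \<open>The crossings of the ellipse with the unit circle\<close>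
  define b where "b = 2 * norm \<alpha> * norm \<beta>"
  define \<psi> where "\<psi> = Arg (\<alpha> * cnj \<beta>)"
  \<comment> \<open>The distance from the origin is a + b cos F in the phase F, so \<open>k\<close>
    is the cosine at a crossing.\<close>
  define k where "k = (1 - a) / b"
  define F0 where "F0 = arccos k"
  define q where "q = N\<^sup>2"
  have q0: "0 < q" using N by (simp add: q_def)
  have ab: "a + b = (norm \<alpha> + norm \<beta>)\<^sup>2" "a - b = (norm \<alpha> - norm \<beta>)\<^sup>2"
    by (simp_all add: a_def b_def power2_eq_square algebra_simps)
  have ab': "1 + \<kappa> \<le> a + b" "a - b \<le> 1 - \<kappa>" using peri apo ab by simp_all
  then have b0: "0 < b" using \<kappa> by simp
  have bk: "b * k = 1 - a" using b0 by (simp add: k_def)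
  have k1: "\<bar>k\<bar> \<le> 1" using ab' b0 \<kappa> by (simp add: k_def abs_le_iff field_simps)
  have F0: "0 \<le> F0" "F0 \<le> pi" "cos F0 = k"
    using k1 by (auto simp: F0_def arccos_lbound arccos_ubound)
  have sF0: "0 \<le> sin F0" using F0 by (intro sin_ge_zero)
  \<comment> \<open>Transversality: the square of \<open>b * sin F0\<close> is the product of the
    gaps \<open>a + b - 1\<close> and \<open>1 - (a - b)\<close>, both at least
    \<open>\<kappa>\<close>.\<close>
  have bs: "\<kappa> \<le> b * sin F0"
  proof (rule power2_le_imp_le)
    have "\<kappa>\<^sup>2 \<le> (a + b - 1) * (1 - (a - b))"
      unfolding power2_eq_square using ab' \<kappa> by (intro mult_mono) auto
    also have "\<dots> = b\<^sup>2 - (b * k)\<^sup>2"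
      unfolding bk by (simp add: power2_eq_square algebra_simps)
    also have "\<dots> = b\<^sup>2 * (1 - (cos F0)\<^sup>2)" by (simp add: F0 power_mult_distrib algebra_simps)
    also have "\<dots> = (b * sin F0)\<^sup>2"
      by (simp add: power_mult_distrib sin_squared_eq)
    finally show "\<kappa>\<^sup>2 \<le> (b * sin F0)\<^sup>2" .
  qed (use b0 sF0 in simp)
  have r: "(norm (kep_z \<Omega> \<alpha> \<beta> s))\<^sup>2 = a + b * cos (2 * \<Omega> * s + \<psi>)" for s
  proof -
    have "\<alpha> * cnj \<beta> = of_real (b / 2) * cis \<psi>"
      unfolding \<psi>_def using rcis_cmod_Arg[of "\<alpha> * cnj \<beta>"] by (simp add: rcis_def b_def norm_mult)
    then have "\<alpha> * cnj \<beta> * cis (2 * \<Omega> * s) = of_real (b / 2) * cis (2 * \<Omega> * s + \<psi>)"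
      by (simp only: mult.assoc cis_mult add.commute)
    then have "Re (\<alpha> * cnj \<beta> * cis (2 * \<Omega> * s)) = b / 2 * cos (2 * \<Omega> * s + \<psi>)"
      by (simp only: Re_complex_of_real Im_complex_of_real complex.sel cis.sel times_complex.sel)
    then show ?thesis unfolding norm_kep_z_sq a_def by simp
  qed
  \<comment> \<open>Crossing times: \<open>\<sigma>\<close> distinguishes the two crossings in each
    revolution and \<open>n\<close> counts the revolutions.\<close>
  define sc where "sc \<sigma> n = (\<sigma> * F0 - \<psi>) / (2 * \<Omega>) + of_int n * pi / \<Omega>" for \<sigma> and n :: int
  have F_sc: "2 * \<Omega> * s + \<psi> - (\<sigma> * F0 + 2 * pi * of_int n) = 2 * \<Omega> * (s - sc \<sigma> n)" for s \<sigma> n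
    using \<Omega> by (simp add: sc_def field_simps)
  have near: "\<exists>\<sigma> n. (\<sigma> = 1 \<or> \<sigma> = - 1) \<and>
      \<kappa> / (4 * M) * \<bar>s - sc \<sigma> n\<bar> \<le> \<bar>(norm (kep_z \<Omega> \<alpha> \<beta> s))\<^sup>2 - 1\<bar>" for s
  proof -
    obtain n :: int and \<sigma> :: real where \<sigma>: "\<sigma> = 1 \<or> \<sigma> = - 1" and
      le: "sin F0 / 4 * \<bar>2 * \<Omega> * s + \<psi> - (\<sigma> * F0 + 2 * pi * of_int n)\<bar> \<le> \<bar>cos (2 * \<Omega> * s + \<psi>) - cos F0\<bar>"
      by (rule ex_near_cos_eq[OF F0(1,2)])
    have "\<kappa> / (4 * M) * \<bar>s - sc \<sigma> n\<bar> \<le> (b * sin F0) * (2 * \<Omega> / 4) * \<bar>s - sc \<sigma> n\<bar>"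
    proof (rule mult_right_mono)
      have "\<kappa> * (1 / (4 * M)) \<le> (b * sin F0) * (2 * \<Omega> / 4)"
        using bs \<kappa> \<Omega> M by (intro mult_mono) (auto simp: field_simps)
      then show "\<kappa> / (4 * M) \<le> (b * sin F0) * (2 * \<Omega> / 4)" by simp
    qed simp
    also have "\<dots> = b * (sin F0 / 4 * \<bar>2 * \<Omega> * (s - sc \<sigma> n)\<bar>)"
      using \<Omega> by (simp add: abs_mult)
    also have "\<dots> \<le> b * \<bar>cos (2 * \<Omega> * s + \<psi>) - cos F0\<bar>"
      using le b0 unfolding F_sc by (intro mult_left_mono) auto
    also have "\<dots> = \<bar>(norm (kep_z \<Omega> \<alpha> \<beta> s))\<^sup>2 - 1\<bar>"
    proof -
      have "b * \<bar>cos (2 * \<Omega> * s + \<psi>) - cos F0\<bar> = \<bar>b * cos (2 * \<Omega> * s + \<psi>) - b * k\<bar>"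
        using b0 by (simp add: F0(3) abs_mult flip: right_diff_distrib)
      then show ?thesis unfolding r bk by (simp add: algebra_simps)
    qed
    finally show ?thesis using \<sigma> by blast
  qed

  \<comment> \<open>Rotating the crossings away from the second primary\<close>
  define u where "u \<sigma> = kep_X \<Omega> \<alpha> \<beta> (sc \<sigma> 0)" for \<sigma>
  have nu: "norm (u \<sigma>) = 1" if "\<sigma> = 1 \<or> \<sigma> = - 1" for \<sigma>
  proof -
    have "2 * \<Omega> * sc \<sigma> 0 + \<psi> = \<sigma> * F0" using \<Omega> by (simp add: sc_def)
    then have "cos (2 * \<Omega> * sc \<sigma> 0 + \<psi>) = k" using that F0 by auto
    then show ?thesis using b0 by (simp add: u_def norm_kep_X r k_def)
  qed
  define \<nu> where "\<nu> = a / (2 * \<Omega>)"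
  have X_sc: "kep_X \<Omega> \<alpha> \<beta> (sc \<sigma> n) = u \<sigma> * cis (- (2 * pi * (\<nu> * of_int n)))" for \<sigma> n
    using kep_X_period[of \<Omega> \<alpha> \<beta> "sc \<sigma> 0" n] \<Omega> by (simp add: u_def sc_def \<nu>_def a_def)
  have X_pow: "(kep_X \<Omega> \<alpha> \<beta> (sc \<sigma> n)) ^ q = u \<sigma> ^ q" for \<sigma> n
  proof -
    \<comment> \<open>The denominator of the resonance is cleared, so the \<open>q\<close>-th power
      no longer depends on \<open>n\<close>.\<close>
    have \<nu>q: "\<nu> * real q = of_int (j * int N + 1)"
      using N unfolding \<nu>_def res q_def by (simp add: field_simps power2_eq_square)
    have "real q * - (2 * pi * (\<nu> * of_int n)) = - (2 * pi * ((\<nu> * real q) * of_int n))" by simp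
    also have "\<dots> = 2 * pi * of_int (- ((j * int N + 1) * n))" unfolding \<nu>q by simp
    finally have "real q * - (2 * pi * (\<nu> * of_int n)) = 2 * pi * of_int (- ((j * int N + 1) * n))" .
    then have "cis (- (2 * pi * (\<nu> * of_int n))) ^ q = cis (2 * pi * of_int (- ((j * int N + 1) * n)))"
      unfolding Complex.DeMoivre by (rule arg_cong)
    also have "\<dots> = 1" by (rule cis_multiple_2pi) simp
    finally show ?thesis unfolding X_sc power_mult_distrib by simp
  qed
  obtain l :: nat where l: "l < 3"
    "1 / 2 \<le> norm (cis (2 * pi / 3) ^ l * u 1 ^ q - 1)" "1 / 2 \<le> norm (cis (2 * pi / 3) ^ l * u (- 1) ^ q - 1)"
    using ex_cube_root_avoiding[of "u 1 ^ q" "u (- 1) ^ q"] nu by (auto simp: norm_power)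
  \<comment> \<open>Positions turn by the square of \<open>c\<close>, whose \<open>q\<close>-th
    power is the chosen cube root of unity.\<close>
  define c where "c = cis (pi * real l / (3 * real q))"
  have nc: "norm c = 1" by (simp add: c_def)
  have c2q: "(c\<^sup>2) ^ q = cis (2 * pi / 3) ^ l"
  proof -
    have "(c\<^sup>2) ^ q = cis (real q * (real 2 * (pi * real l / (3 * real q))))"
      by (simp only: c_def Complex.DeMoivre)
    also have "real q * (real 2 * (pi * real l / (3 * real q))) = real l * (2 * pi / 3)"
      using q0 by (simp add: field_simps)
    finally show ?thesis unfolding Complex.DeMoivre .
  qed
  have qN: "real N \<le> real q" using N unfolding q_def by (simp add: power2_eq_square)
  have c1: "norm (c - 1) \<le> 4 / real N"
  proof -
    have "norm (c - 1) \<le> \<bar>pi * real l / (3 * real q)\<bar>" unfolding c_def by (rule norm_cis_minus_one_le)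
    also have "\<dots> = pi * real l / (3 * real q)" by simp
    also have "\<dots> \<le> 4 * 3 / (3 * real q)"
    proof (rule divide_right_mono)
      show "pi * real l \<le> 4 * 3" using l(1) pi_less_4 by (intro mult_mono) auto
    qed simp
    also have "\<dots> \<le> 4 / real N" using qN N by (simp add: frac_le)
    finally show ?thesis .
  qed
  have avoid_sc: "1 / (2 * real q) \<le> norm (c\<^sup>2 * kep_X \<Omega> \<alpha> \<beta> (sc \<sigma> n) - 1)" if "\<sigma> = 1 \<or> \<sigma> = - 1" for \<sigma> n
  proof -
    have "1 / 2 \<le> norm ((c\<^sup>2 * kep_X \<Omega> \<alpha> \<beta> (sc \<sigma> n)) ^ q - 1)"
      unfolding power_mult_distrib c2q X_pow using l that by auto
    also have "\<dots> \<le> real q * norm (c\<^sup>2 * kep_X \<Omega> \<alpha> \<beta> (sc \<sigma> n) - 1)"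
      by (rule norm_power_minus_one_le) (simp add: norm_mult norm_power nc X_sc nu[OF that])
    finally show ?thesis using q0 by (simp add: field_simps)
  qed
  have avoid: "\<kappa> / (50 * M ^ 5 * real q) \<le> norm (c\<^sup>2 * kep_X \<Omega> \<alpha> \<beta> s - 1)" for s
  proof -
    obtain \<sigma> n where \<sigma>: "\<sigma> = 1 \<or> \<sigma> = - 1" and
      le: "\<kappa> / (4 * M) * \<bar>s - sc \<sigma> n\<bar> \<le> \<bar>(norm (kep_z \<Omega> \<alpha> \<beta> s))\<^sup>2 - 1\<bar>"
      using near by blast
    define D where "D = \<bar>s - sc \<sigma> n\<bar>"
    have M4: "0 < M ^ 4" "1 \<le> M ^ 5" using M by (auto simp: one_le_power)
    \<comment> \<open>Within the threshold, the Lipschitz constant \<open>3 * M ^ 4\<close> costs 1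
      / (4 q) of the 1 / (2 q) available at the crossing. Beyond it, the distance from the origin
      already differs from 1 by \<kappa> / (48 M^5 q).\<close>
    show ?thesis
    proof (cases "D \<le> 1 / (12 * M ^ 4 * real q)")
      case True
      have "c\<^sup>2 * kep_X \<Omega> \<alpha> \<beta> (sc \<sigma> n) - 1 = (c\<^sup>2 * kep_X \<Omega> \<alpha> \<beta> s - 1)
          + c\<^sup>2 * (kep_X \<Omega> \<alpha> \<beta> (sc \<sigma> n) - kep_X \<Omega> \<alpha> \<beta> s)" by (simp add: algebra_simps)
      then have "norm (c\<^sup>2 * kep_X \<Omega> \<alpha> \<beta> (sc \<sigma> n) - 1) \<le> norm (c\<^sup>2 * kep_X \<Omega> \<alpha> \<beta> s - 1)
          + norm (c\<^sup>2 * (kep_X \<Omega> \<alpha> \<beta> (sc \<sigma> n) - kep_X \<Omega> \<alpha> \<beta> s))"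
        by (metis norm_triangle_ineq)
      also have "norm (c\<^sup>2 * (kep_X \<Omega> \<alpha> \<beta> (sc \<sigma> n) - kep_X \<Omega> \<alpha> \<beta> s)) \<le> 3 * M ^ 4 * D"
        using kep_X_lipschitz[OF \<Omega>(1,2) M, of "sc \<sigma> n" s]
        by (simp add: norm_mult norm_power nc D_def abs_minus_commute)
      also have "3 * M ^ 4 * D \<le> 3 * M ^ 4 * (1 / (12 * M ^ 4 * real q))"
        using True M4 by (intro mult_left_mono) auto
      also have "\<dots> = 1 / (4 * real q)" using M4 by simp
      finally have "1 / (4 * real q) \<le> norm (c\<^sup>2 * kep_X \<Omega> \<alpha> \<beta> s - 1)"
        using avoid_sc[OF \<sigma>, of n] by simp
      moreover have "\<kappa> / (50 * M ^ 5 * real q) \<le> 1 / (4 * real q)"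
      proof -
        have "\<kappa> \<le> 1 / 4 * (50 * M ^ 5)" using \<kappa> M4 by linarith
        then have "\<kappa> / (50 * M ^ 5) \<le> 1 / 4" using M by (subst pos_divide_le_eq) auto
        then have "\<kappa> / (50 * M ^ 5) / real q \<le> 1 / 4 / real q" by (rule divide_right_mono) simp
        then show ?thesis by simp
      qed
      ultimately show ?thesis by linarith
    next
      case False
      have "\<kappa> / (50 * M ^ 5 * real q) \<le> \<kappa> / (4 * M) * (1 / (12 * M ^ 4 * real q))"
        using \<kappa> M q0 by (simp add: field_simps eval_nat_numeral)
      also have "\<dots> \<le> \<kappa> / (4 * M) * D" using False \<kappa> M by (intro mult_left_mono) auto
      also have "\<dots> \<le> \<bar>norm (c\<^sup>2 * kep_X \<Omega> \<alpha> \<beta> s) - norm (1::complex)\<bar>"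
        using le by (simp add: D_def norm_mult norm_power nc norm_kep_X)
      also have "\<dots> \<le> norm (c\<^sup>2 * kep_X \<Omega> \<alpha> \<beta> s - 1)" by (rule norm_triangle_ineq3)
      finally show ?thesis .
    qed
  qed

  \<comment> \<open>A crossing close to the second primary\<close>
  obtain k' :: nat where k': "k' < N"
    "norm (c\<^sup>2 * u 1 * cis (- (2 * pi * \<nu>)) * cis (- (2 * pi * real k' / real N)) - 1) \<le> 2 * pi / real N"
    by (rule ex_rotation_near_one[of "c\<^sup>2 * u 1 * cis (- (2 * pi * \<nu>))" N])
      (use N in \<open>auto simp: norm_mult norm_power nc nu\<close>)
  \<comment> \<open>The multiples of \<open>N\<close> supply the rotations by 2 pi k' / N. The
    additional revolution makes \<open>s1\<close> positive although \<open>F0 - \<psi>\<close> may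
    be negative, and k' < N with N at least 2 keeps \<open>s1\<close> below the return time.\<close>
  define n1 where "n1 = int (N * k' + 1)"
  define s1 where "s1 = sc 1 n1"
  have rot: "cis (- (2 * pi * (\<nu> * of_int n1))) = cis (- (2 * pi * \<nu>)) * cis (- (2 * pi * real k' / real N))"
  proof -
    have "\<nu> * (real N * real k') = of_int (j * int k') + real k' / real N"
      using N unfolding \<nu>_def res by (simp add: field_simps power2_eq_square)
    then have "- (2 * pi * (\<nu> * of_int n1))
        = (- (2 * pi * \<nu>) + - (2 * pi * real k' / real N)) + 2 * pi * of_int (- (j * int k'))"
      by (simp add: n1_def algebra_simps)
    then have "cis (- (2 * pi * (\<nu> * of_int n1)))
        = cis (- (2 * pi * \<nu>)) * cis (- (2 * pi * real k' / real N)) * cis (2 * pi * of_int (- (j * int k')))"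
      by (simp only: cis_mult)
    also have "cis (2 * pi * of_int (- (j * int k'))) = 1" by (rule cis_multiple_2pi) simp
    finally show ?thesis by simp
  qed
  have "norm (c\<^sup>2 * kep_X \<Omega> \<alpha> \<beta> s1 - 1) \<le> 7 / real N"
  proof -
    have "norm (c\<^sup>2 * kep_X \<Omega> \<alpha> \<beta> s1 - 1) \<le> 2 * pi / real N"
      using k'(2) unfolding s1_def X_sc rot by (simp add: mult_ac)
    also have "\<dots> \<le> 7 / real N" using pi_approx by (intro divide_right_mono) auto
    finally show ?thesis .
  qed
  moreover have "0 < s1" "s1 < pi * (real N)\<^sup>2 / \<Omega>"
  proof -
    have \<psi>: "- pi < \<psi>" "\<psi> \<le> pi" using Arg_bounded[of "\<alpha> * cnj \<beta>"] by (auto simp: \<psi>_def)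
    have s1: "s1 = (F0 - \<psi> + 2 * pi * (real N * real k' + 1)) / (2 * \<Omega>)"
      using \<Omega> by (simp add: s1_def sc_def n1_def field_simps)
    have "0 \<le> 2 * pi * (real N * real k')" by simp
    then have "0 < F0 - \<psi> + 2 * pi * (real N * real k' + 1)"
      using \<psi> F0(1) pi_gt_zero unfolding distrib_left by linarith
    then show "0 < s1" using \<Omega> by (simp add: s1)
    have "real k' + 1 \<le> real N" using k'(1) by linarith
    then have "real N * (real k' + 1) \<le> real N * real N" by (intro mult_left_mono) auto
    then have "real N * real k' + 2 \<le> (real N)\<^sup>2"
      using N by (simp add: power2_eq_square distrib_left)
    then have "pi * (real N * real k' + 2) \<le> pi * (real N)\<^sup>2" by (intro mult_left_mono) auto
    then have "F0 - \<psi> + 2 * pi * (real N * real k' + 1) < 2 * (pi * (real N)\<^sup>2)"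
      using \<psi> F0(2) by (simp add: distrib_left)
    then have "s1 < 2 * (pi * (real N)\<^sup>2) / (2 * \<Omega>)"
      unfolding s1 using \<Omega> by (intro divide_strict_right_mono) auto
    then show "s1 < pi * (real N)\<^sup>2 / \<Omega>" by simp
  qed
  ultimately show ?thesis
    using that[OF nc c1, of s1] avoid unfolding kep_X_rotate[OF nc] q_def by simp
qed

section \<open>Orbits of the three body problem\<close>

text \<open>The phase point at s = 0, where z = \<alpha> + \<beta> and w = \<i> \<Omega> (\<alpha> -
  \<beta>): position z^2 and momentum 2 w / \<open>cnj z\<close>. At time 0 the rotating and the
  inertial axes coincide.\<close>

definition kep_phase :: "real \<Rightarrow> complex \<Rightarrow> complex \<Rightarrow> phase" where
  "kep_phase \<Omega> \<alpha> \<beta> = (vec2 ((\<alpha> + \<beta>)\<^sup>2), vec2 (2 * (\<i> * of_real \<Omega> * (\<alpha> - \<beta>)) / cnj (\<alpha> + \<beta>)))"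

text \<open>For comparing momenta, which are such quotients; c is the rotation left over from the
  error in the return time.\<close>

lemma norm_diff_quotient_le:
  fixes u v z z' c :: complex
  assumes "0 < m" "m \<le> norm z" "m \<le> norm z'" and M: "norm v \<le> M"
    and "norm (u - v) \<le> \<epsilon>" "norm (z - z') \<le> \<epsilon>" "norm (c - 1) \<le> \<epsilon>" "norm c = 1"
  shows "norm (c * (u / z) - v / z') \<le> \<epsilon> * (1 + M) / m + M * \<epsilon> / m\<^sup>2"
proof -
  have nz: "z \<noteq> 0" "z' \<noteq> 0" using assms by auto
  have e0: "0 \<le> \<epsilon>" using assms(5) norm_ge_zero order_trans by blast
  have M0: "0 \<le> M" using M norm_ge_zero order_trans by blast
  have "c * (u / z) - v / z' = (c * (u - v) + (c - 1) * v) / z + v * ((z' - z) / (z * z'))"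
    using nz by (simp add: field_simps)
  also have "norm \<dots> \<le> (\<epsilon> * (1 + M)) / m + M * (\<epsilon> / (m * m))"
  proof (intro norm_triangle_mono)
    have "norm (c * (u - v) + (c - 1) * v) \<le> \<epsilon> + \<epsilon> * M"
      using assms e0 M0 by (intro norm_triangle_mono) (auto simp: norm_mult intro!: mult_mono)
    then show "norm ((c * (u - v) + (c - 1) * v) / z) \<le> (\<epsilon> * (1 + M)) / m"
      unfolding norm_divide using assms e0 M0 by (intro frac_le) (auto simp: algebra_simps)
    have "norm ((z' - z) / (z * z')) \<le> \<epsilon> / (m * m)"
      unfolding norm_divide norm_mult using assms e0
      by (intro frac_le mult_mono) (auto simp: norm_minus_commute)
    then show "norm (v * ((z' - z) / (z * z'))) \<le> M * (\<epsilon> / (m * m))"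
      unfolding norm_mult using M M0 by (intro mult_mono) auto
  qed
  finally show ?thesis by (simp add: power2_eq_square)
qed

text \<open>Here \<open>S\<close> is the parameter length of N^2 revolutions, and \<open>d\<close>
  is half of the distance that the Kepler orbit keeps from 1. The equation
  \<open>4 * \<Omega>\<^sup>2 * a = 1\<close> places the initial data on the energy level of genuine
  orbits.\<close>

lemma resonant_orbit:
  fixes \<Omega> \<kappa> M :: real and \<alpha> \<beta> :: complex and N :: nat and j :: int
  defines "a \<equiv> (norm \<alpha>)\<^sup>2 + (norm \<beta>)\<^sup>2"
  defines "S \<equiv> pi * (real N)\<^sup>2 / \<Omega>" and "d \<equiv> \<kappa> / (100 * M ^ 5 * (real N)\<^sup>2)"
  assumes \<Omega>: "0 < \<Omega>" "\<Omega> \<le> 1" "1 \<le> 2 * M * \<Omega>" "4 * \<Omega>\<^sup>2 * a = 1"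
    and M: "norm \<alpha> + norm \<beta> \<le> M" "1 \<le> M"
    and \<kappa>: "0 < \<kappa>" "\<kappa> \<le> 1"
    and peri: "\<kappa> \<le> (norm \<alpha> - norm \<beta>)\<^sup>2" "(norm \<alpha> - norm \<beta>)\<^sup>2 \<le> 1 - \<kappa>"
    and apo: "1 + \<kappa> \<le> (norm \<alpha> + norm \<beta>)\<^sup>2"
    and N: "2 \<le> N" and res: "a / (2 * \<Omega>) = of_int j / real N + 1 / (real N)\<^sup>2"
    and \<mu>: "0 < \<mu>" "\<mu> \<le> \<kappa> / 4"
    and eps: "\<epsilon> = 4800 * (M + 1) ^ 7 * \<mu> * S ^ 3 / (\<kappa> ^ 3 * d\<^sup>2)" "\<epsilon> \<le> d / 2"
  obtains c \<gamma> T' T where "norm c = 1" "norm (c - 1) \<le> 4 / real N"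
    "\<gamma> 0 = kep_phase \<Omega> (c * \<alpha>) (c * \<beta>)" "0 < T'" "T' < T" "1 < T"
    "hamiltonian_orbit (rc3bp_H \<mu>) (rc3bp_domain \<mu>) T' \<gamma>"
    "hamiltonian_orbit (rc3bp_H \<mu>) (rc3bp_domain \<mu>) T \<gamma>"
    "norm (fst (\<gamma> T') - vec2 1) \<le> 7 / real N + \<epsilon>"
    "norm (\<gamma> T - \<gamma> 0) \<le> 20 * (M + 1) / \<kappa>\<^sup>2 * \<epsilon>"
proof -
  obtain c s1 where c: "norm c = 1" "norm (c - 1) \<le> 4 / real N"
    and away: "\<And>s. \<kappa> / (50 * M ^ 5 * (real N)\<^sup>2) \<le> norm (kep_X \<Omega> (c * \<alpha>) (c * \<beta>) s - 1)"
    and s1: "0 < s1" "s1 < S" "norm (kep_X \<Omega> (c * \<alpha>) (c * \<beta>) s1 - 1) \<le> 7 / real N"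
    unfolding S_def using kepler_near_miss[OF \<Omega>(1-3) M \<kappa> peri(2) apo N res[unfolded a_def]] by blast
  define \<alpha>0 \<beta>0 where "\<alpha>0 = c * \<alpha>" and "\<beta>0 = c * \<beta>"
  have n0: "norm \<alpha>0 = norm \<alpha>" "norm \<beta>0 = norm \<beta>" by (simp_all add: \<alpha>0_def \<beta>0_def norm_mult c)
  have N0: "1 \<le> real N" using N by simp
  have N2: "1 \<le> (real N)\<^sup>2" using N0 by (rule one_le_power)
  have M5: "1 \<le> M ^ 5" using M by (intro one_le_power)
  have d0: "0 < d" unfolding d_def using \<kappa> M N by (intro divide_pos_pos mult_pos_pos) auto
  have d2: "2 * d = \<kappa> / (50 * M ^ 5 * (real N)\<^sup>2)" by (simp add: d_def)
  have d4: "d \<le> \<kappa> / 4"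
  proof -
    have "1 * 1 \<le> M ^ 5 * (real N)\<^sup>2" using M5 N2 M by (intro mult_mono) auto
    then have "\<kappa> / (100 * M ^ 5 * (real N)\<^sup>2) \<le> \<kappa> / 4" using \<kappa> by (intro frac_le) auto
    then show ?thesis by (simp add: d_def)
  qed
  have S1: "1 \<le> S"
  proof -
    have "\<Omega> * 1 \<le> pi * (real N)\<^sup>2" using \<Omega> N2 pi_ge_two by (intro mult_mono) auto
    then show ?thesis unfolding S_def using \<Omega> by simp
  qed
  let ?zr = "kep_z \<Omega> \<alpha>0 \<beta>0" and ?wr = "kep_w \<Omega> \<alpha>0 \<beta>0" and ?tr = "kep_t \<Omega> \<alpha>0 \<beta>0"
  have sun: "\<kappa> \<le> (norm (?zr s))\<^sup>2" for s
  proof -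
    have "\<bar>norm \<alpha> - norm \<beta>\<bar> \<le> norm (?zr s)"
      using norm_triangle_ineq3[of "\<alpha>0 * cis (\<Omega> * s)" "- (\<beta>0 * cis (- (\<Omega> * s)))"]
      by (simp add: kep_z_def norm_mult n0)
    then have "(norm \<alpha> - norm \<beta>)\<^sup>2 \<le> (norm (?zr s))\<^sup>2" by (rule abs_le_square_iff[THEN iffD1, OF order_trans]) simp
    then show ?thesis using peri(1) by simp
  qed
  have jup: "2 * d \<le> norm (cis (- ?tr s) * (?zr s)\<^sup>2 - 1)" for s
    using away[of s] unfolding d2 \<alpha>0_def \<beta>0_def kep_X_def .
  obtain z w :: "real \<Rightarrow> complex" and h t :: "real \<Rightarrow> real" where ini:
    "z 0 = \<alpha>0 + \<beta>0" "w 0 = \<i> * of_real \<Omega> * (\<alpha>0 - \<beta>0)" "h 0 = - 2 * \<Omega>\<^sup>2" "t 0 = 0"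
    and zD: "\<And>s. s \<in> {0..S} \<Longrightarrow> (z has_vector_derivative w s) (at s within {0..S})"
    and wD: "\<And>s. s \<in> {0..S} \<Longrightarrow> (w has_vector_derivative of_real (h s / 2) * z s
        + z s * cnj (z s) * cnj (z s) * inertial_force \<mu> (t s) (z s) / 2) (at s within {0..S})"
    and hD: "\<And>s. s \<in> {0..S} \<Longrightarrow> (h has_vector_derivative
        2 * Re (cnj (w s * z s) * inertial_force \<mu> (t s) (z s))) (at s within {0..S})"
    and tD: "\<And>s. s \<in> {0..S} \<Longrightarrow> (t has_vector_derivative (norm (z s))\<^sup>2) (at s within {0..S})"
    and dev: "\<And>s. s \<in> {0..S} \<Longrightarrow> norm (z s - ?zr s) \<le> \<epsilon>"
    "\<And>s. s \<in> {0..S} \<Longrightarrow> norm (w s - ?wr s) \<le> \<epsilon>"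
    "\<And>s. s \<in> {0..S} \<Longrightarrow> \<bar>t s - ?tr s\<bar> \<le> \<epsilon>"
    "\<And>s. s \<in> {0..S} \<Longrightarrow> norm (cis (- t s) * (z s)\<^sup>2 - cis (- ?tr s) * (?zr s)\<^sup>2) \<le> \<epsilon>"
    "\<And>s. s \<in> {0..S} \<Longrightarrow> \<kappa> / 2 \<le> norm (cis (- t s) * (z s)\<^sup>2) \<and> d \<le> norm (cis (- t s) * (z s)\<^sup>2 - of_real (1 - \<mu>))"
  proof (rule perturbed_kepler[OF \<Omega>(1-3) _ M(2) S1 \<mu>(1) \<kappa> d0 d4 sun jup eps], goal_cases)
    case 1
    then show ?case using M by (simp add: n0)
  next
    case (2 z w h t)
    show ?case by (rule that[of z w h t, OF 2(2-)])
  qed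
  define X where "X s = cis (- t s) * (z s)\<^sup>2" for s
  define Y where "Y s = cis (- t s) * (2 * w s / cnj (z s))" for s
  have I0: "0 \<in> {0..S}" "S \<in> {0..S}" "s1 \<in> {0..S}" using S1 s1 by auto
  have z_ge: "\<kappa> / 2 \<le> norm (z s)" if "s \<in> {0..S}" for s
  proof -
    have "(\<kappa> / 2)\<^sup>2 \<le> \<kappa> / 2" using \<kappa> by (simp add: power2_eq_square mult_left_le)
    also have "\<dots> \<le> (norm (z s))\<^sup>2" using dev(5)[OF that] by (simp add: norm_mult norm_power)
    finally show ?thesis by (rule power2_le_imp_le) simp
  qed
  have z0: "z s \<noteq> 0" if "s \<in> {0..S}" for s using z_ge[OF that] \<kappa> by auto
  \<comment> \<open>The parallelogram law turns \<open>4 * \<Omega>\<^sup>2 * a = 1\<close> into the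
    energy relation at the start.\<close>
  have h0: "h 0 * (norm (z 0))\<^sup>2 = 2 * (norm (w 0))\<^sup>2 - 1"
  proof -
    have "(norm (\<alpha>0 + \<beta>0))\<^sup>2 + (norm (\<alpha>0 - \<beta>0))\<^sup>2 = 2 * a"
      unfolding a_def n0[symmetric] cmod_power2 by (simp add: power2_eq_square algebra_simps)
    then have "2 * \<Omega>\<^sup>2 * ((norm (\<alpha>0 + \<beta>0))\<^sup>2 + (norm (\<alpha>0 - \<beta>0))\<^sup>2) = 1" using \<Omega>(4) by simp
    moreover have "norm (w 0) = \<Omega> * norm (\<alpha>0 - \<beta>0)" using \<Omega> by (simp add: ini norm_mult)
    ultimately show ?thesis by (simp add: ini(1,3) power_mult_distrib algebra_simps)
  qed
  have X0: "X s \<noteq> of_real (1 - \<mu>) \<and> X s \<noteq> of_real (- \<mu>)" if "s \<in> {0..S}" for s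
  proof -
    have "X s \<noteq> of_real (1 - \<mu>)" using dev(5)[OF that] d0 unfolding X_def by auto
    moreover have "norm (X s) \<noteq> \<mu>" using dev(5)[OF that] \<mu> \<kappa> unfolding X_def by auto
    ultimately show ?thesis using \<mu> by auto
  qed
  obtain \<gamma> where \<gamma>: "\<And>s. s \<in> {0..S} \<Longrightarrow> \<gamma> (t s) = (vec2 (X s), vec2 (Y s))"
    "\<And>s. s \<in> {0..S} \<Longrightarrow> hamiltonian_orbit (rc3bp_H \<mu>) (rc3bp_domain \<mu>) (t s) \<gamma>"
    and t_mono: "\<And>s s'. s \<in> {0..S} \<Longrightarrow> s' \<in> {0..S} \<Longrightarrow> s < s' \<Longrightarrow> t s < t s'"
  proof (rule regularized_orbit[OF _ ini(4) h0 z0 zD wD hD tD X0[unfolded X_def]], goal_cases)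
    case 1
    then show ?case using S1 by simp
  next
    case (8 \<gamma>)
    show ?case by (rule that[of \<gamma>, OF 8(2-)[folded X_def Y_def]])
  qed
  have \<gamma>0: "\<gamma> 0 = kep_phase \<Omega> \<alpha>0 \<beta>0"
    using \<gamma>(1)[OF I0(1)] by (simp add: ini X_def Y_def kep_phase_def)
  \<comment> \<open>During these revolutions the frame turns exactly j N + 1 times, so the Kepler
    orbit closes up in rotating coordinates as well.\<close>
  define n where "n = int (N * N)"
  have Sn: "S = 0 + of_int n * pi / \<Omega>" by (simp add: S_def n_def power2_eq_square)
  have "a / (2 * \<Omega>) * of_int n = of_int (j * int N + 1)"
    using N unfolding res n_def by (simp add: field_simps power2_eq_square)
  then have trS: "?tr S = 2 * pi * of_int (j * int N + 1)"
    unfolding Sn kep_period(3)[OF less_imp_neq[OF \<Omega>(1), symmetric]] n0 a_def[symmetric] by simp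
  \<comment> \<open>The sign that z and w may pick up over all revolutions; position and momentum do
    not see it.\<close>
  define e where "e = cis (of_int n * pi)"
  have e2: "e * e = 1" using cis_int_pi[of n] by (simp add: e_def power2_eq_square)
  then have "e = 1 \<or> e = - 1" using square_eq_1_iff by blast
  then have ee: "cnj e = e" "norm e = 1" "e \<noteq> 0" by auto
  have S_dev: "norm (e * z S - z 0) \<le> \<epsilon>" "norm (e * w S - w 0) \<le> \<epsilon>"
  proof -
    have "?zr S = e * z 0" "?wr S = e * w 0"
      unfolding Sn kep_period(1,2)[OF less_imp_neq[OF \<Omega>(1), symmetric]] e_def
      by (simp_all add: kep_z_def kep_w_def ini)
    then have "e * z S - z 0 = e * (z S - ?zr S)" "e * w S - w 0 = e * (w S - ?wr S)"
      using e2 by (simp_all add: right_diff_distrib mult.assoc[symmetric])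
    then show "norm (e * z S - z 0) \<le> \<epsilon>" "norm (e * w S - w 0) \<le> \<epsilon>"
      using dev(1,2)[OF I0(2)] by (simp_all add: norm_mult ee)
  qed
  have cisS: "norm (cis (- t S) - 1) \<le> \<epsilon>"
  proof -
    have "cis (- ?tr S) = cis (2 * pi * of_int (- (j * int N + 1)))"
      by (simp only: trS of_int_minus mult_minus_right)
    also have "\<dots> = 1" by (rule cis_multiple_2pi) simp
    finally show ?thesis using norm_cis_diff_le[of "- t S" "- ?tr S"] dev(3)[OF I0(2)] by simp
  qed
  have \<epsilon>0: "0 \<le> \<epsilon>" using dev(3)[OF I0(2)] by simp
  have e_le: "\<epsilon> \<le> 1" using eps(2) d4 \<kappa> by simp
  have w0M: "norm (w 0) \<le> M"
  proof -
    have "norm (w 0) \<le> \<bar>\<Omega>\<bar> * (norm \<alpha>0 + norm \<beta>0)" using norm_kep_w_le[of \<Omega> \<alpha>0 \<beta>0 0] by (simp add: kep_w_def ini)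
    also have "\<dots> \<le> 1 * M" using \<Omega> M by (intro mult_mono) (auto simp: n0)
    finally show ?thesis by simp
  qed
  have k2: "1 \<le> 1 / \<kappa>\<^sup>2" "1 / \<kappa> \<le> 1 / \<kappa>\<^sup>2" using \<kappa> by (auto simp: divide_simps power_le_one power2_eq_square mult_le_one)
  have Ydev: "norm (Y S - Y 0) \<le> 16 * (M + 1) / \<kappa>\<^sup>2 * \<epsilon>"
  proof -
    have "Y S = 2 * (cis (- t S) * ((e * w S) / cnj (e * z S)))" using e2 ee by (simp add: Y_def)
    moreover have "Y 0 = 2 * (w 0 / cnj (z 0))" by (simp add: Y_def ini)
    ultimately have "Y S - Y 0 = 2 * (cis (- t S) * ((e * w S) / cnj (e * z S)) - w 0 / cnj (z 0))"
      by (simp add: right_diff_distrib)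
    then have "norm (Y S - Y 0) = 2 * norm (cis (- t S) * ((e * w S) / cnj (e * z S)) - w 0 / cnj (z 0))"
      by (simp only: norm_mult norm_numeral)
    moreover have "norm (cis (- t S) * ((e * w S) / cnj (e * z S)) - w 0 / cnj (z 0))
        \<le> \<epsilon> * (1 + M) / (\<kappa> / 2) + M * \<epsilon> / (\<kappa> / 2)\<^sup>2"
    proof (rule norm_diff_quotient_le)
      have "norm (cnj (e * z S) - cnj (z 0)) = norm (e * z S - z 0)"
        by (metis complex_cnj_diff complex_mod_cnj)
      then show "norm (cnj (e * z S) - cnj (z 0)) \<le> \<epsilon>" using S_dev by simp
    qed (use \<kappa> z_ge[OF I0(1)] z_ge[OF I0(2)] w0M S_dev cisS ee in \<open>auto simp: norm_mult\<close>)
    moreover have "\<epsilon> * (1 + M) / (\<kappa> / 2) + M * \<epsilon> / (\<kappa> / 2)\<^sup>2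
        = 2 * (\<epsilon> * (1 + M)) * (1 / \<kappa>) + 4 * (M * \<epsilon>) * (1 / \<kappa>\<^sup>2)"
      by (simp add: power_divide mult_ac)
    moreover have "\<dots> \<le> 4 * (\<epsilon> * (1 + M)) * (1 / \<kappa>\<^sup>2) + 4 * ((1 + M) * \<epsilon>) * (1 / \<kappa>\<^sup>2)"
      using \<epsilon>0 M k2 \<kappa> by (intro add_mono mult_mono) auto
    moreover have "4 * (\<epsilon> * (1 + M)) * (1 / \<kappa>\<^sup>2) + 4 * ((1 + M) * \<epsilon>) * (1 / \<kappa>\<^sup>2)
        = 16 * (M + 1) / \<kappa>\<^sup>2 * \<epsilon> / 2"
      by (simp add: algebra_simps add_divide_distrib)
    moreover have "x = 2 * q \<Longrightarrow> q \<le> a \<Longrightarrow> a = b \<Longrightarrow> b \<le> c \<Longrightarrow> c = e / 2 \<Longrightarrow> x \<le> e" for x q a b c e :: real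
      by linarith
    ultimately show ?thesis by blast
  qed
  have Xdev: "norm (X S - X 0) \<le> \<epsilon>"
  proof -
    have "cis (- ?tr S) * (?zr S)\<^sup>2 = X 0"
    proof -
      have "cis (- ?tr S) = cis (2 * pi * of_int (- (j * int N + 1)))"
      by (simp only: trS of_int_minus mult_minus_right)
      also have "\<dots> = 1" by (rule cis_multiple_2pi) simp
      finally have "cis (- ?tr S) = 1" .
      moreover have "?zr S = e * z 0"
        unfolding Sn kep_period(1,2)[OF less_imp_neq[OF \<Omega>(1), symmetric]] e_def
        by (simp_all add: kep_z_def ini)
      ultimately show ?thesis using e2 by (simp add: X_def ini power_mult_distrib power2_eq_square)
    qed
    then show ?thesis using dev(4)[OF I0(2)] by (simp add: X_def)
  qed
  \<comment> \<open>The number of turns is an integer, and positive since it equals a N^2 / (2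
    \<Omega>). Hence the return time is at least 2 pi - \<epsilon>, which exceeds 1.\<close>
  have jN: "1 \<le> j * int N + 1"
  proof -
    have "0 < a / (2 * \<Omega>) * of_int n"
    proof -
      have "0 < a" using \<Omega> by (metis mult_zero_right not_one_less_zero zero_less_one
            add_nonneg_nonneg a_def zero_le_power2 order_le_less zero_neq_one)
      then show ?thesis using \<Omega> N by (simp add: n_def)
    qed
    then have "(0::real) < of_int (j * int N + 1)"
      using \<open>a / (2 * \<Omega>) * of_int n = of_int (j * int N + 1)\<close> by simp
    then have "0 < j * int N + 1" by (simp only: of_int_0_less_iff)
    then show ?thesis by simp
  qed
  have T1: "1 < t S"
  proof -
    have "2 * 2 * 1 \<le> 2 * pi * of_int (j * int N + 1)"
      using jN pi_ge_two by (intro mult_mono) (auto simp del: of_int_add of_int_mult)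
    then show ?thesis using dev(3)[OF I0(2)] e_le unfolding trS by linarith
  qed
  show ?thesis
  proof (rule that[OF c, of \<gamma> "t s1" "t S"])
    show "\<gamma> 0 = kep_phase \<Omega> (c * \<alpha>) (c * \<beta>)" using \<gamma>0 by (simp add: \<alpha>0_def \<beta>0_def)
    show "0 < t s1" using t_mono[OF I0(1) I0(3)] s1 ini by simp
    show "t s1 < t S" using t_mono[OF I0(3) I0(2)] s1 by simp
    show "1 < t S" by (rule T1)
    show "hamiltonian_orbit (rc3bp_H \<mu>) (rc3bp_domain \<mu>) (t s1) \<gamma>"
      "hamiltonian_orbit (rc3bp_H \<mu>) (rc3bp_domain \<mu>) (t S) \<gamma>"
      using \<gamma>(2) I0 by auto
    have "norm (X s1 - 1) \<le> norm (X s1 - kep_X \<Omega> \<alpha>0 \<beta>0 s1) + norm (kep_X \<Omega> \<alpha>0 \<beta>0 s1 - 1)"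
      using norm_triangle_ineq[of "X s1 - kep_X \<Omega> \<alpha>0 \<beta>0 s1" "kep_X \<Omega> \<alpha>0 \<beta>0 s1 - 1"] by simp
    also have "\<dots> \<le> 7 / real N + \<epsilon>"
      using dev(4)[OF I0(3)] s1(3) by (simp add: X_def kep_X_def \<alpha>0_def \<beta>0_def)
    finally show "norm (fst (\<gamma> (t s1)) - vec2 1) \<le> 7 / real N + \<epsilon>"
      by (simp add: \<gamma>(1)[OF I0(3)] flip: vec2_diff)
    have "\<gamma> (t S) - \<gamma> 0 = (vec2 (X S - X 0), vec2 (Y S - Y 0))"
      using \<gamma>(1)[OF I0(2)] \<gamma>(1)[OF I0(1)] by (simp add: ini vec2_diff)
    then have "norm (\<gamma> (t S) - \<gamma> 0) \<le> norm (X S - X 0) + norm (Y S - Y 0)"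
      using norm_Pair_le[of "vec2 (X S - X 0)" "vec2 (Y S - Y 0)"] by simp
    also have "\<dots> \<le> 1 * \<epsilon> + 16 * (M + 1) / \<kappa>\<^sup>2 * \<epsilon>" using Xdev Ydev by simp
    also have "\<dots> \<le> 4 * (M + 1) / \<kappa>\<^sup>2 * \<epsilon> + 16 * (M + 1) / \<kappa>\<^sup>2 * \<epsilon>"
    proof -
      have "1 * 1 \<le> (4 * (M + 1)) * (1 / \<kappa>\<^sup>2)" using k2 M by (intro mult_mono) auto
      then have "1 * \<epsilon> \<le> 4 * (M + 1) / \<kappa>\<^sup>2 * \<epsilon>" using \<epsilon>0 by (intro mult_right_mono) auto
      then show ?thesis by simp
    qed
    also have "\<dots> = 20 * (M + 1) / \<kappa>\<^sup>2 * \<epsilon>" by (simp add: algebra_simps add_divide_distrib)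
    finally show "norm (\<gamma> (t S) - \<gamma> 0) \<le> 20 * (M + 1) / \<kappa>\<^sup>2 * \<epsilon>" .
  qed
qed

text \<open>Scaling a by l^2 multiplies a^(3/2) by l^3. Rounding N a^(3/2) up makes l at least 1,
  and a at least 1/2 keeps the relative change of order 1 / N.\<close>

lemma ex_resonant_scaling:
  fixes a :: real and N :: nat
  assumes a: "1 / 2 \<le> a" and N: "1 \<le> N"
  obtains l :: real and j :: int where "1 \<le> l" "l\<^sup>2 \<le> 1 + 6 / real N"
    "(l\<^sup>2 * a) * (l * sqrt a) = of_int j / real N + 1 / (real N)\<^sup>2"
proof -
  define \<tau> where "\<tau> = a * sqrt a"
  define j where "j = \<lceil>real N * \<tau>\<rceil>"
  define R where "R = of_int j / real N + 1 / (real N)\<^sup>2"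
  have "2 / 3 \<le> sqrt a" using a by (intro real_le_rsqrt) (simp add: power2_eq_square)
  then have \<tau>: "1 / 3 \<le> \<tau>"
    using mult_mono[of "1/2" a "2/3" "sqrt a"] a by (simp add: \<tau>_def)
  have j: "real N * \<tau> \<le> of_int j" "of_int j \<le> real N * \<tau> + 1" by (simp_all add: j_def)
  have N0: "0 < real N" "1 \<le> real N" using N by simp_all
  have jl: "\<tau> \<le> of_int j / real N" "of_int j / real N \<le> \<tau> + 1 / real N"
    using j N0 by (simp_all add: field_simps)
  have n2: "0 < 1 / (real N)\<^sup>2" "1 / (real N)\<^sup>2 \<le> 1 / real N"
    using N0 by (simp_all add: power2_eq_square field_simps)
  have R: "\<tau> \<le> R" "R \<le> \<tau> + 2 / real N" unfolding R_def using jl n2 by linarith+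
  define l where "l = root 3 (R / \<tau>)"
  have l3: "l ^ 3 = R / \<tau>" using R \<tau> by (simp add: l_def)
  have l1: "1 \<le> l" using R \<tau> by (simp add: l_def)
  show ?thesis
  proof (rule that[OF l1])
    have "l ^ 2 \<le> l ^ 3" using l1 by (intro power_increasing) auto
    also have "\<dots> \<le> (\<tau> + 2 / real N) / \<tau>" unfolding l3 using R \<tau> by (intro divide_right_mono) auto
    also have "\<dots> = 1 + 2 / real N * (1 / \<tau>)" using \<tau> by (simp add: add_divide_distrib)
    also have "\<dots> \<le> 1 + 2 / real N * 3" using \<tau> by (intro add_left_mono mult_left_mono) (auto simp: field_simps)
    finally show "l\<^sup>2 \<le> 1 + 6 / real N" by simp
    have "(l\<^sup>2 * a) * (l * sqrt a) = l ^ 3 * \<tau>" by (simp add: \<tau>_def power2_eq_square power3_eq_cube)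
    also have "\<dots> = R" using \<tau> by (simp add: l3)
    finally show "(l\<^sup>2 * a) * (l * sqrt a) = of_int j / real N + 1 / (real N)\<^sup>2" by (simp add: R_def)
  qed
qed

text \<open>Kepler's similarity: positions scale by l^2 and momenta by 1 / l, and both turn by the
  square of c.\<close>

lemma kep_phase_scale:
  assumes "norm c = 1" "0 < l"
  shows "kep_phase (\<Omega> / l) (c * (of_real l * \<alpha>)) (c * (of_real l * \<beta>))
    = (vec2 ((c\<^sup>2 * of_real (l\<^sup>2)) * (\<alpha> + \<beta>)\<^sup>2),
       vec2 ((c\<^sup>2 / of_real l) * (2 * (\<i> * of_real \<Omega> * (\<alpha> - \<beta>)) / cnj (\<alpha> + \<beta>))))"
proof -
  have c: "c * cnj c = 1" using assms complex_norm_square[of c] by simp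
  then have c0: "c \<noteq> 0" "cnj c \<noteq> 0" by auto
  have "(c * (of_real l * \<alpha>) + c * (of_real l * \<beta>))\<^sup>2 = (c\<^sup>2 * of_real (l\<^sup>2)) * (\<alpha> + \<beta>)\<^sup>2"
    by (simp add: power2_eq_square algebra_simps)
  moreover have "2 * (\<i> * of_real (\<Omega> / l) * (c * (of_real l * \<alpha>) - c * (of_real l * \<beta>)))
      / cnj (c * (of_real l * \<alpha>) + c * (of_real l * \<beta>))
      = (c\<^sup>2 / of_real l) * (2 * (\<i> * of_real \<Omega> * (\<alpha> - \<beta>)) / cnj (\<alpha> + \<beta>))"
  proof -
    have "2 * (\<i> * of_real (\<Omega> / l) * (c * (of_real l * \<alpha>) - c * (of_real l * \<beta>)))
      = c * (2 * (\<i> * of_real \<Omega> * (\<alpha> - \<beta>)))"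
      using assms by (simp add: field_simps)
    moreover have "cnj (c * (of_real l * \<alpha>) + c * (of_real l * \<beta>)) = (of_real l / c) * cnj (\<alpha> + \<beta>)"
    proof -
      have "cnj c = 1 / c" using c c0 by (simp add: field_simps)
      moreover have "cnj (c * (of_real l * \<alpha>) + c * (of_real l * \<beta>)) = cnj c * of_real l * cnj (\<alpha> + \<beta>)"
        by (simp add: algebra_simps)
      ultimately show ?thesis by simp
    qed
    ultimately show ?thesis using assms c0 by (simp add: power2_eq_square)
  qed
  ultimately show ?thesis by (simp add: kep_phase_def)
qed

text \<open>Writing the mass as \<delta>^20 leaves only natural powers. The constants depend on
  \<kappa> and M alone, hence are uniform over a compact set of initial points.\<close>

lemma near_collision_and_return:
  fixes \<kappa> M :: real
  assumes \<kappa>: "0 < \<kappa>" "\<kappa> \<le> 1" and M: "1 \<le> M"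
  obtains C \<delta>0 where "0 < C" "0 < \<delta>0" "\<And>\<delta> \<alpha> \<beta>. \<lbrakk>0 < \<delta>; \<delta> < \<delta>0;
    \<kappa> \<le> (norm \<alpha> - norm \<beta>)\<^sup>2; (norm \<alpha> - norm \<beta>)\<^sup>2 \<le> 1 - \<kappa>; 1 + \<kappa> \<le> (norm \<alpha> + norm \<beta>)\<^sup>2;
    norm \<alpha> + norm \<beta> \<le> M\<rbrakk> \<Longrightarrow>
    \<exists>\<gamma> T' T. 0 < T' \<and> T' < T \<and> 1 < T \<and>
       hamiltonian_orbit (rc3bp_H (\<delta> ^ 20)) (rc3bp_domain (\<delta> ^ 20)) T' \<gamma> \<and>
       hamiltonian_orbit (rc3bp_H (\<delta> ^ 20)) (rc3bp_domain (\<delta> ^ 20)) T \<gamma> \<and>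
       norm (\<gamma> 0 - kep_phase (1 / (2 * sqrt ((norm \<alpha>)\<^sup>2 + (norm \<beta>)\<^sup>2))) \<alpha> \<beta>) < C * \<delta> \<and>
       norm (\<gamma> T - kep_phase (1 / (2 * sqrt ((norm \<alpha>)\<^sup>2 + (norm \<beta>)\<^sup>2))) \<alpha> \<beta>) < C * \<delta> \<and>
       norm (fst (\<gamma> T') - vec2 (of_real (1 - \<delta> ^ 20))) \<le> C * \<delta>"
proof -
  \<comment> \<open>Chosen to give \<epsilon> \<le> C0 \<mu> N^10. It is computed with 2 M and
    \<kappa> / 2, since the scaling may enlarge the orbit; the cubed \<open>16 * M\<close> bounds S
    / N^2, and the last factor is the square of 1 / (d N^2).\<close>
  define C0 where "C0 = 4800 * (2 * M + 1) ^ 7 * (16 * M) ^ 3 * (2 / \<kappa>) ^ 3 * (6400 * M ^ 5 / \<kappa>)\<^sup>2"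
  \<comment> \<open>The first bound yields 6 / N \<le> \<kappa> / 2, which controls the scaling; the
    second yields \<epsilon> \<le> d / 2.\<close>
  define \<delta>0 where "\<delta>0 = min (\<kappa> / 12) (\<kappa> / (C0 * 4096 * (12800 * M ^ 5)))"
  \<comment> \<open>14 = 8 + 6 from rotation and scaling; the two summands bound the position and
    the momentum. \<open>C2\<close> is the return constant for 2 M and \<kappa> / 2. The 10 in
    \<open>C\<close> exceeds the 7 + 1 + 1 of the near collision and makes the other estimates
    strict.\<close>
  define C1 where "C1 = 14 * (M\<^sup>2 + 2 * M / \<kappa>)"
  define C2 where "C2 = 80 * (2 * M + 1) / \<kappa>\<^sup>2"
  define C where "C = C1 + C2 + 10"
  have C0: "0 < C0" unfolding C0_def using M \<kappa> by (intro mult_pos_pos zero_less_power divide_pos_pos) auto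
  have C12: "0 \<le> C1" "0 \<le> C2" using M \<kappa> by (auto simp: C1_def C2_def)
  have M5: "0 < M ^ 5" "1 \<le> M ^ 5" using M by (auto simp: one_le_power)
  have "0 < C" using C12 by (simp add: C_def)
  moreover have "0 < \<delta>0" unfolding \<delta>0_def using \<kappa> C0 M5 by simp
  moreover have "\<exists>\<gamma> T' T. 0 < T' \<and> T' < T \<and> 1 < T \<and>
       hamiltonian_orbit (rc3bp_H (\<delta> ^ 20)) (rc3bp_domain (\<delta> ^ 20)) T' \<gamma> \<and>
       hamiltonian_orbit (rc3bp_H (\<delta> ^ 20)) (rc3bp_domain (\<delta> ^ 20)) T \<gamma> \<and>
       norm (\<gamma> 0 - kep_phase (1 / (2 * sqrt ((norm \<alpha>)\<^sup>2 + (norm \<beta>)\<^sup>2))) \<alpha> \<beta>) < C * \<delta> \<and>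
       norm (\<gamma> T - kep_phase (1 / (2 * sqrt ((norm \<alpha>)\<^sup>2 + (norm \<beta>)\<^sup>2))) \<alpha> \<beta>) < C * \<delta> \<and>
       norm (fst (\<gamma> T') - vec2 (of_real (1 - \<delta> ^ 20))) \<le> C * \<delta>"
    if \<delta>: "0 < \<delta>" "\<delta> < \<delta>0" and peri: "\<kappa> \<le> (norm \<alpha> - norm \<beta>)\<^sup>2" "(norm \<alpha> - norm \<beta>)\<^sup>2 \<le> 1 - \<kappa>"
      and apo: "1 + \<kappa> \<le> (norm \<alpha> + norm \<beta>)\<^sup>2" and AM: "norm \<alpha> + norm \<beta> \<le> M" for \<delta> \<alpha> \<beta>
  proof -

    \<comment> \<open>Passing to the resonant orbit\<close>
    define a where "a = (norm \<alpha>)\<^sup>2 + (norm \<beta>)\<^sup>2"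
    define \<Omega> where "\<Omega> = 1 / (2 * sqrt a)"
    define \<mu> where "\<mu> = \<delta> ^ 20"
    have \<delta>12: "\<delta> < \<kappa> / 12" "\<delta> < \<kappa> / (C0 * 4096 * (12800 * M ^ 5))" using \<delta>(2) by (auto simp: \<delta>0_def)
    have \<delta>1: "\<delta> \<le> 1" using \<delta>12 \<kappa> by simp
    define N where "N = nat \<lceil>1 / \<delta>\<rceil>"
    have N: "1 / \<delta> \<le> real N" "real N \<le> 1 / \<delta> + 1" using \<delta> by (simp_all add: N_def)
    have "12 / \<kappa> \<le> 1 / \<delta>" using \<delta>12 \<delta> \<kappa> by (simp add: field_simps)
    then have N12: "12 / \<kappa> \<le> real N" using N by simp
    have "12 \<le> 12 / \<kappa>" using \<kappa> by (simp add: field_simps)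
    then have "12 \<le> real N" using N12 by linarith
    then have N2: "2 \<le> N" "1 \<le> N" "0 < real N" by auto
    have Nd: "1 / real N \<le> \<delta>" using N \<delta> N2 by (simp add: field_simps)
    have Nd2: "real N * \<delta> \<le> 2" using mult_right_mono[OF N(2), of \<delta>] \<delta> \<delta>1 by (simp add: distrib_right)
    have N6: "6 / real N \<le> \<kappa> / 2" using N12 \<kappa> N2 by (simp add: field_simps)
    have a2: "1 / 2 \<le> a"
    proof -
      have "0 \<le> (norm \<alpha> - norm \<beta>)\<^sup>2" by simp
      then show ?thesis using apo \<kappa> unfolding a_def power2_eq_square by (simp add: algebra_simps)
    qed
    have sa: "0 < sqrt a" "(sqrt a)\<^sup>2 = a" using a2 by auto
    have aM: "sqrt a \<le> M"
    proof (rule real_le_lsqrt)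
      have "a \<le> (norm \<alpha> + norm \<beta>)\<^sup>2" by (simp add: a_def power2_eq_square algebra_simps)
      also have "\<dots> \<le> M\<^sup>2" using AM by (intro power_mono) auto
      finally show "a \<le> M\<^sup>2" .
    qed (use M a2 in auto)
    have "1 / 2 \<le> sqrt a" using a2 by (intro real_le_rsqrt) (simp add: power2_eq_square)
    then have \<Omega>: "0 < \<Omega>" "\<Omega> \<le> 1" "1 \<le> 2 * M * \<Omega>" "4 * \<Omega>\<^sup>2 * a = 1"
      using sa aM a2 by (simp_all add: \<Omega>_def field_simps power_divide power_mult_distrib)
    obtain l :: real and j :: int where l: "1 \<le> l" "l\<^sup>2 \<le> 1 + 6 / real N"
      "(l\<^sup>2 * a) * (l * sqrt a) = of_int j / real N + 1 / (real N)\<^sup>2"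
      by (rule ex_resonant_scaling[OF a2 N2(2)])
    have l2: "1 \<le> l\<^sup>2" "l \<le> l\<^sup>2" "l\<^sup>2 \<le> 1 + \<kappa> / 2" "l \<le> 2"
    proof -
      show "1 \<le> l\<^sup>2" using l by (simp add: one_le_power)
      show 1: "l \<le> l\<^sup>2" using l by (simp add: power2_eq_square)
      show 2: "l\<^sup>2 \<le> 1 + \<kappa> / 2" using l(2) N6 by simp
      show "l \<le> 2" using 1 2 \<kappa> by simp
    qed
    define \<alpha>1 \<beta>1 where "\<alpha>1 = of_real l * \<alpha>" and "\<beta>1 = of_real l * \<beta>"
    have n1: "norm \<alpha>1 = l * norm \<alpha>" "norm \<beta>1 = l * norm \<beta>" using l by (simp_all add: \<alpha>1_def \<beta>1_def norm_mult)
    have a1: "(norm \<alpha>1)\<^sup>2 + (norm \<beta>1)\<^sup>2 = l\<^sup>2 * a" by (simp add: n1 a_def power_mult_distrib algebra_simps)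
    have pm: "(norm \<alpha>1 - norm \<beta>1)\<^sup>2 = l\<^sup>2 * (norm \<alpha> - norm \<beta>)\<^sup>2" "(norm \<alpha>1 + norm \<beta>1)\<^sup>2 = l\<^sup>2 * (norm \<alpha> + norm \<beta>)\<^sup>2"
      by (simp_all add: n1 power_mult_distrib flip: right_diff_distrib distrib_left)
    have \<Omega>1: "0 < \<Omega> / l" "\<Omega> / l \<le> 1" "1 \<le> 2 * (2 * M) * (\<Omega> / l)"
      "4 * (\<Omega> / l)\<^sup>2 * ((norm \<alpha>1)\<^sup>2 + (norm \<beta>1)\<^sup>2) = 1"
    proof -
      show "0 < \<Omega> / l" using \<Omega> l by simp
      show "\<Omega> / l \<le> 1" using \<Omega> l by simp
      have "1 * (1 / 2) \<le> 2 * M * \<Omega> * (1 / l)" using \<Omega> l l2 M by (intro mult_mono) (auto simp: field_simps)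
      then show "1 \<le> 2 * (2 * M) * (\<Omega> / l)" by simp
      show "4 * (\<Omega> / l)\<^sup>2 * ((norm \<alpha>1)\<^sup>2 + (norm \<beta>1)\<^sup>2) = 1"
        unfolding a1 power_divide using \<Omega>(4) l by simp
    qed
    have M1: "norm \<alpha>1 + norm \<beta>1 \<le> 2 * M" "1 \<le> 2 * M"
    proof -
      have "norm \<alpha>1 + norm \<beta>1 = l * (norm \<alpha> + norm \<beta>)" by (simp add: n1 distrib_left)
      also have "\<dots> \<le> 2 * M" using l l2 AM by (intro mult_mono) auto
      finally show "norm \<alpha>1 + norm \<beta>1 \<le> 2 * M" .
      show "1 \<le> 2 * M" using M by simp
    qed
    \<comment> \<open>Squared lengths grow by a factor of at most 1 + \<kappa> / 2, so half of each
      margin survives.\<close>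
    have peri1: "\<kappa> / 2 \<le> (norm \<alpha>1 - norm \<beta>1)\<^sup>2" "(norm \<alpha>1 - norm \<beta>1)\<^sup>2 \<le> 1 - \<kappa> / 2"
      and apo1: "1 + \<kappa> / 2 \<le> (norm \<alpha>1 + norm \<beta>1)\<^sup>2"
    proof -
      have "1 * \<kappa> \<le> l\<^sup>2 * (norm \<alpha> - norm \<beta>)\<^sup>2" using l2 peri \<kappa> by (intro mult_mono) auto
      then show "\<kappa> / 2 \<le> (norm \<alpha>1 - norm \<beta>1)\<^sup>2" unfolding pm using \<kappa> by simp
      have "l\<^sup>2 * (norm \<alpha> - norm \<beta>)\<^sup>2 \<le> (1 + \<kappa> / 2) * (1 - \<kappa>)" using l2 peri \<kappa> by (intro mult_mono) auto
      also have "\<dots> \<le> 1 - \<kappa> / 2" using \<kappa> by (simp add: algebra_simps)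
      finally show "(norm \<alpha>1 - norm \<beta>1)\<^sup>2 \<le> 1 - \<kappa> / 2" unfolding pm .
      have "1 * (1 + \<kappa>) \<le> l\<^sup>2 * (norm \<alpha> + norm \<beta>)\<^sup>2" using l2 apo \<kappa> by (intro mult_mono) auto
      then show "1 + \<kappa> / 2 \<le> (norm \<alpha>1 + norm \<beta>1)\<^sup>2" unfolding pm using \<kappa> by simp
    qed
    have res: "((norm \<alpha>1)\<^sup>2 + (norm \<beta>1)\<^sup>2) / (2 * (\<Omega> / l)) = of_int j / real N + 1 / (real N)\<^sup>2"
      unfolding a1 l(3)[symmetric] using sa l(1) by (simp add: \<Omega>_def mult_ac)
    have \<mu>: "0 < \<mu>" "\<mu> \<le> \<delta>" "\<mu> \<le> (\<kappa> / 2) / 4"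
    proof -
      show "0 < \<mu>" using \<delta> by (simp add: \<mu>_def)
      show 1: "\<mu> \<le> \<delta>" unfolding \<mu>_def using power_decreasing[of 1 20 \<delta>] \<delta> \<delta>1 by simp
      show "\<mu> \<le> (\<kappa> / 2) / 4" using 1 \<delta>12 \<kappa> by simp
    qed

    \<comment> \<open>The size of the deviation\<close>
    define S where "S = pi * (real N)\<^sup>2 / (\<Omega> / l)"
    define d where "d = (\<kappa> / 2) / (100 * (2 * M) ^ 5 * (real N)\<^sup>2)"
    define \<epsilon> where "\<epsilon> = 4800 * (2 * M + 1) ^ 7 * \<mu> * S ^ 3 / ((\<kappa> / 2) ^ 3 * d\<^sup>2)"
    have d: "d = \<kappa> / (6400 * M ^ 5 * (real N)\<^sup>2)" by (simp add: d_def power_mult_distrib)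
    have d0: "0 < d" using \<kappa> M5 N2 by (simp add: d)
    have \<epsilon>_le: "\<epsilon> \<le> C0 * (\<mu> * real N ^ 10)"
    proof -
      have "1 / (\<Omega> / l) \<le> 4 * M" using \<Omega>1(1,3) by (subst pos_divide_le_eq) auto
      then have "pi * (real N)\<^sup>2 * (1 / (\<Omega> / l)) \<le> 4 * (real N)\<^sup>2 * (4 * M)"
        using pi_less_4 \<Omega>(1) l(1) by (intro mult_mono) auto
      then have "S \<le> 16 * M * (real N)\<^sup>2" by (simp add: S_def mult_ac)
      then have S3: "S ^ 3 \<le> (16 * M * (real N)\<^sup>2) ^ 3"
        using \<Omega>(1) l(1) by (intro power_mono) (auto simp: S_def)
      have "\<epsilon> = (4800 * (2 * M + 1) ^ 7 * \<mu> * (2 / \<kappa>) ^ 3 * (1 / d)\<^sup>2) * S ^ 3"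
        using \<kappa> d0 by (simp add: \<epsilon>_def power_divide field_simps)
      also have "\<dots> \<le> (4800 * (2 * M + 1) ^ 7 * \<mu> * (2 / \<kappa>) ^ 3 * (1 / d)\<^sup>2) * (16 * M * (real N)\<^sup>2) ^ 3"
        using S3 M \<mu> \<kappa> by (intro mult_left_mono) auto
      also have "1 / d = 6400 * M ^ 5 / \<kappa> * (real N)\<^sup>2" using \<kappa> by (simp add: d)
      also have "(4800 * (2 * M + 1) ^ 7 * \<mu> * (2 / \<kappa>) ^ 3 * (6400 * M ^ 5 / \<kappa> * (real N)\<^sup>2)\<^sup>2) * (16 * M * (real N)\<^sup>2) ^ 3
          = C0 * (\<mu> * (((real N)\<^sup>2)\<^sup>2 * ((real N)\<^sup>2) ^ 3))"
        unfolding C0_def power_mult_distrib by (simp only: mult_ac)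
      also have "((real N)\<^sup>2)\<^sup>2 * ((real N)\<^sup>2) ^ 3 = real N ^ 10"
        by (simp flip: power_mult power_add)
      finally show ?thesis .
    qed
    have \<epsilon>_d: "\<epsilon> \<le> d / 2"
    proof -
      \<comment> \<open>The exponents meet here: \<epsilon> is of order \<mu> N^10 and d of order 1
        / N^2, so \<mu> N^12 has to be small. Since N \<delta> \<le> 2, it is at most 2^12
        \<delta>^8.\<close>
      have "\<mu> * real N ^ 12 = (real N * \<delta>) ^ 12 * \<delta> ^ 8"
        unfolding \<mu>_def power_mult_distrib mult.assoc power_add[symmetric] by (simp add: mult.commute)
      also have "\<dots> \<le> 2 ^ 12 * \<delta> ^ 8" using Nd2 \<delta> by (intro mult_right_mono power_mono) auto
      also have "\<dots> \<le> 2 ^ 12 * \<delta>" using power_decreasing[of 1 8 \<delta>] \<delta> \<delta>1 by simp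
      finally have m: "\<mu> * real N ^ 12 \<le> 4096 * \<delta>" by simp
      have "C0 * (\<mu> * real N ^ 10) * (12800 * M ^ 5 * (real N)\<^sup>2) = C0 * (12800 * M ^ 5) * (\<mu> * real N ^ 12)"
        by (simp add: mult_ac flip: power_add)
      also have "\<dots> \<le> C0 * (12800 * M ^ 5) * (4096 * \<delta>)"
        using m C0 M5 by (intro mult_left_mono) auto
      also have "\<dots> = \<delta> * (C0 * 4096 * (12800 * M ^ 5))" by simp
      also have "\<dots> \<le> \<kappa>" using \<delta>12(2) C0 M5 by (simp add: pos_less_divide_eq)
      finally have "C0 * (\<mu> * real N ^ 10) \<le> \<kappa> / (12800 * M ^ 5 * (real N)\<^sup>2)"
        using M5 N2 by (subst pos_le_divide_eq) auto
      then show ?thesis using \<epsilon>_le by (simp add: d)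
    qed
    have d_\<delta>: "d \<le> \<delta>"
    proof -
      have "1 * 1 \<le> M ^ 5 * real N" using M5 N2 by (intro mult_mono) auto
      then have "1 * real N \<le> (6400 * (M ^ 5 * real N)) * real N" by (intro mult_right_mono) auto
      then have "1 * real N \<le> 6400 * M ^ 5 * (real N)\<^sup>2" by (simp add: power2_eq_square mult_ac)
      then have "d \<le> 1 / real N" unfolding d using \<kappa> N2 by (intro frac_le) auto
      then show ?thesis using Nd by simp
    qed
    have \<epsilon>\<delta>: "\<epsilon> \<le> \<delta>" using \<epsilon>_d d_\<delta> d0 by simp
    have \<kappa>1: "0 < \<kappa> / 2" "\<kappa> / 2 \<le> 1" using \<kappa> by auto
    obtain c \<gamma> T' T where c: "norm c = 1" "norm (c - 1) \<le> 4 / real N"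
      and \<gamma>0: "\<gamma> 0 = kep_phase (\<Omega> / l) (c * \<alpha>1) (c * \<beta>1)" and T: "0 < T'" "T' < T" "1 < T"
      and orb: "hamiltonian_orbit (rc3bp_H \<mu>) (rc3bp_domain \<mu>) T' \<gamma>"
        "hamiltonian_orbit (rc3bp_H \<mu>) (rc3bp_domain \<mu>) T \<gamma>"
      and coll: "norm (fst (\<gamma> T') - vec2 1) \<le> 7 / real N + \<epsilon>"
      and ret: "norm (\<gamma> T - \<gamma> 0) \<le> 20 * (2 * M + 1) / (\<kappa> / 2)\<^sup>2 * \<epsilon>"
      using resonant_orbit[OF \<Omega>1 M1 \<kappa>1 peri1 apo1 N2(1) res \<mu>(1,3) \<epsilon>_def[unfolded S_def d_def] \<epsilon>_d[unfolded d_def]]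
      by metis

    \<comment> \<open>Distances from the given point and from the collision\<close>
    define X0 where "X0 = (\<alpha> + \<beta>)\<^sup>2"
    define Y0 where "Y0 = 2 * (\<i> * of_real \<Omega> * (\<alpha> - \<beta>)) / cnj (\<alpha> + \<beta>)"
    have X0: "norm X0 \<le> M\<^sup>2"
      using AM norm_triangle_ineq[of \<alpha> \<beta>] by (simp add: X0_def norm_power power_mono)
    have Y0: "norm Y0 \<le> 2 * M / \<kappa>"
    proof -
      have "\<bar>norm \<alpha> - norm \<beta>\<bar> \<le> norm (\<alpha> + \<beta>)" using norm_triangle_ineq3[of \<alpha> "- \<beta>"] by simp
      moreover have "\<kappa> \<le> \<bar>norm \<alpha> - norm \<beta>\<bar>"
      proof (rule power2_le_imp_le)
        have "\<kappa>\<^sup>2 \<le> \<kappa>" using \<kappa> by (simp add: power2_eq_square mult_left_le)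
        then show "\<kappa>\<^sup>2 \<le> \<bar>norm \<alpha> - norm \<beta>\<bar>\<^sup>2" using peri by simp
      qed simp
      ultimately have "\<kappa> \<le> norm (\<alpha> + \<beta>)" by simp
      moreover have "2 * (\<Omega> * norm (\<alpha> - \<beta>)) \<le> 2 * (1 * M)"
        using \<Omega> AM norm_triangle_ineq4[of \<alpha> \<beta>] by (intro mult_left_mono mult_mono) auto
      moreover have "norm Y0 = 2 * (\<Omega> * norm (\<alpha> - \<beta>)) / norm (\<alpha> + \<beta>)"
        unfolding Y0_def norm_divide complex_mod_cnj using \<Omega> by (simp add: norm_mult)
      ultimately show ?thesis using \<kappa> M by (auto intro!: frac_le)
    qed
    have c2: "norm (c\<^sup>2 - 1) \<le> 8 * \<delta>"
    proof -
      have "norm (c\<^sup>2 - 1) \<le> 2 * norm (c - 1)" using norm_power_minus_one_le[OF c(1), of 2] by simp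
      also have "\<dots> \<le> 8 * (1 / real N)" using c(2) by simp
      finally show ?thesis using Nd by simp
    qed
    have l\<delta>: "l\<^sup>2 - 1 \<le> 6 * \<delta>" using l(2) Nd by simp
    have cX: "norm (c\<^sup>2 * of_real (l\<^sup>2) - 1) \<le> 14 * \<delta>"
    proof -
      have "c\<^sup>2 * of_real (l\<^sup>2) - 1 = c\<^sup>2 * of_real (l\<^sup>2 - 1) + (c\<^sup>2 - 1)" by (simp add: algebra_simps)
      also have "norm \<dots> \<le> norm (c\<^sup>2 * of_real (l\<^sup>2 - 1)) + norm (c\<^sup>2 - 1)" by (rule norm_triangle_ineq)
      also have "norm (c\<^sup>2 * of_real (l\<^sup>2 - 1)) = l\<^sup>2 - 1"
        unfolding norm_mult norm_power c norm_of_real using l2 by simp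
      finally show ?thesis using l\<delta> c2 by linarith
    qed
    have cY: "norm (c\<^sup>2 / of_real l - 1) \<le> 14 * \<delta>"
    proof -
      have "c\<^sup>2 / of_real l - 1 = - (c\<^sup>2 * of_real (1 - 1 / l)) + (c\<^sup>2 - 1)" by (simp add: algebra_simps)
      also have "norm \<dots> \<le> norm (c\<^sup>2 * of_real (1 - 1 / l)) + norm (c\<^sup>2 - 1)"
        by (rule order_trans[OF norm_triangle_ineq]) simp
      also have "norm (c\<^sup>2 * of_real (1 - 1 / l)) = 1 - 1 / l"
        unfolding norm_mult norm_power c norm_of_real using l by simp
      also have "1 - 1 / l \<le> l\<^sup>2 - 1"
      proof -
        have "(l - 1) / l \<le> (l - 1) / 1" using l(1) by (intro frac_le) auto
        then have "1 - 1 / l \<le> l - 1" using l(1) by (simp add: diff_divide_distrib)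
        then show ?thesis using l2 by simp
      qed
      finally show ?thesis using l\<delta> c2 by linarith
    qed
    have kp: "kep_phase (1 / (2 * sqrt ((norm \<alpha>)\<^sup>2 + (norm \<beta>)\<^sup>2))) \<alpha> \<beta> = (vec2 X0, vec2 Y0)"
      unfolding a_def[symmetric] \<Omega>_def[symmetric] by (simp add: kep_phase_def X0_def Y0_def)
    have "\<gamma> 0 = (vec2 ((c\<^sup>2 * of_real (l\<^sup>2)) * X0), vec2 ((c\<^sup>2 / of_real l) * Y0))"
      unfolding \<gamma>0 \<alpha>1_def \<beta>1_def X0_def Y0_def using c l by (intro kep_phase_scale) auto
    then have "\<gamma> 0 - (vec2 X0, vec2 Y0) = (vec2 ((c\<^sup>2 * of_real (l\<^sup>2) - 1) * X0), vec2 ((c\<^sup>2 / of_real l - 1) * Y0))"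
      by (simp add: vec2_diff algebra_simps)
    then have "norm (\<gamma> 0 - (vec2 X0, vec2 Y0)) \<le> norm ((c\<^sup>2 * of_real (l\<^sup>2) - 1) * X0) + norm ((c\<^sup>2 / of_real l - 1) * Y0)"
      using norm_Pair_le[of "vec2 ((c\<^sup>2 * of_real (l\<^sup>2) - 1) * X0)" "vec2 ((c\<^sup>2 / of_real l - 1) * Y0)"] by simp
    also have "\<dots> \<le> (14 * \<delta>) * M\<^sup>2 + (14 * \<delta>) * (2 * M / \<kappa>)"
      unfolding norm_mult using cX cY X0 Y0 \<delta> by (intro add_mono mult_mono) auto
    also have "\<dots> = C1 * \<delta>" by (simp add: C1_def algebra_simps)
    finally have start: "norm (\<gamma> 0 - (vec2 X0, vec2 Y0)) \<le> C1 * \<delta>" .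
    have close: "norm (\<gamma> T - \<gamma> 0) \<le> C2 * \<delta>"
    proof -
      have "20 * (2 * M + 1) / (\<kappa> / 2)\<^sup>2 * \<epsilon> = C2 * \<epsilon>" by (simp add: C2_def power_divide)
      also have "\<dots> \<le> C2 * \<delta>" using C12 \<epsilon>\<delta> by (intro mult_left_mono)
      finally show ?thesis using ret by simp
    qed
    have "norm (\<gamma> T - (vec2 X0, vec2 Y0)) \<le> norm (\<gamma> T - \<gamma> 0) + norm (\<gamma> 0 - (vec2 X0, vec2 Y0))"
      using dist_triangle[of "\<gamma> T" "(vec2 X0, vec2 Y0)" "\<gamma> 0"] by (simp only: dist_norm)
    then have fin: "norm (\<gamma> T - (vec2 X0, vec2 Y0)) \<le> C2 * \<delta> + C1 * \<delta>" using start close by simp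
    have "norm (fst (\<gamma> T') - vec2 (of_real (1 - \<mu>))) \<le> 9 * \<delta>"
    proof -
      have eq: "fst (\<gamma> T') - vec2 (of_real (1 - \<mu>)) = (fst (\<gamma> T') - vec2 1) + vec2 (of_real \<mu>)"
        by (simp add: vec2_diff)
      have "norm (fst (\<gamma> T') - vec2 (of_real (1 - \<mu>))) \<le> norm (fst (\<gamma> T') - vec2 1) + \<mu>"
        unfolding eq using norm_triangle_ineq[of "fst (\<gamma> T') - vec2 1" "vec2 (of_real \<mu>)"] \<mu> by simp
      also have "\<dots> \<le> 7 * (1 / real N) + \<epsilon> + \<mu>" using coll by simp
      finally show ?thesis using Nd \<epsilon>\<delta> \<mu> by linarith
    qed
    moreover have "9 * \<delta> \<le> C * \<delta>" "C1 * \<delta> < C * \<delta>" "C2 * \<delta> + C1 * \<delta> < C * \<delta>"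
    proof -
      have "C * \<delta> = C1 * \<delta> + C2 * \<delta> + 10 * \<delta>" by (simp add: C_def algebra_simps)
      moreover have "0 \<le> C1 * \<delta>" "0 \<le> C2 * \<delta>" using C12 \<delta> by simp_all
      ultimately show "9 * \<delta> \<le> C * \<delta>" "C1 * \<delta> < C * \<delta>" "C2 * \<delta> + C1 * \<delta> < C * \<delta>"
        using \<delta> by linarith+
    qed
    ultimately show ?thesis
      using T orb start fin unfolding kp \<mu>_def[symmetric]
      by (intro exI[of _ \<gamma>] exI[of _ T'] exI[of _ T]) auto
  qed
  ultimately show ?thesis by (rule that)
qed

section \<open>Orbital elements and the theorem\<close>

text \<open>The square of \<open>orb_L\<close> for negative energy, in a closed form whose
  continuity is visible. \<open>ecc\<close> is the matching form of \<open>orb_e\<close>.\<close>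

definition semi_axis :: "phase \<Rightarrow> real" where
  "semi_axis z = - 1 / (2 * kepler_energy z)"

definition ecc :: "phase \<Rightarrow> real" where
  "ecc z = sqrt (1 - (orb_G z)\<^sup>2 / semi_axis z)"

lemma orb_L_eq:
  assumes "kepler_energy z < 0"
  shows "orb_L z = sqrt (semi_axis z)"
  unfolding orb_L_def
proof (rule the_equality)
  have a: "0 < semi_axis z" using assms by (simp add: semi_axis_def divide_less_0_iff)
  then show "0 < sqrt (semi_axis z) \<and> - 1 / (2 * (sqrt (semi_axis z))\<^sup>2) = kepler_energy z"
    using assms by (simp add: semi_axis_def)
  fix L assume L: "0 < L \<and> - 1 / (2 * L\<^sup>2) = kepler_energy z"
  then have "kepler_energy z = - 1 / (2 * L\<^sup>2)" by simp
  then have "L\<^sup>2 = semi_axis z" by (simp add: semi_axis_def)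
  then show "L = sqrt (semi_axis z)" using L by (metis real_sqrt_unique less_imp_le)
qed

text \<open>With a the semimajor axis, G^2 = a (1 - e) (1 + e), so the middle conditions of
  \<open>V_set\<close> say that the pericentre distance a (1 - e) is below 1 and the apocentre
  distance a (1 + e) above it. G \<noteq> 0 makes the former positive.\<close>

lemma V_setD:
  assumes "z \<in> V_set"
  shows "fst z \<noteq> 0" "kepler_energy z < 0" "0 < semi_axis z" "(orb_G z)\<^sup>2 \<le> semi_axis z"
    "0 < semi_axis z * (1 - ecc z)" "semi_axis z * (1 - ecc z) < 1" "1 < semi_axis z * (1 + ecc z)"
proof -
  show h: "kepler_energy z < 0" using assms by (simp add: V_set_def)
  show "fst z \<noteq> 0"
  proof
    assume "fst z = 0"
    then have "0 \<le> kepler_energy z" by (cases z) (simp add: kepler_energy_def)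
    then show False using h by simp
  qed
  show a: "0 < semi_axis z" using h by (simp add: semi_axis_def divide_less_0_iff)
  have L: "orb_L z = sqrt (semi_axis z)" by (rule orb_L_eq[OF h])
  have e: "orb_e z = ecc z" using a by (simp add: orb_e_def ecc_def L)
  have G: "orb_G z \<noteq> 0" "\<bar>orb_G z\<bar> < sqrt (semi_axis z)"
    and c: "(orb_G z)\<^sup>2 / (1 + ecc z) < 1" "1 < (orb_G z)\<^sup>2 / (1 - ecc z)"
    using assms unfolding V_set_def mem_Collect_eq L e by auto
  have "\<bar>orb_G z\<bar>\<^sup>2 < (sqrt (semi_axis z))\<^sup>2" using G(2) by (intro power_strict_mono) auto
  then have G2: "(orb_G z)\<^sup>2 < semi_axis z" using a by simp
  then show "(orb_G z)\<^sup>2 \<le> semi_axis z" by simp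
  have q: "0 < (orb_G z)\<^sup>2 / semi_axis z" "(orb_G z)\<^sup>2 / semi_axis z < 1" using G G2 a by auto
  have e1: "0 \<le> ecc z" "ecc z < 1" using q by (auto simp: ecc_def)
  have "(ecc z)\<^sup>2 = 1 - (orb_G z)\<^sup>2 / semi_axis z" using q by (simp add: ecc_def)
  then have G2e: "(orb_G z)\<^sup>2 = semi_axis z * (1 - ecc z) * (1 + ecc z)"
    using a by (simp add: field_simps power2_eq_square)
  show "0 < semi_axis z * (1 - ecc z)" using a e1 by simp
  show "semi_axis z * (1 - ecc z) < 1" using c(1) e1 unfolding G2e by simp
  show "1 < semi_axis z * (1 + ecc z)" using c(2) e1 unfolding G2e by simp
qed

text \<open>Inverting the Levi-Civita map: \<alpha> + \<beta> is a complex square root of the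
  position, and \<alpha> - \<beta> is determined by the momentum. The squares of the difference and
  of the sum of the moduli are the pericentre and apocentre distances.\<close>

lemma kep_phase_surj:
  assumes "z \<in> V_set"
  obtains \<alpha> \<beta> where "(norm \<alpha>)\<^sup>2 + (norm \<beta>)\<^sup>2 = semi_axis z"
    "kep_phase (1 / (2 * sqrt (semi_axis z))) \<alpha> \<beta> = z"
    "(norm \<alpha> - norm \<beta>)\<^sup>2 = semi_axis z * (1 - ecc z)" "(norm \<alpha> + norm \<beta>)\<^sup>2 = semi_axis z * (1 + ecc z)"
proof -
  define a where "a = semi_axis z"
  define \<Omega> where "\<Omega> = 1 / (2 * sqrt a)"
  note V = V_setD[OF assms]
  have a0: "0 < a" using V(3) by (simp add: a_def)
  have \<Omega>0: "0 < \<Omega>" "\<Omega>\<^sup>2 = 1 / (4 * a)" using a0 by (simp_all add: \<Omega>_def power_divide power_mult_distrib)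
  obtain x y where z: "z = (vec2 x, vec2 y)" by (metis vec2_surj surj_pair)
  have x0: "x \<noteq> 0" using V(1) z by (auto simp: vec_eq_iff forall_2 complex_eq_iff)
  define \<zeta> where "\<zeta> = csqrt x"
  define w where "w = cnj \<zeta> * y / 2"
  define q where "q = w / (\<i> * of_real \<Omega>)"
  have \<zeta>2: "\<zeta>\<^sup>2 = x" by (simp add: \<zeta>_def)
  then have \<zeta>0: "\<zeta> \<noteq> 0" using x0 by auto
  have n\<zeta>: "(norm \<zeta>)\<^sup>2 = norm x" using \<zeta>2 by (metis norm_power)
  define \<alpha> \<beta> where "\<alpha> = (\<zeta> + q) / 2" and "\<beta> = (\<zeta> - q) / 2"
  have ab: "\<alpha> + \<beta> = \<zeta>" "\<alpha> - \<beta> = q" by (simp_all add: \<alpha>_def \<beta>_def field_simps)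
  have ph: "kep_phase \<Omega> \<alpha> \<beta> = z"
  proof -
    have "2 * (\<i> * of_real \<Omega> * q) / cnj \<zeta> = y" using \<Omega>0 \<zeta>0 by (simp add: q_def w_def)
    then show ?thesis unfolding kep_phase_def ab by (simp add: \<zeta>2 z)
  qed
  have sum: "(norm \<alpha>)\<^sup>2 + (norm \<beta>)\<^sup>2 = ((norm \<zeta>)\<^sup>2 + (norm q)\<^sup>2) / 2"
    unfolding \<alpha>_def \<beta>_def cmod_power2 by (simp add: power2_eq_square field_simps)
  have dif: "(norm \<alpha>)\<^sup>2 - (norm \<beta>)\<^sup>2 = Re (\<zeta> * cnj q)"
    unfolding \<alpha>_def \<beta>_def cmod_power2 by (simp add: power2_eq_square field_simps)
  have h: "a * ((norm y)\<^sup>2 / 2 - 1 / norm x) = - 1 / 2"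
    using V(2) unfolding a_def semi_axis_def by (simp add: z kepler_energy_def)
  have nq: "(norm q)\<^sup>2 = norm x * (norm y)\<^sup>2 * a"
  proof -
    have "(norm q)\<^sup>2 = (norm \<zeta>)\<^sup>2 * (norm y)\<^sup>2 / 4 / \<Omega>\<^sup>2"
      by (simp add: q_def w_def norm_divide norm_mult power_divide power_mult_distrib)
    then show ?thesis using a0 by (simp add: n\<zeta> \<Omega>0)
  qed
  have s: "(norm \<alpha>)\<^sup>2 + (norm \<beta>)\<^sup>2 = a"
  proof -
    have "norm x * (norm y)\<^sup>2 * a = 2 * norm x * (a * ((norm y)\<^sup>2 / 2 - 1 / norm x)) + 2 * a"
      using x0 by (simp add: field_simps)
    also have "\<dots> = 2 * a - norm x" unfolding h by simp
    finally show ?thesis unfolding sum nq n\<zeta> by simp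
  qed
  \<comment> \<open>The difference of the squared moduli is the angular momentum divided by 2
    \<Omega>.\<close>
  have G: "((norm \<alpha>)\<^sup>2 - (norm \<beta>)\<^sup>2)\<^sup>2 = a * (orb_G z)\<^sup>2"
  proof -
    have "\<zeta> * cnj q = \<i> * (\<zeta>\<^sup>2 * cnj y) / (2 * of_real \<Omega>)"
      using \<Omega>0 by (simp add: q_def w_def field_simps power2_eq_square)
    then have "Re (\<zeta> * cnj q) = Re (\<i> * (x * cnj y) / of_real (2 * \<Omega>))" by (simp add: \<zeta>2)
    also have "\<dots> = orb_G z / (2 * \<Omega>)"
      unfolding Re_divide_of_real by (simp add: orb_G_def z algebra_simps)
    finally have "((norm \<alpha>)\<^sup>2 - (norm \<beta>)\<^sup>2)\<^sup>2 = (orb_G z)\<^sup>2 / (4 * \<Omega>\<^sup>2)"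
      unfolding dif by (simp add: power_divide power_mult_distrib)
    then show ?thesis using a0 by (simp add: \<Omega>0)
  qed
  \<comment> \<open>Sum 2 a and product a G^2 determine the two apsidal distances as roots of one
    quadratic; \<open>P \<le> Q\<close> decides which is which.\<close>
  define P Q where "P = (norm \<alpha> - norm \<beta>)\<^sup>2" and "Q = (norm \<alpha> + norm \<beta>)\<^sup>2"
  have PQ: "P + Q = 2 * a" "P * Q = a * (orb_G z)\<^sup>2" "P \<le> Q"
  proof -
    show "P + Q = 2 * a" unfolding s[symmetric] P_def Q_def by (simp add: power2_eq_square algebra_simps)
    have "P * Q = ((norm \<alpha> - norm \<beta>) * (norm \<alpha> + norm \<beta>))\<^sup>2" by (simp add: P_def Q_def power_mult_distrib)
    also have "(norm \<alpha> - norm \<beta>) * (norm \<alpha> + norm \<beta>) = (norm \<alpha>)\<^sup>2 - (norm \<beta>)\<^sup>2"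
      by (simp add: power2_eq_square algebra_simps)
    finally show "P * Q = a * (orb_G z)\<^sup>2" using G by simp
    show "P \<le> Q" by (simp add: P_def Q_def power2_eq_square algebra_simps)
  qed
  have e2: "(ecc z)\<^sup>2 = 1 - (orb_G z)\<^sup>2 / a" "0 \<le> ecc z"
    using V(3,4) by (simp_all add: ecc_def a_def)
  have "(Q - a)\<^sup>2 = (a * ecc z)\<^sup>2"
  proof -
    have "(Q - a)\<^sup>2 = a\<^sup>2 - P * Q" using PQ(1) by (simp add: power2_eq_square algebra_simps flip: distrib_left) algebra
    also have "\<dots> = a\<^sup>2 * (ecc z)\<^sup>2" unfolding PQ(2) e2 using a0 by (simp add: field_simps power2_eq_square)
    finally show ?thesis by (simp add: power_mult_distrib)
  qed
  moreover have "0 \<le> Q - a" using PQ by simp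
  moreover have "0 \<le> a * ecc z" using a0 e2 by simp
  ultimately have "Q - a = a * ecc z" by (simp add: power2_eq_iff_nonneg)
  then have "Q = a * (1 + ecc z)" "P = a * (1 - ecc z)" using PQ(1) by (simp_all add: algebra_simps)
  then show ?thesis using that[of \<alpha> \<beta>] s ph unfolding P_def Q_def \<Omega>_def a_def by simp
qed

lemma continuous_on_V_set:
  "continuous_on V_set semi_axis" "continuous_on V_set ecc"
proof -
  have "continuous_on V_set (\<lambda>z. (norm (snd z))\<^sup>2 / 2 - 1 / norm (fst z))"
    using V_setD(1) by (intro continuous_intros) auto
  then have h: "continuous_on V_set kepler_energy" by (simp add: kepler_energy_def case_prod_beta)
  show a: "continuous_on V_set semi_axis"
    unfolding semi_axis_def[abs_def] using V_setD(2) by (intro continuous_intros h) (metis less_irrefl mult_eq_0_iff zero_neq_numeral)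
  have nz: "\<forall>z\<in>V_set. semi_axis z \<noteq> 0" using V_setD(3) by fastforce
  have "continuous_on V_set (\<lambda>z. fst z $ 1 * snd z $ 2 - fst z $ 2 * snd z $ 1)"
    by (intro continuous_intros)
  then have "continuous_on V_set orb_G" by (simp add: orb_G_def case_prod_beta)
  then show "continuous_on V_set ecc"
    unfolding ecc_def[abs_def] by (intro continuous_intros a nz)
qed

lemma compact_positive_lower_bound:
  fixes f :: "'a::topological_space \<Rightarrow> real"
  assumes "compact K" "continuous_on K f" "\<And>z. z \<in> K \<Longrightarrow> 0 < f z"
  obtains \<kappa> where "0 < \<kappa>" "\<And>z. z \<in> K \<Longrightarrow> \<kappa> \<le> f z"
proof (cases "K = {}")
  case True
  then show ?thesis using that[of 1] by simp
next
  case False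
  then obtain x where "x \<in> K" "\<And>z. z \<in> K \<Longrightarrow> f x \<le> f z"
    using continuous_attains_inf[OF assms(1) False assms(2)] by auto
  then show ?thesis using that[of "f x"] assms(3) by auto
qed

theorem theorem1p7:
  fixes K :: "phase set"
  assumes "compact K" and "K \<subseteq> V_set"
  shows "\<exists>C>0. \<exists>\<mu>0>0. \<forall>\<mu>. 0 < \<mu> \<and> \<mu> < \<mu>0 \<longrightarrow>
           (\<forall>z\<in>interior K.
              non_wandering (rc3bp_flow \<mu>) (C * \<mu> powr (1/20)) z \<and>
              (\<exists>V T' T.
                 z \<in> interior V \<and> V \<subseteq> ball z (C * \<mu> powr (1/20)) \<and>
                 0 < T' \<and> T' < T \<and>
                 rc3bp_flow \<mu> T' V \<noteq> {} \<and>
                 setdist (rc3bp_flow \<mu> T' V) (collision_set \<mu>) \<le> C * \<mu> powr (1/20) \<and>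
                 rc3bp_flow \<mu> T V \<inter> V \<noteq> {}))"
proof -
  have cK: "continuous_on K semi_axis" "continuous_on K ecc"
    using continuous_on_V_set assms(2) by (auto intro: continuous_on_subset)
  note KV = V_setD[OF subsetD[OF assms(2)]]
  \<comment> \<open>Compactness makes three strict inequalities uniform: the pericentre is away from
    the origin, it lies inside the unit circle, and the apocentre lies outside.\<close>
  obtain \<kappa>1 where \<kappa>1: "0 < \<kappa>1" "\<And>z. z \<in> K \<Longrightarrow> \<kappa>1 \<le> semi_axis z * (1 - ecc z)"
    by (rule compact_positive_lower_bound[OF assms(1), of "\<lambda>z. semi_axis z * (1 - ecc z)"])
      (use KV(5) cK in \<open>auto intro!: continuous_intros\<close>)
  obtain \<kappa>2 where \<kappa>2: "0 < \<kappa>2" "\<And>z. z \<in> K \<Longrightarrow> \<kappa>2 \<le> 1 - semi_axis z * (1 - ecc z)"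
    by (rule compact_positive_lower_bound[OF assms(1), of "\<lambda>z. 1 - semi_axis z * (1 - ecc z)"])
      (use KV(6) cK in \<open>auto intro!: continuous_intros\<close>)
  obtain \<kappa>3 where \<kappa>3: "0 < \<kappa>3" "\<And>z. z \<in> K \<Longrightarrow> \<kappa>3 \<le> semi_axis z * (1 + ecc z) - 1"
    by (rule compact_positive_lower_bound[OF assms(1), of "\<lambda>z. semi_axis z * (1 + ecc z) - 1"])
      (use KV(7) cK in \<open>auto intro!: continuous_intros\<close>)
  have "bounded ((\<lambda>z. semi_axis z * (1 + ecc z)) ` K)"
    using cK assms(1) by (intro compact_imp_bounded compact_continuous_image continuous_intros)
  then obtain R where R: "\<And>z. z \<in> K \<Longrightarrow> \<bar>semi_axis z * (1 + ecc z)\<bar> \<le> R"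
    unfolding bounded_iff by auto
  define \<kappa> where "\<kappa> = Min {\<kappa>1, \<kappa>2, \<kappa>3, 1}"
  have \<kappa>: "0 < \<kappa>" "\<kappa> \<le> 1" "\<kappa> \<le> \<kappa>1" "\<kappa> \<le> \<kappa>2" "\<kappa> \<le> \<kappa>3"
    using \<kappa>1 \<kappa>2 \<kappa>3 by (auto simp: \<kappa>_def)
  \<comment> \<open>\<open>R\<close> bounds the square of the sum of the moduli, and
    \<open>M\<close> at least 1 gives R \<le> M^2, so no square root is needed.\<close>
  define M where "M = max R 1"
  have M: "1 \<le> M" "R \<le> M\<^sup>2"
  proof -
    show M1: "1 \<le> M" by (simp add: M_def)
    have "R \<le> M * 1" by (simp add: M_def)
    also have "\<dots> \<le> M\<^sup>2" using M1 unfolding power2_eq_square by (intro mult_left_mono) auto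
    finally show "R \<le> M\<^sup>2" .
  qed
  obtain C \<delta>0 where C: "0 < C" and \<delta>0: "0 < \<delta>0" and main: "\<And>\<delta> \<alpha> \<beta>. \<lbrakk>0 < \<delta>; \<delta> < \<delta>0;
    \<kappa> \<le> (norm \<alpha> - norm \<beta>)\<^sup>2; (norm \<alpha> - norm \<beta>)\<^sup>2 \<le> 1 - \<kappa>; 1 + \<kappa> \<le> (norm \<alpha> + norm \<beta>)\<^sup>2;
    norm \<alpha> + norm \<beta> \<le> M\<rbrakk> \<Longrightarrow>
    \<exists>\<gamma> T' T. 0 < T' \<and> T' < T \<and> 1 < T \<and>
       hamiltonian_orbit (rc3bp_H (\<delta> ^ 20)) (rc3bp_domain (\<delta> ^ 20)) T' \<gamma> \<and>
       hamiltonian_orbit (rc3bp_H (\<delta> ^ 20)) (rc3bp_domain (\<delta> ^ 20)) T \<gamma> \<and>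
       norm (\<gamma> 0 - kep_phase (1 / (2 * sqrt ((norm \<alpha>)\<^sup>2 + (norm \<beta>)\<^sup>2))) \<alpha> \<beta>) < C * \<delta> \<and>
       norm (\<gamma> T - kep_phase (1 / (2 * sqrt ((norm \<alpha>)\<^sup>2 + (norm \<beta>)\<^sup>2))) \<alpha> \<beta>) < C * \<delta> \<and>
       norm (fst (\<gamma> T') - vec2 (of_real (1 - \<delta> ^ 20))) \<le> C * \<delta>"
  proof (rule near_collision_and_return[OF \<kappa>(1,2) M(1)], goal_cases)
    case (1 C \<delta>0)
    show ?case by (rule that[of C \<delta>0, OF 1(2-)])
  qed
  have "non_wandering (rc3bp_flow \<mu>) (C * \<mu> powr (1/20)) z \<and>
      (\<exists>V T' T. z \<in> interior V \<and> V \<subseteq> ball z (C * \<mu> powr (1/20)) \<and> 0 < T' \<and> T' < T \<and>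
         rc3bp_flow \<mu> T' V \<noteq> {} \<and>
         setdist (rc3bp_flow \<mu> T' V) (collision_set \<mu>) \<le> C * \<mu> powr (1/20) \<and>
         rc3bp_flow \<mu> T V \<inter> V \<noteq> {})"
    if \<mu>: "0 < \<mu>" "\<mu> < \<delta>0 ^ 20" and z: "z \<in> interior K" for \<mu> z
  proof -
    define \<delta> where "\<delta> = \<mu> powr (1/20)"
    have \<delta>20: "\<delta> ^ 20 = \<mu>" using \<mu> by (simp add: \<delta>_def powr_power)
    have \<delta>: "0 < \<delta>" using \<mu> by (simp add: \<delta>_def)
    have "\<delta> < \<delta>0" using \<mu>(2) \<delta>0 unfolding \<delta>20[symmetric] by (rule power_less_imp_less_base[OF _ less_imp_le])
    have zK: "z \<in> K" using z interior_subset by blast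
    obtain \<alpha> \<beta> where ab: "(norm \<alpha>)\<^sup>2 + (norm \<beta>)\<^sup>2 = semi_axis z"
      "kep_phase (1 / (2 * sqrt (semi_axis z))) \<alpha> \<beta> = z"
      "(norm \<alpha> - norm \<beta>)\<^sup>2 = semi_axis z * (1 - ecc z)" "(norm \<alpha> + norm \<beta>)\<^sup>2 = semi_axis z * (1 + ecc z)"
      using kep_phase_surj zK assms(2) by blast
    have "norm \<alpha> + norm \<beta> \<le> M"
    proof (rule power2_le_imp_le)
      show "(norm \<alpha> + norm \<beta>)\<^sup>2 \<le> M\<^sup>2" unfolding ab(4) using R[OF zK] M(2) by simp
    qed (use M in simp)
    then obtain \<gamma> T' T where T: "0 < T'" "T' < T" "1 < T"
      and orb: "hamiltonian_orbit (rc3bp_H \<mu>) (rc3bp_domain \<mu>) T' \<gamma>"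
       "hamiltonian_orbit (rc3bp_H \<mu>) (rc3bp_domain \<mu>) T \<gamma>"
      and near: "norm (\<gamma> 0 - z) < C * \<delta>" "norm (\<gamma> T - z) < C * \<delta>"
      and coll: "norm (fst (\<gamma> T') - vec2 (of_real (1 - \<mu>))) \<le> C * \<delta>"
      using main[OF \<delta> \<open>\<delta> < \<delta>0\<close>, of \<alpha> \<beta>] \<kappa> \<kappa>1(2)[OF zK] \<kappa>2(2)[OF zK] \<kappa>3(2)[OF zK]
      unfolding ab \<delta>20 by auto
    have mem: "\<gamma> 0 \<in> ball z (C * \<delta>)" "\<gamma> T \<in> ball z (C * \<delta>)"
      using near by (simp_all add: dist_norm norm_minus_commute)
    have flow: "\<gamma> T \<in> rc3bp_flow \<mu> T W" "\<gamma> T' \<in> rc3bp_flow \<mu> T' W" if "ball z (C * \<delta>) \<subseteq> W" for W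
      using orb mem that by (auto simp: rc3bp_flow_def hamiltonian_flow_def)
    \<comment> \<open>One orbit serves all admissible neighborhoods: each contains the ball, hence
      both \<open>\<gamma> 0\<close> and \<open>\<gamma> T\<close>.\<close>
    have "non_wandering (rc3bp_flow \<mu>) (C * \<delta>) z"
      unfolding non_wandering_def using T(3) flow(1) mem(2) by blast
    moreover have "setdist (rc3bp_flow \<mu> T' (ball z (C * \<delta>))) (collision_set \<mu>) \<le> C * \<delta>"
    proof -
      \<comment> \<open>The collision set leaves the momentum free; taking that of
        \<open>\<gamma> T'\<close> reduces the distance to that of the positions.\<close>
      have "(vec2 (of_real (1 - \<mu>)), snd (\<gamma> T')) \<in> collision_set \<mu>"
        by (simp add: collision_set_def vector_eq_vec2 complex_of_real_def)
      then have "setdist (rc3bp_flow \<mu> T' (ball z (C * \<delta>))) (collision_set \<mu>)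
          \<le> dist (\<gamma> T') (vec2 (of_real (1 - \<mu>)), snd (\<gamma> T'))"
        by (intro setdist_le_dist flow(2)) auto
      also have "\<dots> = norm (fst (\<gamma> T') - vec2 (of_real (1 - \<mu>)))"
        by (cases "\<gamma> T'") (simp add: dist_Pair_Pair dist_norm)
      finally show ?thesis using coll by simp
    qed
    moreover have "z \<in> interior (ball z (C * \<delta>))" using C \<delta> by simp
    ultimately show ?thesis
      unfolding \<delta>_def[symmetric] using T flow[OF subset_refl] mem
      by (intro conjI exI[of _ "ball z (C * \<delta>)"] exI[of _ T'] exI[of _ T]) auto
  qed
  moreover have "0 < \<delta>0 ^ 20" using \<delta>0 by simp
  ultimately show ?thesis using C by blast
qed

end
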